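(* Assume that $R_\nu$ is a principal ideal domain. Let $\Delta$ be a lattice in $K_\nu^n$. Then for any $\Delta$-rational subspaces $L$ and $M$ of $K_\nu^n$, $$d_{\Delta}(L)\,d_{\Delta}(M) \geq d_{\Delta}(L \cap M)\,d_{\Delta}(L + M),$$ or equivalently, $$\mathrm{Covol}(L \cap \Delta)\, \mathrm{Covol}(M \cap \Delta) \geq \mathrm{Covol}(L \cap M \cap \Delta)\, \mathrm{Covol}((L+M) \cap \Delta).$$
   Context: Setting: $K$ is the function field of a geometrically connected smooth projective curve $\mathbf{C}$ of genus $g$ over a finite field $\mathbb{F}_q$. Fix a discrete valuation $\nu$ on $K$ (normalized, i.e. there is $\pi_\nu\in K$ with $\nu(\pi_\nu)=1$); $K_\nu$ is the completion of $K$ at $\nu$, $\mathcal{O}_\nu$ its valuation ring, $k_\nu=\mathcal{O}_\nu/\pi_\nu\mathcal{O}_\nu$, $q_\nu$ the cardinality of $k_\nu$, and $|x|=q_\nu^{-\nu(x)}$ for $x\in K_\nu$ (with $|0|=0$). $R_\nu$ is the affine algebra of the affine curve $\mathbf{C}-\{\nu\}$ (functions in $K$ regular away from $\nu$); it is a discrete subring of $K_\nu$. Let $n$ be a positive integer. Norm: let $\mathbf{e}_1,\dots,\mathbf{e}_n$ be the standard basis of $K_\nu^n$. For $I=\{\iota_1<\dots<\iota_i\}\subseteq\{1,\dots,n\}$ put $\mathbf{e}_I=\mathbf{e}_{\iota_1}\wedge\dots\wedge\mathbf{e}_{\iota_i}$. For $\mathbf{v}=\sum_{I}c_I\mathbf{e}_I\in\bigwedge^i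 K_\nu^n$ (sum over subsets $I$ with $i$ elements), $\|\mathbf{v}\|=\max_I|c_I|$. Lattices: let $V$ be a $K_\nu$-subspace of $K_\nu^n$ and $\Delta$ a discrete $R_\nu$-module contained in $V$. An $R_\nu$-basis of $\Delta$ is a basis of $\Delta$ over $R_\nu$ which is also linearly independent over $K_\nu$. The rank of $\Delta$ is $\dim_{K_\nu}\mathrm{span}_{K_\nu}(\Delta)$. $\Delta$ is a lattice in $V$ if it has an $R_\nu$-basis and its rank equals $\dim_{K_\nu}(V)$. Given a lattice $\Delta$ in $V$, a subspace $W$ of $V$ is $\Delta$-rational if $W\cap\Delta$ is a lattice in $W$; then $d_\Delta(W)=\|\mathbf{w}_1\wedge\dots\wedge\mathbf{w}_i\|$ for any $R_\nu$-basis $\{\mathbf{w}_1,\dots,\mathbf{w}_i\}$ of $W\cap\Delta$ (this is independent of the basis), and $d_\Delta(\{0\})=1$. The covolume of a lattice $\Lambda$ in a subspace $V\subseteq K_\nu^n$ is $\mathrm{Covol}(\Lambda)=q^{(g-1)\dim(V)}d_\Lambda(V)$. (When $R_\nu$ is a principal ideal domain, sums and intersections of $\Delta$-rational subspaces are $\Delta$-rational, so all quantities in the claim are defined.) *)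

theory Defs
  imports "HOL-Analysis.Analysis" "HOL-Algebra.Ring_Divisibility"
begin

section \<open>Discrete valuations\<close>

text \<open>A valuation is an integer-valued function. Its value at \<open>0\<close>, which should be \<open>\<infinity>\<close>, is
  fixed to be \<open>0\<close>, so that equality of functions is equality of normalized valuations; every
  later definition therefore treats \<open>0\<close> separately.\<close>

definition discrete_valuation :: "('a::field \<Rightarrow> int) \<Rightarrow> bool" where
  "discrete_valuation v \<longleftrightarrow>
     v 0 = 0 \<and>
     (\<forall>x y. x \<noteq> 0 \<longrightarrow> y \<noteq> 0 \<longrightarrow> v (x * y) = v x + v y) \<and>
     (\<forall>x y. x \<noteq> 0 \<longrightarrow> y \<noteq> 0 \<longrightarrow> x + y \<noteq> 0 \<longrightarrow> min (v x) (v y) \<le> v (x + y)) \<and>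
     (\<exists>\<pi>. \<pi> \<noteq> 0 \<and> v \<pi> = 1)"

definition val_ring :: "('a::field \<Rightarrow> int) \<Rightarrow> 'a set" where
  "val_ring v = {x. x = 0 \<or> 0 \<le> v x}"

definition val_ideal :: "('a::field \<Rightarrow> int) \<Rightarrow> 'a set" where
  "val_ideal v = {x. x = 0 \<or> 0 < v x}"

definition residue_field :: "('a::field \<Rightarrow> int) \<Rightarrow> 'a set set" where
  "residue_field v =
     val_ring v // {(x, y). x \<in> val_ring v \<and> y \<in> val_ring v \<and> x - y \<in> val_ideal v}"

definition vabs :: "('a::field \<Rightarrow> int) \<Rightarrow> 'a \<Rightarrow> real" where
  "vabs v x = (if x = 0 then 0 else real (card (residue_field v)) powi (- v x))"

definition field_embedding :: "('a::field \<Rightarrow> 'b::field) \<Rightarrow> bool" where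
  "field_embedding h \<longleftrightarrow>
     h 1 = 1 \<and> (\<forall>x y. h (x + y) = h x + h y) \<and> (\<forall>x y. h (x * y) = h x * h y)"

definition is_completion ::
    "('a::field \<Rightarrow> int) \<Rightarrow> ('a \<Rightarrow> 'k::field) \<Rightarrow> ('k \<Rightarrow> int) \<Rightarrow> bool" where
  "is_completion v \<iota> w \<longleftrightarrow>
     field_embedding \<iota> \<and> discrete_valuation w \<and> (\<forall>x. w (\<iota> x) = v x) \<and>
     (\<forall>y. \<forall>e>0. \<exists>x. vabs w (y - \<iota> x) < e) \<and>
     (\<forall>X :: nat \<Rightarrow> 'k.
        (\<forall>e>0. \<exists>N. \<forall>m\<ge>N. \<forall>n\<ge>N. vabs w (X m - X n) < e) \<longrightarrow>
        (\<exists>l. \<forall>e>0. \<exists>N. \<forall>n\<ge>N. vabs w (X n - l) < e))"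


section \<open>Function fields of curves over a finite field\<close>

definition rational_subfield :: "('f::field \<Rightarrow> 'a::field) \<Rightarrow> 'a \<Rightarrow> 'a set" where
  "rational_subfield emb x =
     {poly (map_poly emb p) x / poly (map_poly emb r) x |p r. poly (map_poly emb r) x \<noteq> 0}"

text \<open>\<open>'a\<close> is, via \<open>emb\<close>, a finitely generated extension of \<open>'f\<close> of transcendence degree one in
  which \<open>'f\<close> is algebraically closed. For a finite field \<open>'f\<close> these are exactly the function fields
  of the smooth projective geometrically connected curves over \<open>'f\<close>, and such a curve is
  determined by its function field; its closed points are the normalized discrete valuations.
  (A discrete valuation is automatically trivial on the finite constant field.)\<close>

definition curve_function_field :: "('f::{field,finite} \<Rightarrow> 'a::field) \<Rightarrow> bool" where
  "curve_function_field emb \<longleftrightarrow>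
     field_embedding emb \<and>
     (\<exists>x. (\<forall>p. p \<noteq> 0 \<longrightarrow> poly (map_poly emb p) x \<noteq> 0) \<and>
          (\<exists>B. finite B \<and>
             (\<forall>y. \<exists>c. (\<forall>b\<in>B. c b \<in> rational_subfield emb x) \<and> y = (\<Sum>b\<in>B. c b * b)))) \<and>
     (\<forall>y. (\<exists>p. p \<noteq> 0 \<and> poly (map_poly emb p) y = 0) \<longrightarrow> y \<in> range emb)"

text \<open>The degree of a closed point is the dimension over \<open>'f\<close> of its residue field, expressed as the
  least number of elements of the valuation ring whose residue classes span the residue field.\<close>

definition place_degree :: "('f::{field,finite} \<Rightarrow> 'a::field) \<Rightarrow> ('a \<Rightarrow> int) \<Rightarrow> nat" where
  "place_degree emb P =
     (LEAST d. \<exists>B. B \<subseteq> val_ring P \<and> finite B \<and> card B = d \<and>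
        (\<forall>x\<in>val_ring P. \<exists>c. x - (\<Sum>b\<in>B. emb (c b) * b) \<in> val_ideal P))"

definition divisors :: "(('a::field \<Rightarrow> int) \<Rightarrow> int) set" where
  "divisors = {D. finite {P. D P \<noteq> 0} \<and> (\<forall>P. D P \<noteq> 0 \<longrightarrow> discrete_valuation P)}"

definition divisor_degree ::
    "('f::{field,finite} \<Rightarrow> 'a::field) \<Rightarrow> (('a \<Rightarrow> int) \<Rightarrow> int) \<Rightarrow> int" where
  "divisor_degree emb D = (\<Sum>P | D P \<noteq> 0. D P * int (place_degree emb P))"

definition riemann_roch_space :: "(('a::field \<Rightarrow> int) \<Rightarrow> int) \<Rightarrow> 'a set" where
  "riemann_roch_space D = {x. x = 0 \<or> (\<forall>P. discrete_valuation P \<longrightarrow> - D P \<le> P x)}"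

definition riemann_roch_dim ::
    "('f::{field,finite} \<Rightarrow> 'a::field) \<Rightarrow> (('a \<Rightarrow> int) \<Rightarrow> int) \<Rightarrow> nat" where
  "riemann_roch_dim emb D = vector_space.dim (\<lambda>c x. emb c * x) (riemann_roch_space D)"

text \<open>The usual definition of the genus of a function field. The set is nonempty and bounded
  above by Riemann's theorem, so the supremum is a maximum.\<close>

definition genus :: "('f::{field,finite} \<Rightarrow> 'a::field) \<Rightarrow> int" where
  "genus emb = (SUP D\<in>divisors. divisor_degree emb D - int (riemann_roch_dim emb D) + 1)"

text \<open>The affine algebra of the curve minus the point \<open>v\<close>.\<close>

definition affine_algebra :: "('a::field \<Rightarrow> int) \<Rightarrow> 'a ring" where
  "affine_algebra v =
     \<lparr>carrier = {x. \<forall>P. discrete_valuation P \<longrightarrow> P \<noteq> v \<longrightarrow> x \<in> val_ring P},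
      mult = (*), one = 1, zero = 0, add = (+)\<rparr>"


section \<open>The exterior algebra\<close>

text \<open>An element \<open>\<Sum>\<^sub>I c\<^sub>I e\<^sub>I\<close> of the exterior algebra of \<open>'k ^ 'n\<close> is represented by its coefficient
  function \<open>I \<mapsto> c\<^sub>I\<close>. For \<open>I\<close> and \<open>J\<close> disjoint, \<open>e\<^sub>I \<and> e\<^sub>J\<close> is the basis element of
  \<open>I \<union> J\<close>, with sign the parity of the number of inversions; otherwise it is \<open>0\<close>. The norm is the
  maximum over all \<open>I\<close>, which for an element of degree \<open>i\<close> is the maximum over the \<open>I\<close> with
  \<open>i\<close> elements, the other coefficients being \<open>0\<close>.\<close>

type_synonym ('k, 'n) exterior = "'n set \<Rightarrow> 'k"

definition wedge :: "('k::field, 'n::{finite,linorder}) exterior \<Rightarrow> ('k, 'n) exterior \<Rightarrow> ('k, 'n) exterior"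
  where "wedge u v =
    (\<lambda>S. \<Sum>I\<in>Pow S. (- 1) ^ card {(a, b). a \<in> I \<and> b \<in> S - I \<and> b < a} * u I * v (S - I))"

definition ext_one :: "('k::field, 'n) exterior" where
  "ext_one = (\<lambda>S. if S = {} then 1 else 0)"

definition ext_vec :: "'k::field ^ 'n::finite \<Rightarrow> ('k, 'n) exterior" where
  "ext_vec x = (\<lambda>S. \<Sum>i\<in>UNIV. if S = {i} then x $ i else 0)"

definition wedge_list :: "('k::field ^ 'n::{finite,linorder}) list \<Rightarrow> ('k, 'n) exterior" where
  "wedge_list ws = foldr (\<lambda>x u. wedge (ext_vec x) u) ws ext_one"

definition ext_norm :: "('k::field \<Rightarrow> int) \<Rightarrow> ('k, 'n::finite) exterior \<Rightarrow> real" where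
  "ext_norm w u = (MAX I. vabs w (u I))"


section \<open>Lattices\<close>

text \<open>Below \<open>R\<close> is a subring of the valued field \<open>('k, w)\<close>.\<close>

definition submodule_over :: "'k::field set \<Rightarrow> ('k ^ 'n::finite) set \<Rightarrow> bool" where
  "submodule_over R D \<longleftrightarrow>
     0 \<in> D \<and> (\<forall>x\<in>D. \<forall>y\<in>D. x + y \<in> D) \<and> (\<forall>r\<in>R. \<forall>x\<in>D. r *s x \<in> D)"

definition discrete_in :: "('k::field \<Rightarrow> int) \<Rightarrow> ('k ^ 'n::finite) set \<Rightarrow> bool" where
  "discrete_in w D \<longleftrightarrow>
     (\<forall>x\<in>D. \<exists>e>0. \<forall>y\<in>D. (\<forall>i. vabs w (y $ i - x $ i) < e) \<longrightarrow> y = x)"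

text \<open>Finiteness of \<open>B\<close> is no restriction, since only bases which are linearly independent over \<open>'k\<close>
  are used.\<close>

definition basis_over :: "'k::field set \<Rightarrow> ('k ^ 'n::finite) set \<Rightarrow> ('k ^ 'n) set \<Rightarrow> bool" where
  "basis_over R D B \<longleftrightarrow>
     finite B \<and>
     D = {\<Sum>b\<in>B. r b *s b |r. \<forall>b\<in>B. r b \<in> R} \<and>
     (\<forall>r. (\<forall>b\<in>B. r b \<in> R) \<and> (\<Sum>b\<in>B. r b *s b) = 0 \<longrightarrow> (\<forall>b\<in>B. r b = 0))"

definition lattice_basis :: "'k::field set \<Rightarrow> ('k ^ 'n::finite) set \<Rightarrow> ('k ^ 'n) set \<Rightarrow> bool" where
  "lattice_basis R D B \<longleftrightarrow> basis_over R D B \<and> vec.independent B"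

definition lattice_rank :: "('k::field ^ 'n::finite) set \<Rightarrow> nat" where
  "lattice_rank D = vec.dim (vec.span D)"

definition is_lattice ::
    "('k::field \<Rightarrow> int) \<Rightarrow> 'k set \<Rightarrow> ('k ^ 'n::finite) set \<Rightarrow> ('k ^ 'n) set \<Rightarrow> bool" where
  "is_lattice w R D V \<longleftrightarrow>
     vec.subspace V \<and> D \<subseteq> V \<and> submodule_over R D \<and> discrete_in w D \<and>
     (\<exists>B. lattice_basis R D B) \<and> lattice_rank D = vec.dim V"

definition rational_subspace ::
    "('k::field \<Rightarrow> int) \<Rightarrow> 'k set \<Rightarrow> ('k ^ 'n::finite) set \<Rightarrow> ('k ^ 'n) set \<Rightarrow> bool" where
  "rational_subspace w R D W \<longleftrightarrow> vec.subspace W \<and> is_lattice w R (W \<inter> D) W"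

text \<open>Meaningful for rational subspaces \<open>W\<close>; the value does not depend on the chosen basis or its
  ordering.\<close>

definition lattice_d ::
    "('k::field \<Rightarrow> int) \<Rightarrow> 'k set \<Rightarrow> ('k ^ 'n::{finite,linorder}) set \<Rightarrow> ('k ^ 'n::{finite,linorder}) set \<Rightarrow> real" where
  "lattice_d w R D W =
     (if W = {0} then 1
      else ext_norm w (wedge_list (SOME ws. distinct ws \<and> lattice_basis R (W \<inter> D) (set ws))))"

text \<open>A lattice in \<open>V\<close> spans \<open>V\<close>, so \<open>V\<close> can be recovered as the span.\<close>

definition covol ::
    "('f::{field,finite} \<Rightarrow> 'a::field) \<Rightarrow> ('k::field \<Rightarrow> int) \<Rightarrow> 'k set \<Rightarrow>
     ('k ^ 'n::{finite,linorder}) set \<Rightarrow> real" where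
  "covol emb w R D =
     real CARD('f) powi ((genus emb - 1) * int (vec.dim (vec.span D))) *
     lattice_d w R D (vec.span D)"

end

theory Submission
  imports Defs
begin

text \<open>
  Let \<open>es\<close> be a basis of \<open>L \<inter> M \<inter> \<Delta>\<close>. Over a principal ideal domain it extends to bases \<open>ls @ es\<close> and
  \<open>ms @ es\<close> of \<open>L \<inter> \<Delta>\<close> and \<open>M \<inter> \<Delta>\<close>, because a submodule cut out by a subspace is saturated. The
  module spanned by \<open>ms @ ls @ es\<close> has full rank in \<open>(L + M) \<inter> \<Delta>\<close>, so its wedge is that of a basis
  of \<open>(L + M) \<inter> \<Delta>\<close> up to a nonzero factor in \<open>R\<close>, which has absolute value at least \<open>1\<close> since
  \<open>\<Delta>\<close> is discrete. The claim is thus reduced to an inequality between ultrametric norms of wedges of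
  arbitrary vectors, which follows by Gaussian elimination with complete pivoting on \<open>es\<close>.

  The absolute value of \<open>w\<close> is defined from the cardinality of its residue field, which is \<open>0\<close> if the
  residue field is infinite; the completion property does not exclude this case by itself, as both of
  its metric clauses are then trivial. It is excluded by the discreteness of \<open>\<Delta>\<close> once \<open>R\<close> contains an
  element of negative valuation, that is, once there is a function whose only pole is \<open>\<nu>\<close>.
  Such a function is found without the Riemann--Roch theorem: the functions regular away from the
  poles of some \<open>y\<close> and the functions regular at these poles together span a subgroup of finite
  index in the function field, so the pigeonhole principle applies to the powers of an element
  whose only pole among the poles of \<open>y\<close> is \<open>\<nu>\<close>.
\<close>

section \<open>Valuations\<close>

text \<open>That \<open>L \<inter> M\<close> and \<open>L + M\<close> are again rational is not
  among the hypotheses; it comes out of the construction of the bases. The intersection of the two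
  lattices controls only relations with coefficients in \<open>R\<close>, whereas rationality and
  norms need independence over the whole field. Elimination without division bridges the two:
  vectors of \<Delta> that are dependent over the field are dependent over \<open>R\<close>.

  Submultiplicativity bounds the norms for \<open>L \<inter> M\<close> and \<open>L + M\<close> from
  above, but \<open>L\<close> and \<open>M\<close> need a lower bound, and for general vectors there
  is none. It holds if one block is the identity matrix on some coordinates at which the other
  vectors vanish; pivoting creates this situation at the cost of a scalar that enters both sides
  squared.

  In the search for a pole at \<nu>, a spanning set over the rational functions of \<open>y\<close>
  need not consist of integral elements. A denominator \<open>H\<close> and a power
  \<open>y ^ n\<close> correct this, and since there are finitely many constants, only finitely many
  remainders of degree below \<open>n\<close> occur.\<close>

definition vge :: "('a::field \<Rightarrow> int) \<Rightarrow> int \<Rightarrow> 'a \<Rightarrow> bool" where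
  "vge P n x \<longleftrightarrow> x = 0 \<or> n \<le> P x"

lemma val_mult: "discrete_valuation P \<Longrightarrow> x \<noteq> 0 \<Longrightarrow> y \<noteq> 0 \<Longrightarrow> P (x * y) = P x + P y"
  by (simp add: discrete_valuation_def)

lemma val_one: "discrete_valuation P \<Longrightarrow> P 1 = 0"
  using val_mult[of P 1 1] by simp

lemma val_power: "discrete_valuation P \<Longrightarrow> x \<noteq> 0 \<Longrightarrow> P (x ^ n) = int n * P x"
  by (induction n) (simp_all add: val_one val_mult algebra_simps)

lemma val_inverse: "discrete_valuation P \<Longrightarrow> P (inverse x) = - P x"
  using val_mult[of P x "inverse x"] val_one[of P]
  by (cases "x = 0") (auto simp: discrete_valuation_def)

lemma val_divide: "discrete_valuation P \<Longrightarrow> x \<noteq> 0 \<Longrightarrow> y \<noteq> 0 \<Longrightarrow> P (x / y) = P x - P y"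
  by (simp add: divide_inverse val_mult val_inverse)

lemma val_minus:
  assumes "discrete_valuation P"
  shows "P (- x) = P x"
proof (cases "x = 0")
  case False
  have "P (-1) = 0"
    using val_mult[OF assms, of "-1" "-1"] val_one[OF assms] by simp
  then show ?thesis
    using val_mult[OF assms, of "-1" x] False by simp
qed simp

text \<open>\<open>vge\<close> reads the value of 0 as infinity. This undoes the convention
  \<open>P 0 = 0\<close>, so that ultrametric estimates need no separate case for vanishing
  sums.\<close>

lemma vge_0 [simp]: "vge P n 0"
  by (simp add: vge_def)

lemma vge_mono: "vge P n x \<Longrightarrow> m \<le> n \<Longrightarrow> vge P m x"
  by (auto simp: vge_def)

lemma vge_add: "discrete_valuation P \<Longrightarrow> vge P n x \<Longrightarrow> vge P n y \<Longrightarrow> vge P n (x + y)"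
  unfolding vge_def discrete_valuation_def by (metis add.left_neutral add.right_neutral min.bounded_iff order_trans)

lemma vge_minus [simp]: "discrete_valuation P \<Longrightarrow> vge P n (- x) = vge P n x"
  by (simp add: vge_def val_minus)

lemma vge_diff: "discrete_valuation P \<Longrightarrow> vge P n x \<Longrightarrow> vge P n y \<Longrightarrow> vge P n (x - y)"
  using vge_add[of P n x "- y"] by simp

lemma vge_mult: "discrete_valuation P \<Longrightarrow> vge P m x \<Longrightarrow> vge P n y \<Longrightarrow> vge P (m + n) (x * y)"
  unfolding vge_def by (cases "x = 0"; cases "y = 0") (auto simp: val_mult)

lemma vge_mult_0: "discrete_valuation P \<Longrightarrow> vge P 0 x \<Longrightarrow> vge P 0 y \<Longrightarrow> vge P 0 (x * y)"
  using vge_mult[of P 0 x 0 y] by simp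

lemma vge_power_0: "discrete_valuation P \<Longrightarrow> vge P 0 x \<Longrightarrow> vge P 0 (x ^ n)"
  by (induction n) (auto simp: vge_mult_0, simp add: vge_def val_one)

lemma vge_sum: "discrete_valuation P \<Longrightarrow> (\<And>i. i \<in> A \<Longrightarrow> vge P n (f i)) \<Longrightarrow> vge P n (sum f A)"
  by (induction A rule: infinite_finite_induct) (auto simp: vge_add)

text \<open>Strictness turns the ultrametric inequality into an equality: writing
  \<open>a = (a + b) - b\<close> gives the missing direction. The bound \<open>P a + 1\<close>
  expresses strictness for integer values.\<close>

lemma val_add_dominant:
  assumes P: "discrete_valuation P" and "a \<noteq> 0" and b: "vge P (P a + 1) b"
  shows "a + b \<noteq> 0 \<and> P (a + b) = P a"
proof (cases "b = 0")
  case False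
  then have ab: "P a < P b" using b by (auto simp: vge_def)
  have nz: "a + b \<noteq> 0"
    using ab val_minus[OF P, of b] by (metis add_eq_0_iff2 less_irrefl)
  have "vge P (min (P a) (P b)) (a + b)"
    by (intro vge_add[OF P]) (auto simp: vge_def)
  then have 1: "P a \<le> P (a + b)" using nz ab by (auto simp: vge_def)
  have "vge P (min (P (a + b)) (P b)) (a + b - b)"
    by (intro vge_diff[OF P]) (auto simp: vge_def)
  then have "P (a + b) \<le> P a" using \<open>a \<noteq> 0\<close> ab by (auto simp: vge_def min_def split: if_splits)
  with 1 nz show ?thesis by simp
qed (use \<open>a \<noteq> 0\<close> in simp)

text \<open>Otherwise the valuation ring of \<open>Q\<close> would lie in that of \<open>P\<close>.
  Units for \<open>Q\<close> are then units for \<open>P\<close>, and dividing by powers of a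
  uniformizer of \<open>Q\<close> shows that \<open>P\<close> is a multiple of \<open>Q\<close>.
  Both being normalized, the factor is 1.\<close>

lemma valuation_separating:
  assumes P: "discrete_valuation P" and Q: "discrete_valuation Q" and "P \<noteq> Q"
  obtains z where "z \<noteq> 0" "P z < 0" "0 \<le> Q z"
proof -
  have "\<exists>z. z \<noteq> 0 \<and> P z < 0 \<and> 0 \<le> Q z"
  proof (rule ccontr)
    assume "\<not> ?thesis"
    then have A: "0 \<le> P z" if "z \<noteq> 0" "0 \<le> Q z" for z
      using that by force
    obtain \<pi> where \<pi>: "\<pi> \<noteq> 0" "Q \<pi> = 1" using Q by (auto simp: discrete_valuation_def)
    obtain \<rho> where \<rho>: "\<rho> \<noteq> 0" "P \<rho> = 1" using P by (auto simp: discrete_valuation_def)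
    have unit: "P u = 0" if "u \<noteq> 0" "Q u = 0" for u
      using A[of u] A[of "inverse u"] that val_inverse[OF P] val_inverse[OF Q] by force
    have PQ: "P z = Q z * P \<pi>" if "z \<noteq> 0" for z
    proof (cases "0 \<le> Q z")
      case True
      have "P (z / \<pi> ^ nat (Q z)) = 0"
        using True that \<pi> by (intro unit) (auto simp: val_divide[OF Q] val_power[OF Q])
      then show ?thesis using True that \<pi> by (simp add: val_divide[OF P] val_power[OF P])
    next
      case False
      have "P (z * \<pi> ^ nat (- Q z)) = 0"
        using False that \<pi> by (intro unit) (auto simp: val_mult[OF Q] val_power[OF Q])
      then show ?thesis using False that \<pi> by (simp add: val_mult[OF P] val_power[OF P])
    qed
    have "Q \<rho> * P \<pi> = 1" using PQ[of \<rho>] \<rho> by simp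
    moreover have "0 \<le> P \<pi>" using A[of \<pi>] \<pi> by simp
    ultimately have "P \<pi> = 1" by (metis abs_of_nonneg dvd_triv_right zdvd1_eq)
    then have "P z = Q z" for z
      using PQ[of z] P Q by (cases "z = 0") (auto simp: discrete_valuation_def)
    with \<open>P \<noteq> Q\<close> show False by blast
  qed
  with that show thesis by blast
qed

text \<open>Induction on \<open>T\<close>: a function \<open>z\<close> that works for
  \<open>T\<close> is adjusted at one more valuation \<open>Q\<close> by means of a function
  \<open>y\<close> that works for \<open>Q\<close> alone.\<close>

lemma weak_approximation:
  assumes N: "discrete_valuation N" and "finite T"
    and "\<And>P. P \<in> T \<Longrightarrow> discrete_valuation P \<and> P \<noteq> N"
  obtains z where "z \<noteq> 0" "N z < 0" "\<And>P. P \<in> T \<Longrightarrow> 0 < P z"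
proof -
  have two: "\<exists>z. z \<noteq> 0 \<and> N z < 0 \<and> 0 < Q z" if Q: "discrete_valuation Q" "Q \<noteq> N" for Q
  proof -
    obtain a where a: "a \<noteq> 0" "N a < 0" "0 \<le> Q a"
      using valuation_separating[OF N Q(1)] Q(2) by metis
    obtain b where b: "b \<noteq> 0" "Q b < 0" "0 \<le> N b"
      using valuation_separating[OF Q(1) N] Q(2) by metis
    show ?thesis
      by (rule exI[of _ "a / b"]) (use a b in \<open>simp add: val_divide N Q(1)\<close>)
  qed
  have "\<exists>z. z \<noteq> 0 \<and> N z < 0 \<and> (\<forall>P\<in>T. 0 < P z)"
    using \<open>finite T\<close> assms(3)
  proof (induction T)
    case empty
    obtain \<pi> where \<pi>: "\<pi> \<noteq> 0" "N \<pi> = 1" using N by (auto simp: discrete_valuation_def)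
    show ?case by (rule exI[of _ "inverse \<pi>"]) (use \<pi> in \<open>simp add: val_inverse N\<close>)
  next
    case (insert Q T)
    then obtain z where z: "z \<noteq> 0" "N z < 0" "\<forall>P\<in>T. 0 < P z" by auto
    have Q: "discrete_valuation Q" "Q \<noteq> N" using insert.prems by auto
    have T: "discrete_valuation P" if "P \<in> T" for P using insert.prems that by auto
    obtain y where y: "y \<noteq> 0" "N y < 0" "0 < Q y" using two[OF Q] by blast
    \<comment> \<open>Large enough that at each member of \<open>T\<close> the zero of
      \<open>z ^ n\<close> outweighs a possible pole of \<open>y\<close>.\<close>
    define n where "n = Suc (\<Sum>P\<in>T. nat \<bar>P y\<bar>)"
    have n: "0 < int n * P z + P y" if "P \<in> T" for P
    proof -
      have "nat \<bar>P y\<bar> \<le> (\<Sum>P\<in>T. nat \<bar>P y\<bar>)"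
        using that insert.hyps(1) by (intro member_le_sum) auto
      then have "int (nat \<bar>P y\<bar>) < int n" unfolding n_def by linarith
      then have "\<bar>P y\<bar> < int n" by simp
      moreover have "int n * 1 \<le> int n * P z" using z that by (intro mult_left_mono) auto
      ultimately show ?thesis by linarith
    qed
    consider "Q z > 0" | "Q z = 0" | "Q z < 0" by linarith
    then show ?case
    proof cases
      case 1
      then show ?thesis using z by auto
    next
      case 2
      have "N (z ^ n * y) < 0"
        using z y by (simp add: val_mult N val_power add_nonpos_neg mult_nonneg_nonpos)
      moreover have "0 < Q (z ^ n * y)" using 2 z y by (simp add: val_mult Q val_power)
      moreover have "0 < P (z ^ n * y)" if "P \<in> T" for P
        using n[OF that] z y by (simp add: val_mult T[OF that] val_power)
      ultimately show ?thesis using z y by (intro exI[of _ "z ^ n * y"]) auto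
    next
      case 3
      have npos: "n > 0" by (simp add: n_def)
      have neg: "1 + z ^ n \<noteq> 0 \<and> V (1 + z ^ n) = V (z ^ n)" if V: "discrete_valuation V" "V z < 0" for V
      proof -
        have "V (z ^ n) < 0" using V z npos by (simp add: val_power mult_pos_neg)
        then show ?thesis
          using val_add_dominant[OF V(1), of "z ^ n" 1] z val_one[OF V(1)] by (simp add: vge_def add.commute)
      qed
      have pos: "V (1 + z ^ n) = 0" if V: "discrete_valuation V" "V z > 0" for V
      proof -
        have "V (z ^ n) > 0" using V z npos by (simp add: val_power)
        then show ?thesis
          using val_add_dominant[OF V(1), of 1 "z ^ n"] z val_one[OF V(1)] by (simp add: vge_def)
      qed
      \<comment> \<open>The factor \<open>z ^ n / (1 + z ^ n)\<close> has value 0 where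
        \<open>z\<close> has a pole, so that \<open>y\<close> decides there, and it keeps the value
        of \<open>z ^ n\<close> where \<open>z\<close> vanishes.\<close>
      define u where "u = z ^ n / (1 + z ^ n) * y"
      have nz: "1 + z ^ n \<noteq> 0" using neg[OF N z(2)] by simp
      have val: "V u = V (z ^ n) - V (1 + z ^ n) + V y" if "discrete_valuation V" for V
        unfolding u_def using that z y nz by (simp add: val_mult val_divide)
      have "N u < 0" using val[OF N] neg[OF N z(2)] y by simp
      moreover have "0 < Q u" using val[OF Q(1)] neg[OF Q(1) 3] y by simp
      moreover have "0 < P u" if "P \<in> T" for P
        using val[OF T[OF that]] pos[OF T[OF that]] z that n[OF that] by (simp add: val_power T)
      moreover have "u \<noteq> 0" using z y nz by (simp add: u_def)
      ultimately show ?thesis by auto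
    qed
  qed
  with that show thesis by blast
qed

section \<open>Linear systems over a subring of a field\<close>

definition is_subring :: "'a::comm_ring_1 set \<Rightarrow> bool" where
  "is_subring R \<longleftrightarrow> 0 \<in> R \<and> 1 \<in> R \<and> (\<forall>x\<in>R. - x \<in> R) \<and> (\<forall>x\<in>R. \<forall>y\<in>R. x + y \<in> R \<and> x * y \<in> R)"

lemma is_subringD:
  assumes "is_subring R"
  shows "0 \<in> R" "1 \<in> R" "x \<in> R \<Longrightarrow> - x \<in> R" "x \<in> R \<Longrightarrow> y \<in> R \<Longrightarrow> x + y \<in> R"
    "x \<in> R \<Longrightarrow> y \<in> R \<Longrightarrow> x * y \<in> R" "x \<in> R \<Longrightarrow> y \<in> R \<Longrightarrow> x - y \<in> R"
  using assms unfolding is_subring_def by (auto simp flip: diff_conv_add_uminus) (metis diff_conv_add_uminus)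

lemma subring_sum: "is_subring R \<Longrightarrow> (\<And>i. i \<in> A \<Longrightarrow> f i \<in> R) \<Longrightarrow> sum f A \<in> R"
  by (induction A rule: infinite_finite_induct) (auto simp: is_subringD)

text \<open>Gaussian elimination without division. The last hypothesis covers two uses at once: a
  system with more unknowns than equations, and a system over \<open>R\<close> known to be solvable
  over the whole field. Either property passes to the reduced system.\<close>

lemma linear_system_solution:
  fixes R :: "'a::field set"
  assumes R: "is_subring R"
    and "finite B" "finite S" "\<And>i j. i \<in> S \<Longrightarrow> j \<in> B \<Longrightarrow> a i j \<in> R"
    and "card B < card S \<or> (\<exists>c. (\<exists>i\<in>S. c i \<noteq> 0) \<and> (\<forall>j\<in>B. (\<Sum>i\<in>S. c i * a i j) = 0))"
  shows "\<exists>c. (\<forall>i\<in>S. c i \<in> R) \<and> (\<exists>i\<in>S. c i \<noteq> 0) \<and> (\<forall>j\<in>B. (\<Sum>i\<in>S. c i * a i j) = 0)"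
  using assms(2-5)
proof (induction B arbitrary: S a)
  case empty
  then have "S \<noteq> {}" by auto
  then show ?case by (intro exI[of _ "\<lambda>_. 1"]) (auto simp: is_subringD[OF R])
next
  case (insert j0 B)
  show ?case
  proof (cases "\<forall>i\<in>S. a i j0 = 0")
    case True
    have "card B < card S \<or> (\<exists>c. (\<exists>i\<in>S. c i \<noteq> 0) \<and> (\<forall>j\<in>B. (\<Sum>i\<in>S. c i * a i j) = 0))"
      using insert.prems(3) insert.hyps by auto
    from insert.IH[OF insert.prems(1) _ this] insert.prems(2) 
    obtain c where "\<forall>i\<in>S. c i \<in> R" "\<exists>i\<in>S. c i \<noteq> 0" "\<forall>j\<in>B. (\<Sum>i\<in>S. c i * a i j) = 0" by auto
    moreover have "(\<Sum>i\<in>S. c i * a i j0) = 0" using True by simp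
    ultimately show ?thesis by auto
  next
    case False
    then obtain i0 where i0: "i0 \<in> S" "a i0 j0 \<noteq> 0" by auto
    define S' where "S' = S - {i0}"
    have S: "S = insert i0 S'" "i0 \<notin> S'" and fS': "finite S'" using i0 insert.prems(1) by (auto simp: S'_def)
    \<comment> \<open>Cross multiplication with the pivot \<open>a i0 j0\<close> eliminates equation
      \<open>j0\<close> and keeps the coefficients in \<open>R\<close>.\<close>
    define a' where "a' i j = a i0 j0 * a i j - a i j0 * a i0 j" for i j
    have a': "a' i j \<in> R" if "i \<in> S'" "j \<in> B" for i j
      unfolding a'_def using that insert.prems(2) S
      by (intro is_subringD[OF R]) auto
    have "card B < card S' \<or> (\<exists>c. (\<exists>i\<in>S'. c i \<noteq> 0) \<and> (\<forall>j\<in>B. (\<Sum>i\<in>S'. c i * a' i j) = 0))"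
      using insert.prems(3)
    proof
      assume "card (insert j0 B) < card S"
      then show ?thesis using S fS' insert.hyps by simp
    next
      assume "\<exists>c. (\<exists>i\<in>S. c i \<noteq> 0) \<and> (\<forall>j\<in>insert j0 B. (\<Sum>i\<in>S. c i * a i j) = 0)"
      then obtain c where c: "\<exists>i\<in>S. c i \<noteq> 0" "\<And>j. j \<in> insert j0 B \<Longrightarrow> (\<Sum>i\<in>S. c i * a i j) = 0"
        by blast
      have rel: "(\<Sum>i\<in>S'. c i * a i j) = - c i0 * a i0 j" if "j \<in> insert j0 B" for j
        using c(2)[OF that] S fS' by (simp add: eq_neg_iff_add_eq_0 add.commute)
      have "(\<Sum>i\<in>S'. c i * a' i j) = 0" if "j \<in> B" for j
      proof -
        have "(\<Sum>i\<in>S'. c i * a' i j) = a i0 j0 * (\<Sum>i\<in>S'. c i * a i j) - (\<Sum>i\<in>S'. c i * a i j0) * a i0 j"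
          by (simp add: a'_def algebra_simps sum_subtractf sum_distrib_left sum_distrib_right)
        also have "\<dots> = 0" using that by (simp add: rel)
        finally show ?thesis .
      qed
      moreover have "\<exists>i\<in>S'. c i \<noteq> 0"
      proof (rule ccontr)
        assume "\<not> ?thesis"
        then have "(\<Sum>i\<in>S'. c i * a i j0) = 0" by simp
        with rel[of j0] i0 have "c i0 = 0" by simp
        with c(1) S \<open>\<not> ?thesis\<close> show False by auto
      qed
      ultimately show ?thesis by blast
    qed
    from insert.IH[OF fS' a' this] obtain c
      where c: "\<forall>i\<in>S'. c i \<in> R" "\<exists>i\<in>S'. c i \<noteq> 0" "\<And>j. j \<in> B \<Longrightarrow> (\<Sum>i\<in>S'. c i * a' i j) = 0"
      by blast
    \<comment> \<open>Scaling by the pivot allows the unknown \<open>i0\<close> to be chosen in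
      \<open>R\<close> such that equation \<open>j0\<close> holds.\<close>
    define d where "d i = (if i = i0 then - (\<Sum>i\<in>S'. c i * a i j0) else a i0 j0 * c i)" for i
    have "d i \<in> R" if "i \<in> S" for i
      unfolding d_def using that c(1) S insert.prems(2)
      by (auto intro!: is_subringD[OF R] subring_sum[OF R])
    moreover have "\<exists>i\<in>S. d i \<noteq> 0"
      using c(2) S i0 by (auto simp: d_def intro!: bexI)
    moreover have "(\<Sum>i\<in>S. d i * a i j) = 0" if "j \<in> insert j0 B" for j
    proof -
      have "(\<Sum>i\<in>S. d i * a i j) = d i0 * a i0 j + (\<Sum>i\<in>S'. d i * a i j)"
        using S fS' by simp
      also have "(\<Sum>i\<in>S'. d i * a i j) = (\<Sum>i\<in>S'. a i0 j0 * c i * a i j)"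
        using S(2) by (intro sum.cong) (auto simp: d_def)
      also have "d i0 * a i0 j = - (\<Sum>i\<in>S'. c i * a i j0 * a i0 j)"
        by (simp add: d_def sum_distrib_right)
      finally have "(\<Sum>i\<in>S. d i * a i j) = (\<Sum>i\<in>S'. c i * a' i j)"
        by (simp add: a'_def algebra_simps sum_subtractf)
      also have "\<dots> = 0"
      proof (cases "j = j0")
        case True
        then show ?thesis by (simp add: a'_def algebra_simps)
      qed (use that c(3) in auto)
      finally show ?thesis .
    qed
    ultimately show ?thesis by blast
  qed
qed

section \<open>Evaluation of polynomials over the constant field\<close>

definition peval :: "('f::field \<Rightarrow> 'a::field) \<Rightarrow> 'f poly \<Rightarrow> 'a \<Rightarrow> 'a" where
  "peval emb p x = poly (map_poly emb p) x"

lemma field_embedding_simps: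
  assumes "field_embedding h"
  shows "h 0 = 0" "h 1 = 1" "h (x + y) = h x + h y" "h (x * y) = h x * h y"
    "h (- x) = - h x" "h x = 0 \<longleftrightarrow> x = 0"
proof -
  show add: "h (x + y) = h x + h y" and mult: "h (x * y) = h x * h y" and one: "h 1 = 1" for x y
    using assms by (auto simp: field_embedding_def)
  have "h 0 = h 0 + h 0" using add[of 0 0] by (simp only: add_0_left)
  then show zero: "h 0 = 0" by (metis add_cancel_left_right)
  show "h (- x) = - h x" using add[of x "- x"] zero by (simp add: eq_neg_iff_add_eq_0 add.commute)
  show "h x = 0 \<longleftrightarrow> x = 0"
    using mult[of x "inverse x"] one zero by (cases "x = 0") auto
qed

context
  fixes emb :: "'f::{field,finite} \<Rightarrow> 'a::field"
  assumes emb: "field_embedding emb"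
begin

lemmas emb_simps [simp] = field_embedding_simps[OF emb]

lemma peval_0 [simp]: "peval emb 0 x = 0"
  by (simp add: peval_def)

lemma peval_pCons [simp]: "peval emb (pCons a p) x = emb a + x * peval emb p x"
  by (simp add: peval_def map_poly_pCons)

lemma peval_1 [simp]: "peval emb 1 x = 1"
  using peval_pCons[of 1 0 x] by (simp add: one_pCons)

lemma peval_add [simp]: "peval emb (p + q) x = peval emb p x + peval emb q x"
  by (induction p q rule: poly_induct2) (auto simp: algebra_simps)

lemma peval_smult [simp]: "peval emb (Polynomial.smult c p) x = emb c * peval emb p x"
  by (induction p) (auto simp: algebra_simps)

lemma peval_mult [simp]: "peval emb (p * q) x = peval emb p x * peval emb q x"
  by (induction p) (auto simp: algebra_simps)

lemma peval_minus [simp]: "peval emb (- p) x = - peval emb p x"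
  using peval_smult[of "-1" p x] by simp

lemma peval_diff [simp]: "peval emb (p - q) x = peval emb p x - peval emb q x"
  using peval_add[of p "- q" x] by simp

lemma peval_power [simp]: "peval emb (p ^ n) x = peval emb p x ^ n"
  by (induction n) auto

text \<open>A nonzero constant is a root of unity because the constant field is finite, and the
  integers have no torsion.\<close>

lemma val_emb:
  assumes P: "discrete_valuation P"
  shows "P (emb c) = 0"
proof (cases "c = 0")
  case True
  then show ?thesis using P by (simp add: discrete_valuation_def)
next
  case False
  have "\<not> inj (\<lambda>n::nat. c ^ n)"
    by (metis finite finite_imageD infinite_UNIV_nat)
  then obtain i j where "i < j" "c ^ i = c ^ j"
    unfolding inj_def by (metis linorder_neqE_nat)
  then have "c ^ (j - i) = 1" using False by (simp add: power_diff)
  moreover have "emb (c ^ n) = emb c ^ n" for n by (induction n) auto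
  ultimately have "emb c ^ (j - i) = 1" by (metis emb_simps(2))
  then have "int (j - i) * P (emb c) = 0"
    using val_power[OF P, of "emb c" "j - i"] False val_one[OF P] by simp
  then show ?thesis using \<open>i < j\<close> by simp
qed

lemma vge_emb: "discrete_valuation P \<Longrightarrow> vge P 0 (emb c)"
  by (simp add: vge_def val_emb)

lemma vge_peval: "discrete_valuation P \<Longrightarrow> vge P 0 x \<Longrightarrow> vge P 0 (peval emb p x)"
  by (induction p) (auto intro!: vge_add vge_mult_0 vge_emb)

text \<open>At a pole of \<open>x\<close> the leading term has strictly the smallest value.\<close>

lemma val_peval:
  assumes P: "discrete_valuation P" and x: "P x < 0" and "p \<noteq> 0"
  shows "peval emb p x \<noteq> 0 \<and> P (peval emb p x) = int (degree p) * P x"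
  using \<open>p \<noteq> 0\<close>
proof (induction p)
  case (pCons a p)
  have xnz: "x \<noteq> 0" using x P by (auto simp: discrete_valuation_def)
  show ?case
  proof (cases "p = 0")
    case True
    then show ?thesis using pCons by (simp add: val_emb[OF P])
  next
    case False
    with pCons have IH: "peval emb p x \<noteq> 0" "P (peval emb p x) = int (degree p) * P x" by auto
    have v: "P (x * peval emb p x) = int (degree (pCons a p)) * P x"
      using IH xnz False by (simp add: val_mult[OF P] algebra_simps)
    have "int (degree p) * P x \<le> 0" using x by (simp add: mult_nonneg_nonpos)
    then have "P (x * peval emb p x) < 0" using v x False by (simp add: algebra_simps)
    then have "vge P (P (x * peval emb p x) + 1) (emb a)"
      using vge_emb[OF P, of a] by (auto intro: vge_mono)
    from val_add_dominant[OF P _ this] IH xnz v show ?thesis by (simp add: add.commute)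
  qed
qed simp

text \<open>Provides the finite sets of remainders for the two pigeonhole arguments to come, modulo
  a denominator \<open>r\<close> and modulo a power of the variable.\<close>

lemma finite_polys_below: "finite {p :: 'f poly. p = 0 \<or> degree p < n}"
proof (rule finite_subset)
  show "finite (Poly ` {xs :: 'f list. set xs \<subseteq> UNIV \<and> length xs = n})"
    by (intro finite_imageI finite_lists_length_eq) simp
  show "{p :: 'f poly. p = 0 \<or> degree p < n} \<subseteq> Poly ` {xs. set xs \<subseteq> UNIV \<and> length xs = n}"
  proof
    fix p :: "'f poly" assume "p \<in> {p. p = 0 \<or> degree p < n}"
    then have "Polynomial.coeff p i = 0" if "i \<ge> n" for i using that by (auto intro: coeff_eq_0)
    then have "p = Poly (map (Polynomial.coeff p) [0..<n])"
      by (intro poly_eqI) (auto simp: coeff_Poly_eq nth_default_def)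
    then show "p \<in> Poly ` {xs. set xs \<subseteq> UNIV \<and> length xs = n}" by fastforce
  qed
qed

subsection \<open>Simple transcendental subfields\<close>

lemma rational_subfield_iff:
  "z \<in> rational_subfield emb x \<longleftrightarrow> (\<exists>p r. peval emb r x \<noteq> 0 \<and> z = peval emb p x / peval emb r x)"
  by (auto simp: rational_subfield_def peval_def)

lemma peval_in_rational_subfield: "peval emb p x \<in> rational_subfield emb x"
  unfolding rational_subfield_iff by (rule exI[of _ p], rule exI[of _ 1]) simp

lemma rational_subfield_inverse:
  "z \<in> rational_subfield emb x \<Longrightarrow> inverse z \<in> rational_subfield emb x"
  unfolding rational_subfield_iff
proof (elim exE conjE)
  fix p r assume A: "peval emb r x \<noteq> 0" "z = peval emb p x / peval emb r x"
  show "\<exists>p r. peval emb r x \<noteq> 0 \<and> inverse z = peval emb p x / peval emb r x"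
  proof (cases "peval emb p x = 0")
    case True
    then show ?thesis using A by (intro exI[of _ 0] exI[of _ 1]) simp
  next
    case False
    then show ?thesis using A by (intro exI[of _ r] exI[of _ p]) simp
  qed
qed

lemma rational_subfield_subring: "is_subring (rational_subfield emb x)"
proof -
  have add: "y + z \<in> rational_subfield emb x" 
    if yz: "y \<in> rational_subfield emb x" "z \<in> rational_subfield emb x" for y z
  proof -
    obtain p r p' r' where A: "peval emb r x \<noteq> 0" "y = peval emb p x / peval emb r x"
      "peval emb r' x \<noteq> 0" "z = peval emb p' x / peval emb r' x"
      using yz unfolding rational_subfield_iff by blast
    show ?thesis unfolding rational_subfield_iff
      by (rule exI[of _ "p * r' + p' * r"], rule exI[of _ "r * r'"])
        (use A in \<open>simp add: add_frac_eq\<close>)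
  qed
  have mult: "y * z \<in> rational_subfield emb x" 
    if yz: "y \<in> rational_subfield emb x" "z \<in> rational_subfield emb x" for y z
  proof -
    obtain p r p' r' where A: "peval emb r x \<noteq> 0" "y = peval emb p x / peval emb r x"
      "peval emb r' x \<noteq> 0" "z = peval emb p' x / peval emb r' x"
      using yz unfolding rational_subfield_iff by blast
    show ?thesis unfolding rational_subfield_iff
      by (rule exI[of _ "p * p'"], rule exI[of _ "r * r'"])
        (use A in simp)
  qed
  have minus: "- z \<in> rational_subfield emb x" if "z \<in> rational_subfield emb x" for z
    using mult[OF peval_in_rational_subfield[of "-1"] that] by simp
  show ?thesis
    using peval_in_rational_subfield[of 0] peval_in_rational_subfield[of 1]
    by (auto simp: is_subring_def intro: add mult minus)
qed

text \<open>Serves to exchange a generator with a zero at a given place for one with a pole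
  there.\<close>

lemma rational_subfield_inverse_generator:
  "rational_subfield emb x \<subseteq> rational_subfield emb (inverse x)"
proof
  note sub = is_subringD[OF rational_subfield_subring[of "inverse x"]]
  have const: "emb c \<in> rational_subfield emb (inverse x)" for c
    using peval_in_rational_subfield[of "[:c:]" "inverse x"] by simp
  have "x \<in> rational_subfield emb (inverse x)"
    using rational_subfield_inverse[OF peval_in_rational_subfield[of "[:0,1:]" "inverse x"]] by simp
  then have pol: "peval emb p x \<in> rational_subfield emb (inverse x)" for p
    by (induction p) (auto intro!: sub(1,4,5) const)
  fix z assume "z \<in> rational_subfield emb x"
  then obtain p r where "z = peval emb p x * inverse (peval emb r x)"
    by (auto simp: rational_subfield_iff divide_inverse)
  then show "z \<in> rational_subfield emb (inverse x)"
    using sub(5)[OF pol rational_subfield_inverse[OF pol]] by metis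
qed

end

subsection \<open>Spans over a subring\<close>

definition lspan :: "'a::comm_ring_1 set \<Rightarrow> 'a set \<Rightarrow> 'a set" where
  "lspan k B = {\<Sum>b\<in>B. c b * b |c. \<forall>b\<in>B. c b \<in> k}"

lemma lspan_add: "is_subring k \<Longrightarrow> x \<in> lspan k B \<Longrightarrow> y \<in> lspan k B \<Longrightarrow> x + y \<in> lspan k B"
  unfolding lspan_def mem_Collect_eq
proof (elim exE conjE)
  fix c d assume A: "is_subring k" "x = (\<Sum>b\<in>B. c b * b)" "\<forall>b\<in>B. c b \<in> k" 
    "y = (\<Sum>b\<in>B. d b * b)" "\<forall>b\<in>B. d b \<in> k"
  then show "\<exists>c. x + y = (\<Sum>b\<in>B. c b * b) \<and> (\<forall>b\<in>B. c b \<in> k)"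
    by (intro exI[of _ "\<lambda>b. c b + d b"]) (auto simp: algebra_simps sum.distrib is_subringD)
qed

lemma lspan_scale: "is_subring k \<Longrightarrow> r \<in> k \<Longrightarrow> x \<in> lspan k B \<Longrightarrow> r * x \<in> lspan k B"
  unfolding lspan_def mem_Collect_eq
proof (elim exE conjE)
  fix c assume A: "is_subring k" "r \<in> k" "x = (\<Sum>b\<in>B. c b * b)" "\<forall>b\<in>B. c b \<in> k"
  then show "\<exists>c. r * x = (\<Sum>b\<in>B. c b * b) \<and> (\<forall>b\<in>B. c b \<in> k)"
    by (intro exI[of _ "\<lambda>b. r * c b"]) (auto simp: algebra_simps sum_distrib_left is_subringD)
qed

lemma lspan_0: "is_subring k \<Longrightarrow> 0 \<in> lspan k B"
  unfolding lspan_def mem_Collect_eq by (intro exI[of _ "\<lambda>_. 0"]) (auto simp: is_subringD)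

lemma lspan_base: "is_subring k \<Longrightarrow> finite B \<Longrightarrow> b \<in> B \<Longrightarrow> b \<in> lspan k B"
proof -
  assume A: "is_subring k" "finite B" "b \<in> B"
  have "(\<Sum>b'\<in>B. (if b' = b then 1 else 0) * b') = (\<Sum>b'\<in>B. if b' = b then b' else 0)"
    by (intro sum.cong) auto
  also have "\<dots> = b" using A by simp
  finally show ?thesis using A unfolding lspan_def mem_Collect_eq
    by (intro exI[of _ "\<lambda>b'. if b' = b then 1 else 0"]) (auto simp: is_subringD)
qed

lemma lspan_sum: "is_subring k \<Longrightarrow> (\<And>i. i \<in> A \<Longrightarrow> f i \<in> lspan k B) \<Longrightarrow> sum f A \<in> lspan k B"
  by (induction A rule: infinite_finite_induct) (auto simp: lspan_add lspan_0)

lemma lspan_mono: "k \<subseteq> k' \<Longrightarrow> lspan k B \<subseteq> lspan k' B"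
  by (auto simp: lspan_def)

text \<open>Replaces arguments with integral closures: it is enough that \<open>u\<close> clears the
  structure constants of the multiplication. For \<open>b0\<close> of least value among the nonzero
  members of \<open>B\<close>, the product \<open>u * (b0 * b0)\<close> has at least the value of
  \<open>b0\<close>, so \<open>u * b0\<close> has value at least 0, and the value of any other
  nonzero \<open>u * b\<close> is no smaller.\<close>

lemma vge_lspan_basis:
  assumes P: "discrete_valuation P" and B: "finite B" and "u \<noteq> 0"
    and mult: "\<And>b b'. b \<in> B \<Longrightarrow> b' \<in> B \<Longrightarrow> b * b' = (\<Sum>b''\<in>B. c b b' b'' * b'')"
    and c: "\<And>b b' b''. b \<in> B \<Longrightarrow> b' \<in> B \<Longrightarrow> b'' \<in> B \<Longrightarrow> vge P 0 (u * c b b' b'')"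
    and "b \<in> B"
  shows "vge P 0 (u * b)"
proof (cases "b = 0")
  case False
  define B' where "B' = B - {0}"
  have B': "finite B'" "B' \<noteq> {}" using B False \<open>b \<in> B\<close> by (auto simp: B'_def)
  define m where "m = Min (P ` B')"
  have "m \<in> P ` B'" unfolding m_def using B' by (intro Min_in) auto
  then obtain b0 where b0: "b0 \<in> B" "b0 \<noteq> 0" "P b0 = m" by (auto simp: B'_def)
  have ge: "vge P m b'" if "b' \<in> B" for b'
    using that B' unfolding vge_def m_def by (cases "b' = 0") (auto simp: B'_def intro!: Min_le)
  have "u * (b0 * b0) = (\<Sum>b''\<in>B. (u * c b0 b0 b'') * b'')"
    by (simp add: mult[OF b0(1) b0(1)] sum_distrib_left mult.assoc)
  also have "vge P (0 + m) \<dots>"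
    using b0 c ge by (intro vge_sum[OF P] vge_mult[OF P]) auto
  finally have "m \<le> P u + (m + m)" using b0 \<open>u \<noteq> 0\<close> by (simp add: vge_def val_mult[OF P])
  moreover have "m \<le> P b" using ge[OF \<open>b \<in> B\<close>] False by (simp add: vge_def)
  ultimately show ?thesis using False \<open>u \<noteq> 0\<close> by (simp add: vge_def val_mult[OF P])
qed simp

section \<open>Functions with a single pole\<close>

context
  fixes emb :: "'f::{field,finite} \<Rightarrow> 'a::field"
  assumes emb: "field_embedding emb"
begin

text \<open>Repeated division by \<open>h\<close> expands a polynomial in \<open>x\<close> in powers
  of \<open>peval emb h x\<close>, with digits of degree below \<open>degree h\<close>. The purpose
  is to stay finite over the rational subfield when the generator is replaced by
  \<open>peval emb h x\<close>.\<close>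

lemma rational_subfield_change_generator:
  fixes h :: "'f poly"
  assumes tr: "\<And>p. p \<noteq> 0 \<Longrightarrow> peval emb p x \<noteq> 0" and h: "degree h > 0"
  shows "rational_subfield emb x \<subseteq> lspan (rational_subfield emb (peval emb h x)) ((\<lambda>i. x ^ i) ` {..<degree h})"
    (is "_ \<subseteq> lspan ?k ?B")
proof -
  note [simp] = peval_0[OF emb] peval_pCons[OF emb] peval_add[OF emb] peval_mult[OF emb] peval_diff[OF emb] peval_power[OF emb]
  note sub = rational_subfield_subring[OF emb, of "peval emb h x"]
  note k = is_subringD[OF sub]
  have H: "peval emb h x \<in> ?k"
    using peval_in_rational_subfield[OF emb, of "[:0,1:]" "peval emb h x"] emb_simps[OF emb] by simp
  have const: "emb c \<in> ?k" for c
    using peval_in_rational_subfield[OF emb, of "[:c:]" "peval emb h x"] by simp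
  have small: "peval emb p x \<in> lspan ?k ?B" if "degree p < degree h" for p
  proof -
    have "peval emb p x = (\<Sum>i\<le>degree p. emb (Polynomial.coeff p i) * x ^ i)"
    proof -
      have "degree (map_poly emb p) = degree p"
        by (rule degree_map_poly) (simp add: emb_simps[OF emb])
      then show ?thesis by (simp add: peval_def poly_altdef coeff_map_poly emb_simps[OF emb])
    qed
    also have "\<dots> \<in> lspan ?k ?B"
      using that by (intro lspan_sum[OF sub] lspan_scale[OF sub] lspan_base[OF sub] const) auto
    finally show ?thesis .
  qed
  have pol: "peval emb p x \<in> lspan ?k ?B" for p
  proof (induction "degree p" arbitrary: p rule: less_induct)
    case less
    show ?case
    proof (cases "degree p < degree h")
      case False
      have "degree (p div h) < degree p"
        using False h by (simp add: degree_div_less)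
      then have "peval emb h x * peval emb (p div h) x \<in> lspan ?k ?B"
        using less by (intro lspan_scale[OF sub H]) auto
      moreover have "peval emb (p mod h) x \<in> lspan ?k ?B"
      proof (rule small)
        have "h \<noteq> 0" using h by auto
        then show "degree (p mod h) < degree h"
          using degree_mod_less[of h p] h by (metis degree_0)
      qed
      moreover have "peval emb p x = peval emb h x * peval emb (p div h) x + peval emb (p mod h) x"
        by (metis div_mult_mod_eq mult.commute peval_add[OF emb] peval_mult[OF emb])
      ultimately show ?thesis by (simp add: lspan_add[OF sub])
    qed (use small in auto)
  qed
  show ?thesis
  proof
    fix z assume "z \<in> rational_subfield emb x"
    then obtain p r where r: "peval emb r x \<noteq> 0" and z: "z = peval emb p x / peval emb r x"
      by (auto simp: rational_subfield_iff[OF emb])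
    have r0: "r \<noteq> 0" using r by auto
    \<comment> \<open>Finiteness of \<open>F[X]/(r)\<close> provides a multiple of \<open>r\<close> that is a polynomial in \<open>h\<close>.\<close>
    have "range (\<lambda>n::nat. h ^ n mod r) \<subseteq> {p. p = 0 \<or> degree p < degree r}"
      using degree_mod_less[OF r0] by auto
    then have "finite (range (\<lambda>n::nat. h ^ n mod r))"
      using finite_polys_below[OF emb] by (rule finite_subset)
    then have "\<not> inj (\<lambda>n::nat. h ^ n mod r)"
      using finite_imageD infinite_UNIV_nat by blast
    then obtain i j where ij: "i < j" "h ^ i mod r = h ^ j mod r"
      unfolding inj_def by (metis linorder_neqE_nat)
    then obtain s where s: "h ^ j - h ^ i = r * s"
      by (metis mod_eq_dvd_iff dvd_def)
    have hnz: "h \<noteq> 0" using h by auto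
    have "degree (h ^ i) < degree (h ^ j)"
      using ij h hnz by (simp add: degree_power_eq)
    then have "h ^ j - h ^ i \<noteq> 0" by auto
    then have nz: "peval emb (h ^ j - h ^ i) x \<noteq> 0" by (rule tr)
    have zs: "z = inverse (peval emb h x ^ j - peval emb h x ^ i) * peval emb (p * s) x"
    proof -
      have "peval emb h x ^ j - peval emb h x ^ i = peval emb r x * peval emb s x"
        using arg_cong[OF s, of "\<lambda>p. peval emb p x"] by simp
      moreover have "peval emb h x ^ j - peval emb h x ^ i \<noteq> 0" using nz by simp
      ultimately show ?thesis using r by (simp add: z field_simps)
    qed
    have pow: "peval emb h x ^ n \<in> ?k" for n
      by (induction n) (auto intro: k H)
    then have "inverse (peval emb h x ^ j - peval emb h x ^ i) \<in> ?k"
      by (intro rational_subfield_inverse[OF emb] k)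
    then show "z \<in> lspan ?k ?B"
      unfolding zs by (intro lspan_scale[OF sub] pol)
  qed
qed

section \<open>Denominators, values at the poles of a generator, and finiteness of its pole
  set\<close>

lemma common_denominator:
  fixes y :: 'a
  assumes P: "discrete_valuation P" "P y < 0" and "finite C" "C \<subseteq> rational_subfield emb y"
  shows "\<exists>h::'f poly. h \<noteq> 0 \<and> (\<forall>c\<in>C. \<exists>p. peval emb h y * c = peval emb p y)"
  using assms(3,4)
proof (induction C)
  case empty
  then show ?case by (intro exI[of _ 1]) auto
next
  case (insert c C)
  then have "\<exists>h::'f poly. h \<noteq> 0 \<and> (\<forall>c\<in>C. \<exists>p. peval emb h y * c = peval emb p y)" by simp
  then obtain h :: "'f poly" where h: "h \<noteq> 0" "\<forall>c\<in>C. \<exists>p. peval emb h y * c = peval emb p y" by metis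
  obtain p r where r: "peval emb r y \<noteq> 0" and c: "c = peval emb p y / peval emb r y"
    using insert.prems by (auto simp: rational_subfield_iff[OF emb])
  have "\<exists>p. peval emb (h * r) y * c' = peval emb p y" if c': "c' \<in> insert c C" for c'
  proof (cases "c' = c")
    case True
    then show ?thesis using r c
      by (intro exI[of _ "h * p"]) (simp add: peval_mult[OF emb])
  next
    case False
    then obtain p' where "peval emb p' y = peval emb h y * c'" using bspec[OF h(2), of c'] c' by auto
    then show ?thesis
      by (intro exI[of _ "r * p'"]) (simp add: peval_mult[OF emb] mult_ac)
  qed
  moreover have "h * r \<noteq> 0" using h(1) r peval_0[OF emb] by auto
  ultimately show ?case by (intro exI[of _ "h * r"]) simp
qed

text \<open>At a pole only leading terms count, so \<open>d\<close> is a difference of degrees and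
  the same for all poles of \<open>y\<close>. This uniformity allows coefficients to be ranked
  independently of the pole.\<close>

lemma val_rational_subfield:
  fixes y :: 'a
  assumes N: "discrete_valuation N" "N y < 0" and c: "c \<in> rational_subfield emb y" "c \<noteq> 0"
  shows "\<exists>d. \<forall>P. discrete_valuation P \<and> P y < 0 \<longrightarrow> P c = d * P y"
proof -
  obtain p r where A: "peval emb r y \<noteq> 0" "c = peval emb p y / peval emb r y"
    using c(1) by (auto simp: rational_subfield_iff[OF emb])
  have "p \<noteq> 0" "r \<noteq> 0" "peval emb p y \<noteq> 0" using A c(2) peval_0[OF emb] by auto
  have "P c = (int (degree p) - int (degree r)) * P y" if P: "discrete_valuation P" "P y < 0" for P
  proof -
    have "P c = P (peval emb p y) - P (peval emb r y)"
      unfolding A(2) by (rule val_divide[OF P(1)]) fact+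
    then show ?thesis
      using val_peval[OF emb P \<open>p \<noteq> 0\<close>] val_peval[OF emb P \<open>r \<noteq> 0\<close>] by (simp add: left_diff_distrib)
  qed
  then show ?thesis by blast
qed

text \<open>Choose for each \<open>P\<close> in a finite set of poles of \<open>y\<close> a function
  \<open>z P\<close> with a pole at \<open>P\<close> and zeros at the other members. These functions
  are linearly independent over the rational functions of \<open>y\<close>, so there are at most as
  many as generators in \<open>B\<close>.\<close>

lemma finite_poles:
  fixes y :: 'a
  assumes N: "discrete_valuation N" "N y < 0" and B: "finite B" and K: "lspan (rational_subfield emb y) B = UNIV"
  shows "finite {P. discrete_valuation P \<and> P y < 0}" (is "finite ?T")
proof (rule finite_if_finite_subsets_card_bdd[THEN conjunct1])
  fix S assume S: "S \<subseteq> ?T" "finite S"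
  note sub = rational_subfield_subring[OF emb, of y]
  show "card S \<le> card B"
  proof (rule ccontr)
    assume "\<not> card S \<le> card B"
    then have less: "card B < card S" by simp
    have "\<exists>z. z \<noteq> 0 \<and> P z < 0 \<and> (\<forall>Q\<in>S. Q \<noteq> P \<longrightarrow> 0 < Q z)" if PS: "P \<in> S" for P
    proof -
      obtain z where "z \<noteq> 0" "P z < 0" "\<And>Q. Q \<in> S - {P} \<Longrightarrow> 0 < Q z"
        by (rule weak_approximation[of P "S - {P}"]) (use S PS in auto)
      then show ?thesis by (intro exI[of _ z]) simp
    qed
    then obtain z where z: "\<And>P. P \<in> S \<Longrightarrow> z P \<noteq> 0" "\<And>P. P \<in> S \<Longrightarrow> P (z P) < 0"
      "\<And>P Q. P \<in> S \<Longrightarrow> Q \<in> S \<Longrightarrow> Q \<noteq> P \<Longrightarrow> 0 < Q (z P)"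
      by metis
    have "\<exists>a. (\<forall>b\<in>B. a b \<in> rational_subfield emb y) \<and> z P = (\<Sum>b\<in>B. a b * b)" for P
    proof -
      have "z P \<in> lspan (rational_subfield emb y) B" by (simp add: K)
      then show ?thesis unfolding lspan_def by blast
    qed
    then obtain a where a: "\<And>P b. b \<in> B \<Longrightarrow> a P b \<in> rational_subfield emb y"
      "\<And>P. z P = (\<Sum>b\<in>B. a P b * b)" by metis
    obtain c where c: "\<forall>P\<in>S. c P \<in> rational_subfield emb y" "\<exists>P\<in>S. c P \<noteq> 0"
        "\<forall>b\<in>B. (\<Sum>P\<in>S. c P * a P b) = 0"
      using linear_system_solution[OF sub B S(2), of a, OF _ disjI1[OF less]] a(1) by auto
    have "(\<Sum>P\<in>S. c P * z P) = (\<Sum>b\<in>B. (\<Sum>P\<in>S. c P * a P b) * b)"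
      unfolding a(2) sum_distrib_left sum_distrib_right by (subst sum.swap) (simp add: mult.assoc)
    also have "\<dots> = 0" by (simp add: c(3))
    finally have rel: "(\<Sum>P\<in>S. c P * z P) = 0" .
    define S' where "S' = {P\<in>S. c P \<noteq> 0}"
    have S': "finite S'" "S' \<noteq> {}" "S' \<subseteq> S" using S c(2) by (auto simp: S'_def)
    have "\<exists>d. \<forall>Q\<in>S. Q (c P) = d * Q y" if "P \<in> S'" for P
      using val_rational_subfield[OF N bspec[OF c(1)], of P] that S by (auto simp: S'_def)
    then obtain d where d: "\<And>P Q. P \<in> S' \<Longrightarrow> Q \<in> S \<Longrightarrow> Q (c P) = d P * Q y" by metis
    \<comment> \<open>The coefficients have values \<open>d P * P0 y\<close> at \<open>P0\<close>,
      and \<open>P0 y\<close> is negative, so the largest \<open>d\<close> gives the smallest value.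
      As \<open>z P0\<close> has a pole at \<open>P0\<close> and the other functions have zeros
      there, its term strictly dominates the relation.\<close>
    define D where "D = Max (d ` S')"
    have "D \<in> d ` S'" unfolding D_def using S' by (intro Max_in) auto
    then obtain P0 where P0: "P0 \<in> S'" "d P0 = D" by auto
    have D: "d P \<le> D" if "P \<in> S'" for P unfolding D_def using that S' by simp
    have P: "discrete_valuation P0" "P0 y < 0" "c P0 \<noteq> 0" "P0 \<in> S"
      using P0 S by (auto simp: S'_def)
    have v0: "P0 (c P0 * z P0) = D * P0 y + P0 (z P0)"
      using d[OF P0(1) P(4)] P0(2) P(3) z(1)[OF P(4)] by (simp add: val_mult[OF P(1)])
    have "vge P0 (P0 (c P0 * z P0) + 1) (\<Sum>P\<in>S - {P0}. c P * z P)"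
    proof (intro vge_sum[OF P(1)])
      fix Q assume Q: "Q \<in> S - {P0}"
      show "vge P0 (P0 (c P0 * z P0) + 1) (c Q * z Q)"
      proof (cases "c Q = 0")
        case False
        then have Q': "Q \<in> S'" using Q by (auto simp: S'_def)
        have "P0 (c Q * z Q) = d Q * P0 y + P0 (z Q)"
          using d[OF Q' P(4)] False z(1) Q by (simp add: val_mult[OF P(1)])
        moreover have "D * P0 y \<le> d Q * P0 y"
          using D[OF Q'] P(2) by (simp add: mult_right_mono_neg)
        moreover have "0 < P0 (z Q)" "P0 (z P0) < 0" using z Q P(4) by auto
        ultimately show ?thesis unfolding v0 by (simp add: vge_def)
      qed simp
    qed
    then have "c P0 * z P0 + (\<Sum>P\<in>S - {P0}. c P * z P) \<noteq> 0"
      using val_add_dominant[OF P(1), of "c P0 * z P0"] P(3) z(1)[OF P(4)] by simp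
    then show False
      using rel sum.remove[OF S(2) P(4), of "\<lambda>P. c P * z P"] by simp
  qed
qed

text \<open>If the given transcendental \<open>x\<close> has no pole at \<open>N\<close>, some
  polynomial in \<open>x\<close> vanishes at \<open>N\<close>, and its inverse is the required
  generator.\<close>

lemma finite_over_pole:
  fixes N :: "'a \<Rightarrow> int"
  assumes K: "curve_function_field emb" and N: "discrete_valuation N"
  obtains y B where "N y < 0" "finite B" "lspan (rational_subfield emb y) B = UNIV"
proof -
  have "\<exists>x. (\<forall>p. p \<noteq> 0 \<longrightarrow> peval emb p x \<noteq> 0) \<and> (\<exists>B. finite B \<and>
      (\<forall>y. \<exists>c. (\<forall>b\<in>B. c b \<in> rational_subfield emb x) \<and> y = (\<Sum>b\<in>B. c b * b)))"
    using K unfolding curve_function_field_def peval_def by (elim conjE)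
  then obtain x B where x: "\<forall>p. p \<noteq> 0 \<longrightarrow> peval emb p x \<noteq> 0" and B: "finite B"
    and span: "\<forall>y. \<exists>c. (\<forall>b\<in>B. c b \<in> rational_subfield emb x) \<and> y = (\<Sum>b\<in>B. c b * b)"
    by (elim exE conjE)
  have tr: "peval emb p x \<noteq> 0" if "p \<noteq> 0" for p using x that by simp
  have spanx: "lspan (rational_subfield emb x) B = UNIV"
    using span unfolding lspan_def by blast
  show thesis
  proof (cases "N x < 0")
    case True
    then show thesis using B spanx by (intro that)
  next
    case False
    then have x: "vge N 0 x" by (simp add: vge_def)
    \<comment> \<open>If \<open>N\<close> were trivial on the nonzero polynomials in
      \<open>x\<close>, it would be nonnegative on the rational functions of \<open>x\<close>, then
      on the generators \<open>B\<close> by their multiplication table, and so on the whole field,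
      which is false for the inverse of a uniformizer.\<close>
    have "\<exists>h::'f poly. h \<noteq> 0 \<and> N (peval emb h x) \<noteq> 0"
    proof (rule ccontr)
      assume "\<not> ?thesis"
      then have triv: "N (peval emb h x) = 0" if "h \<noteq> 0" for h :: "'f poly" using that by blast
      have rat: "vge N 0 c" if c: "c \<in> rational_subfield emb x" for c
      proof -
        obtain p r where A: "peval emb r x \<noteq> 0" "c = peval emb p x / peval emb r x"
          using c by (auto simp: rational_subfield_iff[OF emb])
        have "r \<noteq> 0" using A peval_0[OF emb] by auto
        then show ?thesis using A triv tr peval_0[OF emb]
          by (cases "p = 0") (auto simp: vge_def val_divide[OF N])
      qed
      from span obtain e where e: "\<And>y b. b \<in> B \<Longrightarrow> e y b \<in> rational_subfield emb x"
        "\<And>y. y = (\<Sum>b\<in>B. e y b * b)" by metis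
      have base: "vge N 0 b" if "b \<in> B" for b
        using vge_lspan_basis[OF N B, of 1 "\<lambda>b b'. e (b * b')" b] e rat that by simp
      obtain \<pi> where \<pi>: "\<pi> \<noteq> 0" "N \<pi> = 1" using N by (auto simp: discrete_valuation_def)
      have "vge N 0 (\<Sum>b\<in>B. e (inverse \<pi>) b * b)"
        using e(1) rat base by (intro vge_sum[OF N] vge_mult_0[OF N]) auto
      then have "vge N 0 (inverse \<pi>)" by (simp flip: e(2))
      then show False using \<pi> by (simp add: vge_def val_inverse[OF N])
    qed
    then obtain h :: "'f poly" where h: "h \<noteq> 0" "N (peval emb h x) \<noteq> 0" by blast
    have "vge N 0 (peval emb h x)" by (rule vge_peval[OF emb N x])
    then have hpos: "N (peval emb h x) > 0" using h tr by (auto simp: vge_def)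
    have deg: "degree h > 0"
    proof (rule ccontr)
      assume "\<not> degree h > 0"
      then obtain c where "h = [:c:]" by (metis degree_eq_zeroE gr0I)
      then show False using h val_emb[OF emb N, of c] by (simp add: peval_pCons[OF emb] peval_0[OF emb])
    qed
    define y where "y = inverse (peval emb h x)"
    define X where "X = (\<lambda>i. x ^ i) ` {..<degree h}"
    \<comment> \<open>Generators of the tower: powers of \<open>x\<close> over the new rational
      subfield, times the old generators.\<close>
    define B' where "B' = (\<lambda>(u, b). u * b) ` (X \<times> B)"
    have B': "finite B'" using B by (simp add: B'_def X_def)
    have mem: "u * b \<in> B'" if "u \<in> X" "b \<in> B" for u b
      unfolding B'_def using that by (intro image_eqI[of _ _ "(u, b)"]) auto
    note sub = rational_subfield_subring[OF emb, of y]
    have gen: "rational_subfield emb x \<subseteq> lspan (rational_subfield emb y) X"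
      unfolding X_def y_def
      by (rule order_trans[OF rational_subfield_change_generator[OF tr deg]
            lspan_mono[OF rational_subfield_inverse_generator[OF emb]]])
    have step: "c * b \<in> lspan (rational_subfield emb y) B'" if c: "c \<in> rational_subfield emb x" and "b \<in> B" for c b
    proof -
      obtain e where e: "\<forall>u\<in>X. e u \<in> rational_subfield emb y" "c = (\<Sum>u\<in>X. e u * u)"
        using subsetD[OF gen c] unfolding lspan_def by blast
      have "c * b = (\<Sum>u\<in>X. e u * (u * b))" by (simp add: e(2) sum_distrib_right mult.assoc)
      also have "\<dots> \<in> lspan (rational_subfield emb y) B'"
        by (intro lspan_sum[OF sub] lspan_scale[OF sub] lspan_base[OF sub B'] mem \<open>b \<in> B\<close> bspec[OF e(1)])
      finally show ?thesis .
    qed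
    have "z \<in> lspan (rational_subfield emb y) B'" for z
    proof -
      obtain c where "\<forall>b\<in>B. c b \<in> rational_subfield emb x" "z = (\<Sum>b\<in>B. c b * b)"
        using span by blast
      then show ?thesis by (simp add: lspan_sum[OF sub] step)
    qed
    then have "lspan (rational_subfield emb y) B' = UNIV" by blast
    moreover have "N y < 0" using hpos by (simp add: y_def val_inverse[OF N])
    ultimately show thesis using B' by (intro that)
  qed
qed

end

context
  fixes emb :: "'f::{field,finite} \<Rightarrow> 'a::field"
  assumes emb: "field_embedding emb"
begin

text \<open>Divide the numerator of \<open>y ^ n * z\<close> by its denominator and the quotient by
  \<open>y ^ n\<close>. The first remainder gives a proper fraction \<open>s\<close>, regular at the
  poles of \<open>y\<close>; the second one, \<open>q\<close>, comes from a finite set. This is the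
  source of the finite index.\<close>

lemma rational_subfield_decomposition:
  fixes y :: 'a and n :: nat
  assumes "y \<noteq> 0" and z: "z \<in> rational_subfield emb y"
  shows "\<exists>p q s. (q = 0 \<or> degree q < n) \<and> z = peval emb p y + s / y ^ n + peval emb q y / y ^ n \<and>
    (\<forall>P. discrete_valuation P \<and> P y < 0 \<longrightarrow> vge P 0 s)"
proof -
  obtain u0 r where r: "peval emb r y \<noteq> 0" and u0: "z = peval emb u0 y / peval emb r y"
    using z by (auto simp: rational_subfield_iff[OF emb])
  have r0: "r \<noteq> 0" using r peval_0[OF emb] by auto
  define X :: "'f poly" where "X = [:0, 1:] ^ n"
  have X: "X \<noteq> 0" "degree X = n" "peval emb X y = y ^ n"
    by (simp_all add: X_def degree_power_eq peval_power[OF emb] peval_pCons[OF emb] peval_0[OF emb] emb_simps[OF emb])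
  define u where "u = X * u0"
  define p q where "p = u div r div X" and "q = u div r mod X"
  define s where "s = peval emb (u mod r) y / peval emb r y"
  have "u = (p * X + q) * r + u mod r" by (simp add: p_def q_def)
  then have "peval emb u y = peval emb ((p * X + q) * r + u mod r) y" by simp
  then have "y ^ n * peval emb u0 y = (peval emb p y * y ^ n + peval emb q y) * peval emb r y + s * peval emb r y"
    using r by (simp add: u_def peval_mult[OF emb] peval_add[OF emb] X s_def)
  then have "y ^ n * z = peval emb p y * y ^ n + peval emb q y + s"
    using r unfolding u0 by (simp add: field_simps)
  then have "z = peval emb p y + s / y ^ n + peval emb q y / y ^ n"
    using \<open>y \<noteq> 0\<close> by (simp add: field_simps)
  moreover have "q = 0 \<or> degree q < n"
    using degree_mod_less[OF X(1), of "u div r"] X(2) by (simp add: q_def)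
  moreover have "vge P 0 s" if P: "discrete_valuation P" "P y < 0" for P
  proof (cases "u mod r = 0")
    case True
    then show ?thesis by (simp add: s_def peval_0[OF emb])
  next
    case False
    then have "degree (u mod r) \<le> degree r" using degree_mod_less[OF r0, of u] by simp
    then have "int (degree r) * P y \<le> int (degree (u mod r)) * P y"
      using P(2) by (intro mult_right_mono_neg) auto
    moreover have "P s = P (peval emb (u mod r) y) - P (peval emb r y)"
      unfolding s_def using val_peval[OF emb P False] r by (intro val_divide[OF P(1)]) auto
    ultimately show ?thesis
      using val_peval[OF emb P False] val_peval[OF emb P r0] by (simp add: vge_def)
  qed
  ultimately show ?thesis by blast
qed

text \<open>The degree of the numerator suffices as exponent of \<open>y\<close>, because a
  denominator can only lower the order of the pole.\<close>

lemma vge_rational_subfield_uniform: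
  fixes y :: 'a
  assumes "finite C" "C \<subseteq> rational_subfield emb y"
  shows "\<exists>n::nat. \<forall>c\<in>C. \<forall>P. discrete_valuation P \<and> P y < 0 \<longrightarrow> vge P 0 (c / y ^ n)"
  using assms
proof (induction C)
  case (insert c C)
  then obtain n where n: "\<forall>c\<in>C. \<forall>P. discrete_valuation P \<and> P y < 0 \<longrightarrow> vge P 0 (c / y ^ n)" by auto
  obtain p r where r: "peval emb r y \<noteq> 0" and c: "c = peval emb p y / peval emb r y"
    using insert.prems by (auto simp: rational_subfield_iff[OF emb])
  have r0: "r \<noteq> 0" using r peval_0[OF emb] by auto
  have y: "vge P 0 (1 / y)" if P: "discrete_valuation P" "P y < 0" for P
    using P val_inverse[OF P(1), of y] by (simp add: vge_def divide_inverse)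
  have "vge P 0 (c' / y ^ (n + degree p))" if P: "discrete_valuation P" "P y < 0" and c': "c' \<in> insert c C" for P c'
  proof (cases "c' = c")
    case True
    have ynz: "y \<noteq> 0" using P by (auto simp: discrete_valuation_def)
    have "vge P 0 (c / y ^ degree p)"
    proof (cases "p = 0")
      case False
      have "P (c / y ^ degree p) = P (peval emb p y) - P (peval emb r y) - int (degree p) * P y"
        using val_peval[OF emb P False] r ynz by (simp add: c val_divide[OF P(1)] val_mult[OF P(1)] val_power[OF P(1)])
      also have "\<dots> = - (int (degree r) * P y)"
        using val_peval[OF emb P False] val_peval[OF emb P r0] by simp
      also have "\<dots> \<ge> 0" using P(2) by (simp add: mult_nonneg_nonpos)
      finally show ?thesis by (simp add: vge_def)
    qed (simp add: c peval_0[OF emb])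
    then have "vge P 0 ((1 / y) ^ n * (c / y ^ degree p))"
      by (intro vge_mult_0[OF P(1)] vge_power_0[OF P(1)] y[OF P])
    then show ?thesis by (simp add: True power_add power_one_over)
  next
    case False
    then have "vge P 0 (c' / y ^ n)" using n P c' by auto
    then have "vge P 0 ((1 / y) ^ degree p * (c' / y ^ n))"
      by (intro vge_mult_0[OF P(1)] vge_power_0[OF P(1)] y[OF P])
    then show ?thesis by (simp add: power_add power_one_over mult.commute)
  qed
  then show ?case by (intro exI[of _ "n + degree p"]) simp
qed simp

end

text \<open>Two powers of \<open>z\<close> with the same remainders \<open>q\<close> in all
  coordinates differ by \<open>r + \<sigma>\<close>, where \<open>r\<close> is regular wherever
  \<open>y\<close> is and \<sigma> is regular at the poles of \<open>y\<close>. Among the poles of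
  \<open>y\<close>, \<open>r\<close> therefore inherits from the powers of \<open>z\<close> the
  single pole at \<open>N\<close>.\<close>

lemma affine_algebra_pole:
  fixes emb :: "'f::{field,finite} \<Rightarrow> 'a::field" and N :: "'a \<Rightarrow> int"
  assumes K: "curve_function_field emb" and N: "discrete_valuation N"
  shows "\<exists>r\<in>carrier (affine_algebra N). r \<noteq> 0 \<and> N r < 0"
proof -
  have emb: "field_embedding emb" using K by (simp add: curve_function_field_def)
  obtain y B where y: "N y < 0" and B: "finite B" and span_B: "lspan (rational_subfield emb y) B = UNIV"
    by (rule finite_over_pole[OF emb K N])
  define k where "k = rational_subfield emb y"
  have ynz: "y \<noteq> 0" using y N by (auto simp: discrete_valuation_def)
  have "\<exists>c. (\<forall>b\<in>B. c b \<in> k) \<and> x = (\<Sum>b\<in>B. c b * b)" for x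
    using span_B unfolding lspan_def k_def by blast
  then obtain e where e: "\<And>x b. b \<in> B \<Longrightarrow> e x b \<in> k" "\<And>x. x = (\<Sum>b\<in>B. e x b * b)"
    by metis
  define C where "C = (\<lambda>(b, b', b''). e (b * b') b'') ` (B \<times> B \<times> B)"
  have C: "finite C" "C \<subseteq> k" using B e(1) by (auto simp: C_def)
  have inC: "e (b * b') b'' \<in> C" if "b \<in> B" "b' \<in> B" "b'' \<in> B" for b b' b''
    unfolding C_def using that by (intro image_eqI[of _ _ "(b, b', b'')"]) auto
  \<comment> \<open>\<open>h\<close> clears the structure constants of \<open>B\<close> where
    \<open>y\<close> is regular, and the power \<open>y ^ m\<close> does so at the poles of
    \<open>y\<close>.\<close>
  obtain h :: "'f poly" where h: "h \<noteq> 0" "\<forall>c\<in>C. \<exists>p. peval emb h y * c = peval emb p y"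
    using common_denominator[OF emb N y C[unfolded k_def]] by metis
  obtain m where m: "\<forall>c\<in>C. \<forall>P. discrete_valuation P \<and> P y < 0 \<longrightarrow> vge P 0 (c / y ^ m)"
    using vge_rational_subfield_uniform[OF emb C[unfolded k_def]] by metis
  define H where "H = peval emb h y"
  have Hnz: "H \<noteq> 0" using val_peval[OF emb N y h(1)] by (simp add: H_def)
  \<comment> \<open>\<open>m\<close> accounts for the structure constants, \<open>degree h\<close>
    for the pole of \<open>H\<close> itself at the poles of \<open>y\<close>.\<close>
  define n where "n = m + degree h"
  have finite_place: "vge P 0 (H * b)" if P: "discrete_valuation P" "\<not> P y < 0" and b: "b \<in> B" for P b
  proof (rule vge_lspan_basis[OF P(1) B Hnz e(2) _ b])
    fix b b' b'' assume "b \<in> B" "b' \<in> B" "b'' \<in> B"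
    then obtain p where "H * e (b * b') b'' = peval emb p y"
      using h(2) inC unfolding H_def by blast
    then show "vge P 0 (H * e (b * b') b'')"
      using vge_peval[OF emb P(1), of y p] P(2) by (simp add: vge_def)
  qed
  have infinite_place: "vge P 0 (H * b / y ^ n)" if P: "discrete_valuation P" "P y < 0" and b: "b \<in> B" for P b
  proof -
    have "vge P 0 (1 / y ^ m * b)"
      by (rule vge_lspan_basis[OF P(1) B _ e(2) _ b]) (use ynz m P inC in auto)
    moreover have "vge P 0 (H / y ^ degree h)"
      using val_peval[OF emb P h(1)] ynz Hnz by (simp add: vge_def H_def val_divide[OF P(1)] val_power[OF P(1)])
    ultimately have "vge P 0 (H / y ^ degree h * (1 / y ^ m * b))" by (rule vge_mult_0[OF P(1), rotated])
    then show ?thesis by (simp add: n_def power_add mult.commute)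
  qed
  define T where "T = {P. discrete_valuation P \<and> P y < 0}"
  have "finite T" unfolding T_def by (rule finite_poles[OF emb N y B span_B])
  \<comment> \<open>Zeros at the other poles of \<open>y\<close> keep the powers of \<open>z\<close>
    regular there. Where \<open>y\<close> is regular nothing is known about \<open>z\<close>, which
    is why its powers have to be corrected.\<close>
  obtain z where z: "z \<noteq> 0" "N z < 0" "\<And>P. P \<in> T - {N} \<Longrightarrow> 0 < P z"
    by (rule weak_approximation[OF N, of "T - {N}"]) (use \<open>finite T\<close> in \<open>auto simp: T_def\<close>)
  define dec where "dec x p q s \<longleftrightarrow> (q = 0 \<or> degree q < n) \<and> x = peval emb p y + s / y ^ n + peval emb q y / y ^ n \<and>
    (\<forall>P. discrete_valuation P \<and> P y < 0 \<longrightarrow> vge P 0 s)" for x s and p q :: "'f poly"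
  \<comment> \<open>The factor \<open>inverse H\<close> turns coordinates with respect to
    \<open>b\<close> into coordinates with respect to the corrected generators
    \<open>H * b\<close>.\<close>
  have "\<exists>p q s. dec (inverse H * e (z ^ t) b) p q s" if b: "b \<in> B" for t b
  proof -
    have "inverse H * e (z ^ t) b \<in> rational_subfield emb y"
      using e(1)[OF b] unfolding k_def H_def
      by (intro is_subringD[OF rational_subfield_subring[OF emb]] rational_subfield_inverse[OF emb]
          peval_in_rational_subfield[OF emb])
    then show ?thesis unfolding dec_def by (rule rational_subfield_decomposition[OF emb ynz])
  qed
  then have "\<forall>tb. \<exists>x. snd tb \<in> B \<longrightarrow> dec (inverse H * e (z ^ fst tb) (snd tb)) (fst x) (fst (snd x)) (snd (snd x))"
    by simp
  from choice[OF this] obtain f where f: "\<And>t b. b \<in> B \<Longrightarrow>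
      dec (inverse H * e (z ^ t) b) (fst (f (t, b))) (fst (snd (f (t, b)))) (snd (snd (f (t, b))))"
    by auto
  define p q s where "p t b = fst (f (t, b))" and "q t b = fst (snd (f (t, b)))" and "s t b = snd (snd (f (t, b)))" for t b
  have "dec (inverse H * e (z ^ t) b) (p t b) (q t b) (s t b)" if "b \<in> B" for t b
    using f[OF that] by (simp add: p_def q_def s_def)
  then have d: "\<And>t b. b \<in> B \<Longrightarrow> q t b = 0 \<or> degree (q t b) < n"
    "\<And>t b. b \<in> B \<Longrightarrow> inverse H * e (z ^ t) b = peval emb (p t b) y + s t b / y ^ n + peval emb (q t b) y / y ^ n"
    "\<And>t b P. b \<in> B \<Longrightarrow> discrete_valuation P \<Longrightarrow> P y < 0 \<Longrightarrow> vge P 0 (s t b)"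
    unfolding dec_def by simp_all
  \<comment> \<open>Each exponent \<open>t\<close> yields a tuple of remainders, one for each member
    of \<open>B\<close>, out of finitely many tuples.\<close>
  have "range (\<lambda>t. restrict (q t) B) \<subseteq> (\<Pi>\<^sub>E b\<in>B. {p. p = 0 \<or> degree p < n})"
    using d(1) by (intro image_subsetI restrict_PiE_iff[THEN iffD2]) simp
  then have "finite (range (\<lambda>t. restrict (q t) B))"
    by (rule finite_subset) (intro finite_PiE B finite_polys_below[OF emb])
  then have "\<not> inj (\<lambda>t. restrict (q t) B)"
    using finite_imageD infinite_UNIV_nat by blast
  then obtain t1 t2 where t: "t1 < t2" "restrict (q t1) B = restrict (q t2) B"
    unfolding inj_def by (metis linorder_neqE_nat)
  have q: "q t1 b = q t2 b" if "b \<in> B" for b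
    using fun_cong[OF t(2), of b] that by simp
  define r where "r = (\<Sum>b\<in>B. (peval emb (p t2 b) y - peval emb (p t1 b) y) * (H * b))"
  define \<sigma> where "\<sigma> = (\<Sum>b\<in>B. (s t2 b - s t1 b) * (H * b / y ^ n))"
  have pow: "z ^ t = (\<Sum>b\<in>B. (peval emb (p t b) y + s t b / y ^ n + peval emb (q t b) y / y ^ n) * (H * b))" for t
  proof -
    have "z ^ t = (\<Sum>b\<in>B. e (z ^ t) b * b)" by (rule e(2))
    also have "\<dots> = (\<Sum>b\<in>B. inverse H * e (z ^ t) b * (H * b))" using Hnz by (simp add: field_simps)
    also have "\<dots> = (\<Sum>b\<in>B. (peval emb (p t b) y + s t b / y ^ n + peval emb (q t b) y / y ^ n) * (H * b))"
      by (intro sum.cong refl) (simp only: d(2))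
    finally show ?thesis .
  qed
  \<comment> \<open>\<open>r\<close> can be read in two ways: its definition shows regularity where
    \<open>y\<close> is regular, and this equation shows regularity at the poles of \<open>y\<close>
    other than \<open>N\<close>.\<close>
  have r: "r = z ^ t2 + (- (z ^ t1) - \<sigma>)"
    unfolding pow r_def \<sigma>_def sum_subtractf[symmetric] sum.distrib[symmetric] sum_negf[symmetric]
    by (intro sum.cong refl) (simp add: q algebra_simps add_divide_distrib diff_divide_distrib)
  have \<sigma>: "vge P 0 \<sigma>" if P: "discrete_valuation P" "P y < 0" for P
    unfolding \<sigma>_def using d(3) infinite_place P
    by (intro vge_sum[OF P(1)] vge_mult_0[OF P(1)] vge_diff[OF P(1)]) auto
  have "vge P 0 r" if P: "discrete_valuation P" "P \<noteq> N" for P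
  proof (cases "P y < 0")
    case True
    have zP: "vge P 0 z" using z(3)[of P] P True by (auto simp: T_def vge_def)
    show ?thesis
      unfolding r using P True \<sigma>[OF P(1) True] zP by (intro vge_add vge_diff vge_power_0) (auto intro: vge_power_0)
  next
    case False
    have "vge P 0 y" using False by (simp add: vge_def)
    then show ?thesis
      unfolding r_def using finite_place[OF P(1) False]
      by (intro vge_sum[OF P(1)] vge_mult_0[OF P(1), of "_ - _"] vge_diff[OF P(1)] vge_peval[OF emb P(1)])
  qed
  then have "r \<in> carrier (affine_algebra N)"
    by (auto simp: affine_algebra_def val_ring_def vge_def)
  \<comment> \<open>At \<open>N\<close> the higher power \<open>z ^ t2\<close> dominates both
    \<open>z ^ t1\<close> and \<sigma>, which is regular there.\<close>
  moreover have "r \<noteq> 0 \<and> N r < 0"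
  proof -
    have Nz: "N (z ^ t2) = int t2 * N z" "N (z ^ t1) = int t1 * N z" using z(1) by (simp_all add: val_power[OF N])
    have lt: "int t2 * N z < int t1 * N z" "int t2 * N z < 0"
      using t(1) z(2) by (auto simp: mult_strict_right_mono_neg mult_pos_neg)
    have "vge N (N (z ^ t2) + 1) (z ^ t1)" "vge N (N (z ^ t2) + 1) \<sigma>"
      using \<sigma>[OF N y] lt Nz by (auto simp: vge_def)
    then have "vge N (N (z ^ t2) + 1) (- (z ^ t1) - \<sigma>)"
      by (intro vge_diff[OF N]) (simp_all only: vge_minus[OF N])
    from val_add_dominant[OF N _ this] z(1) lt Nz show ?thesis by (simp add: r)
  qed
  ultimately show ?thesis by blast
qed

section \<open>The exterior algebra\<close>

text \<open>Defined for arbitrary pairs of sets, so that it is multiplicative under disjoint unions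
  in either argument.\<close>

definition inv_sign :: "'n::linorder set \<Rightarrow> 'n set \<Rightarrow> 'k::comm_ring_1" where
  "inv_sign I J = (- 1) ^ card {(a, b). a \<in> I \<and> b \<in> J \<and> b < a}"

lemma wedge_eq: "wedge u v S = (\<Sum>I\<in>Pow S. inv_sign I (S - I) * u I * v (S - I))"
  by (simp add: wedge_def inv_sign_def)

lemma inv_sign_Un_left:
  fixes I I' J :: "'n::{finite,linorder} set"
  assumes "I \<inter> I' = {}"
  shows "inv_sign (I \<union> I') J = inv_sign I J * inv_sign I' J"
proof -
  have "{(a, b). a \<in> I \<union> I' \<and> b \<in> J \<and> b < a} =
      {(a, b). a \<in> I \<and> b \<in> J \<and> b < a} \<union> {(a, b). a \<in> I' \<and> b \<in> J \<and> b < a}" by auto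
  then show ?thesis
    unfolding inv_sign_def power_add[symmetric]
    by (subst card_Un_disjoint[symmetric]) (use assms in auto)
qed

lemma inv_sign_Un_right:
  fixes I J J' :: "'n::{finite,linorder} set"
  assumes "J \<inter> J' = {}"
  shows "inv_sign I (J \<union> J') = inv_sign I J * inv_sign I J'"
proof -
  have "{(a, b). a \<in> I \<and> b \<in> J \<union> J' \<and> b < a} =
      {(a, b). a \<in> I \<and> b \<in> J \<and> b < a} \<union> {(a, b). a \<in> I \<and> b \<in> J' \<and> b < a}" by auto
  then show ?thesis
    unfolding inv_sign_def power_add[symmetric]
    by (subst card_Un_disjoint[symmetric]) (use assms in auto)
qed

lemma inv_sign_empty [simp]: "inv_sign {} J = 1" "inv_sign I {} = 1"
  by (simp_all add: inv_sign_def)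

lemma inv_sign_singletons: "inv_sign {a} {b} = (if b < a then - 1 else 1)"
proof -
  have "{(a', b'). a' \<in> {a} \<and> b' \<in> {b} \<and> b' < a'} = (if b < a then {(a, b)} else {})" by auto
  then show ?thesis by (simp add: inv_sign_def)
qed

text \<open>Both sides are sums over ordered partitions of \<open>S\<close> into three blocks, and
  by multiplicativity of the sign both count the inversions between all three pairs of
  blocks.\<close>

lemma wedge_assoc:
  fixes u v x :: "('k::field, 'n::{finite,linorder}) exterior"
  shows "wedge (wedge u v) x = wedge u (wedge v x)"
proof
  fix S :: "'n set"
  define f where "f A I = inv_sign A (S - A) * inv_sign I (A - I) * u I * v (A - I) * x (S - A)" for A I
  define g where "g I J = inv_sign I (S - I) * inv_sign J (S - I - J) * u I * v J * x (S - I - J)" for I J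
  have "wedge (wedge u v) x S = (\<Sum>A\<in>Pow S. \<Sum>I\<in>Pow A. f A I)"
    by (simp add: wedge_eq f_def sum_distrib_left sum_distrib_right mult_ac)
  also have "\<dots> = (\<Sum>(A, I)\<in>Sigma (Pow S) Pow. f A I)" by (rule sum.Sigma) auto
  also have "\<dots> = (\<Sum>(I, J)\<in>(SIGMA I:Pow S. Pow (S - I)). g I J)"
  proof (rule sum.reindex_bij_witness[of _ "\<lambda>(I, J). (I \<union> J, I)" "\<lambda>(A, I). (I, A - I)"]; safe)
    fix A I assume A: "A \<subseteq> S" "I \<subseteq> A"
    have 1: "inv_sign A (S - A) = (inv_sign I (S - A) * inv_sign (A - I) (S - A) :: 'k)"
      using inv_sign_Un_left[of I "A - I" "S - A"] A by (simp add: Un_absorb1)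
    have 2: "inv_sign I (S - I) = (inv_sign I (A - I) * inv_sign I (S - A) :: 'k)"
    proof -
      have "S - I = (A - I) \<union> (S - A)" using A by auto
      moreover have "(A - I) \<inter> (S - A) = {}" by auto
      ultimately show ?thesis using inv_sign_Un_right[of "A - I" "S - A" I] by simp
    qed
    have 3: "S - I - (A - I) = S - A" using A by auto
    show "g I (A - I) = f A I" unfolding f_def g_def 1 2 3 by (simp add: mult_ac)
  qed auto
  also have "\<dots> = (\<Sum>I\<in>Pow S. \<Sum>J\<in>Pow (S - I). g I J)" by (rule sum.Sigma[symmetric]) auto
  also have "\<dots> = wedge u (wedge v x) S"
    by (simp add: wedge_eq g_def sum_distrib_left mult_ac)
  finally show "wedge (wedge u v) x S = wedge u (wedge v x) S" .
qed

lemma wedge_linear_left: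
  "wedge (\<lambda>S. c * u S + d * u' S) v = (\<lambda>S. c * wedge u v S + d * wedge u' v S)"
  by (simp add: fun_eq_iff wedge_eq sum_distrib_left algebra_simps sum.distrib)

lemma wedge_linear_right:
  "wedge u (\<lambda>S. c * v S + d * v' S) = (\<lambda>S. c * wedge u v S + d * wedge u v' S)"
  by (simp add: fun_eq_iff wedge_eq sum_distrib_left algebra_simps sum.distrib)

lemma wedge_scale_right: "wedge u (\<lambda>S. c * v S) = (\<lambda>S. c * wedge u v S)"
  using wedge_linear_right[of u c v 0 v] by simp

lemma wedge_add_left: "wedge (\<lambda>S. u S + u' S) v = (\<lambda>S. wedge u v S + wedge u' v S)"
  using wedge_linear_left[of 1 u 1 u' v] by simp

lemma wedge_add_right: "wedge u (\<lambda>S. v S + v' S) = (\<lambda>S. wedge u v S + wedge u v' S)"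
  using wedge_linear_right[of u 1 v 1 v'] by simp

lemma wedge_zero_right [simp]: "wedge u (\<lambda>S. 0) = (\<lambda>S. 0)"
  by (simp add: fun_eq_iff wedge_eq)

lemma wedge_ext_one: "wedge ext_one v = v"
proof
  fix S
  have "wedge ext_one v S = (\<Sum>I\<in>Pow S. if I = {} then v S else 0)"
    unfolding wedge_eq by (intro sum.cong) (auto simp: ext_one_def)
  also have "\<dots> = v S" by simp
  finally show "wedge ext_one v S = v S" .
qed

section \<open>Alternation, support and degree of wedges of vectors\<close>

lemma ext_vec_singleton [simp]: "ext_vec x {a} = x $ a"
  by (simp add: ext_vec_def)

lemma ext_vec_eq_0: "(\<And>a. S \<noteq> {a}) \<Longrightarrow> ext_vec x S = 0"
  by (simp add: ext_vec_def)

lemma ext_vec_linear: "ext_vec (c *s x + d *s y) = (\<lambda>S. c * ext_vec x S + d * ext_vec y S)"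
  by (auto simp: ext_vec_def sum_distrib_left sum.distrib[symmetric] intro!: sum.cong)

text \<open>Laplace expansion along the first vector.\<close>

lemma wedge_vec:
  "wedge (ext_vec x) g S = (\<Sum>a\<in>S. inv_sign {a} (S - {a}) * x $ a * g (S - {a}))"
proof -
  have "wedge (ext_vec x) g S = (\<Sum>I\<in>(\<lambda>a. {a}) ` S. inv_sign I (S - I) * ext_vec x I * g (S - I))"
    unfolding wedge_eq
  proof (rule sum.mono_neutral_right)
    show "\<forall>I\<in>Pow S - (\<lambda>a. {a}) ` S. inv_sign I (S - I) * ext_vec x I * g (S - I) = 0"
      by (intro ballI) (subst ext_vec_eq_0, auto)
  qed auto
  also have "\<dots> = (\<Sum>a\<in>S. inv_sign {a} (S - {a}) * x $ a * g (S - {a}))"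
    by (subst sum.reindex) (auto simp: inj_on_def)
  finally show ?thesis .
qed

lemma wedge_vec_self: "wedge (ext_vec x) (ext_vec x) = (\<lambda>S. 0)"
proof
  fix S
  show "wedge (ext_vec x) (ext_vec x) S = 0"
  proof (cases "\<exists>a b. a < b \<and> S = {a, b}")
    case True
    then obtain a b where ab: "a < b" "S = {a, b}" by blast
    then have "S - {a} = {b}" "S - {b} = {a}" by auto
    then show ?thesis using ab by (auto simp: wedge_vec inv_sign_singletons)
  next
    case False
    have "ext_vec x (S - {a}) = 0" if "a \<in> S" for a
    proof (rule ext_vec_eq_0)
      fix b show "S - {a} \<noteq> {b}"
      proof
        assume "S - {a} = {b}"
        then have "S = {a, b}" "a \<noteq> b" using that by auto
        then have "a < b \<and> S = {a, b} \<or> b < a \<and> S = {b, a}" by auto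
        then show False using False by auto
      qed
    qed
    then show ?thesis by (simp add: wedge_vec)
  qed
qed

lemma wedge_vec_self_left: "wedge (ext_vec x) (wedge (ext_vec x) g) = (\<lambda>S. 0)"
  by (simp add: wedge_assoc[symmetric] wedge_vec_self) (simp add: fun_eq_iff wedge_eq)

text \<open>Polarization: the wedge with a repeated vector vanishes for \<open>x\<close>,
  \<open>y\<close> and \<open>x + y\<close>.\<close>

lemma wedge_vec_commute:
  "wedge (ext_vec x) (wedge (ext_vec y) g) = (\<lambda>S. - wedge (ext_vec y) (wedge (ext_vec x) g) S)"
proof
  fix S
  have "ext_vec (x + y) = (\<lambda>S. 1 * ext_vec x S + 1 * ext_vec y S)"
    using ext_vec_linear[of 1 x 1 y] by simp
  then have "wedge (ext_vec (x + y)) (wedge (ext_vec (x + y)) g) S =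
      wedge (ext_vec x) (wedge (ext_vec x) g) S + wedge (ext_vec x) (wedge (ext_vec y) g) S +
      (wedge (ext_vec y) (wedge (ext_vec x) g) S + wedge (ext_vec y) (wedge (ext_vec y) g) S)"
    by (simp only: wedge_add_left wedge_add_right mult_1)
  then show "wedge (ext_vec x) (wedge (ext_vec y) g) S = - wedge (ext_vec y) (wedge (ext_vec x) g) S"
    by (simp add: wedge_vec_self_left eq_neg_iff_add_eq_0)
qed

lemma wedge_list_Nil [simp]: "wedge_list [] = ext_one"
  by (simp add: wedge_list_def)

lemma wedge_list_Cons [simp]: "wedge_list (x # xs) = wedge (ext_vec x) (wedge_list xs)"
  by (simp add: wedge_list_def)

lemma wedge_list_append: "wedge_list (xs @ ys) = wedge (wedge_list xs) (wedge_list ys)"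
  by (induction xs) (simp_all add: wedge_ext_one wedge_assoc)

lemma wedge_list_member: "x \<in> set xs \<Longrightarrow> wedge (ext_vec x) (wedge_list xs) = (\<lambda>S. 0)"
proof (induction xs)
  case (Cons y xs)
  show ?case
  proof (cases "x = y")
    case True
    then show ?thesis by (simp add: wedge_vec_self_left)
  next
    case False
    then have "wedge (ext_vec x) (wedge_list xs) = (\<lambda>S. 0)" using Cons by simp
    then show ?thesis by (simp add: wedge_vec_commute[of x y])
  qed
qed simp

lemma wedge_list_span:
  assumes "x \<in> vec.span (set xs)"
  shows "wedge (ext_vec x) (wedge_list xs) = (\<lambda>S. 0)"
  using assms
proof (induction rule: vec.span_induct_alt)
  case base
  show ?case by (simp add: fun_eq_iff wedge_vec)
next
  case (step c x y)
  have "ext_vec (c *s x + y) = (\<lambda>S. c * ext_vec x S + 1 * ext_vec y S)"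
    using ext_vec_linear[of c x 1 y] by simp
  then show ?case using step wedge_list_member[of x xs]
    by (simp only: wedge_linear_left) simp
qed

lemma wedge_list_support:
  "(\<And>x. x \<in> set xs \<Longrightarrow> x $ i = 0) \<Longrightarrow> i \<in> S \<Longrightarrow> wedge_list xs S = 0"
proof (induction xs arbitrary: S)
  case (Cons x xs)
  have "x $ a * wedge_list xs (S - {a}) = 0" for a
    using Cons by (cases "a = i") auto
  then show ?case by (auto simp: wedge_vec mult.assoc intro!: sum.neutral)
qed (auto simp: ext_one_def)

lemma wedge_list_homogeneous: "wedge_list xs S \<noteq> 0 \<Longrightarrow> card S = length xs"
proof (induction xs arbitrary: S)
  case (Cons x xs)
  then have "(\<Sum>a\<in>S. inv_sign {a} (S - {a}) * x $ a * wedge_list xs (S - {a})) \<noteq> 0"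
    by (simp add: wedge_vec)
  then obtain a where "a \<in> S" "inv_sign {a} (S - {a}) * x $ a * wedge_list xs (S - {a}) \<noteq> 0"
    by (rule sum.not_neutral_contains_not_neutral)
  then have a: "a \<in> S" "wedge_list xs (S - {a}) \<noteq> 0" by auto
  have "card S = Suc (card (S - {a}))" using a(1) by (intro card.remove) auto
  then show ?case using Cons.IH[OF a(2)] by simp
qed (auto simp: ext_one_def split: if_splits)

section \<open>Modules spanned by lists of vectors\<close>

text \<open>Lists instead of sets, because a wedge depends on an order and the inductions split off
  or exchange the head. Taking \<open>R = UNIV\<close> gives linear spans, so that one theory serves
  lattices and subspaces.\<close>

fun mspan :: "'k::field set \<Rightarrow> ('k ^ 'n::finite) list \<Rightarrow> ('k ^ 'n) set" where
  "mspan R [] = {0}"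
| "mspan R (u # us) = {r *s u + v |r v. r \<in> R \<and> v \<in> mspan R us}"

lemma mspan_ConsI: "x = r *s u + v \<Longrightarrow> r \<in> R \<Longrightarrow> v \<in> mspan R us \<Longrightarrow> x \<in> mspan R (u # us)"
  by auto

lemma submodule_overD:
  assumes "submodule_over R D"
  shows "0 \<in> D" "x \<in> D \<Longrightarrow> y \<in> D \<Longrightarrow> x + y \<in> D" "r \<in> R \<Longrightarrow> x \<in> D \<Longrightarrow> r *s x \<in> D"
  using assms by (auto simp: submodule_over_def)

lemma submodule_minus: "is_subring R \<Longrightarrow> submodule_over R D \<Longrightarrow> x \<in> D \<Longrightarrow> - x \<in> D"
  using submodule_overD(3)[of R D "-1" x] is_subringD(2)[of R] is_subringD(3)[of R 1] by simp

lemma submodule_diff: "is_subring R \<Longrightarrow> submodule_over R D \<Longrightarrow> x \<in> D \<Longrightarrow> y \<in> D \<Longrightarrow> x - y \<in> D"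
  using submodule_overD(2)[of R D x "- y"] submodule_minus by fastforce

lemma submodule_inter: "submodule_over R D \<Longrightarrow> submodule_over R E \<Longrightarrow> submodule_over R (D \<inter> E)"
  by (simp add: submodule_over_def)

lemma submodule_subspace: "vec.subspace V \<Longrightarrow> submodule_over R V"
  by (simp add: submodule_over_def vec.subspace_def)

lemma submodule_mspan:
  assumes R: "is_subring R"
  shows "submodule_over R (mspan R us)"
proof (induction us)
  case Nil
  then show ?case by (simp add: submodule_over_def)
next
  case (Cons u us)
  note IH = submodule_overD[OF Cons]
  show ?case
    unfolding submodule_over_def
  proof (intro conjI ballI)
    show "0 \<in> mspan R (u # us)"
      using IH(1) is_subringD(1)[OF R] by (auto intro!: exI[of _ 0])
  next
    fix x y assume "x \<in> mspan R (u # us)" "y \<in> mspan R (u # us)"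
    then obtain r v r' v' where "x = r *s u + v" "y = r' *s u + v'" "r \<in> R" "r' \<in> R" "v \<in> mspan R us" "v' \<in> mspan R us"
      by auto
    then have "x + y = (r + r') *s u + (v + v')" "r + r' \<in> R" "v + v' \<in> mspan R us"
      using IH(2) is_subringD(4)[OF R] by (auto simp: vec.scale_left_distrib)
    then show "x + y \<in> mspan R (u # us)" by (rule mspan_ConsI)
  next
    fix r x assume "r \<in> R" "x \<in> mspan R (u # us)"
    then obtain r' v where "x = r' *s u + v" "r' \<in> R" "v \<in> mspan R us" by auto
    then have "r *s x = (r * r') *s u + r *s v" "r * r' \<in> R" "r *s v \<in> mspan R us"
      using IH(3) is_subringD(5)[OF R] \<open>r \<in> R\<close> by (auto simp: vec.scale_right_distrib)
    then show "r *s x \<in> mspan R (u # us)" by (rule mspan_ConsI)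
  qed
qed

lemma mspan_least: "submodule_over R D \<Longrightarrow> set us \<subseteq> D \<Longrightarrow> mspan R us \<subseteq> D"
  by (induction us) (auto simp: submodule_overD)

lemma mspan_member:
  assumes R: "is_subring R"
  shows "u \<in> set us \<Longrightarrow> u \<in> mspan R us"
proof (induction us)
  case (Cons v us)
  show ?case
  proof (cases "u = v")
    case True
    then have "u = 1 *s v + 0" by simp
    then show ?thesis
      by (rule mspan_ConsI[OF _ is_subringD(2)[OF R] submodule_overD(1)[OF submodule_mspan[OF R]]])
  next
    case False
    then have "u = 0 *s v + u" "u \<in> mspan R us" using Cons by auto
    then show ?thesis by (intro mspan_ConsI[OF _ is_subringD(1)[OF R]])
  qed
qed simp

lemma mspan_subset_iff: "is_subring R \<Longrightarrow> mspan R us \<subseteq> mspan R vs \<longleftrightarrow> set us \<subseteq> mspan R vs"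
  using mspan_least[OF submodule_mspan] mspan_member by blast

lemma mspan_cong_set: "is_subring R \<Longrightarrow> set us = set vs \<Longrightarrow> mspan R us = mspan R vs"
  by (metis mspan_member mspan_subset_iff subsetI subset_antisym)

lemma mspan_append: "mspan R (us @ vs) = {x + y |x y. x \<in> mspan R us \<and> y \<in> mspan R vs}"
proof (induction us)
  case (Cons u us)
  show ?case
  proof (intro equalityI subsetI)
    fix z assume "z \<in> mspan R ((u # us) @ vs)"
    then obtain r x y where z: "r \<in> R" "x \<in> mspan R us" "y \<in> mspan R vs" "z = r *s u + (x + y)"
      by (auto simp: Cons)
    then have "z = (r *s u + x) + y" "r *s u + x \<in> mspan R (u # us)" by auto
    then show "z \<in> {x + y |x y. x \<in> mspan R (u # us) \<and> y \<in> mspan R vs}" using z(3) by blast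
  next
    fix z assume "z \<in> {x + y |x y. x \<in> mspan R (u # us) \<and> y \<in> mspan R vs}"
    then obtain r x y where z: "r \<in> R" "x \<in> mspan R us" "y \<in> mspan R vs" "z = (r *s u + x) + y"
      by auto
    then have "z = r *s u + (x + y)" "x + y \<in> mspan R (us @ vs)" by (auto simp: Cons add.assoc)
    then show "z \<in> mspan R ((u # us) @ vs)" using z(1) by auto
  qed
qed simp

lemma mspan_Cons_mono: "mspan R us = mspan R vs \<Longrightarrow> mspan R (u # us) = mspan R (u # vs)"
  by simp

lemma mspan_append_mono: "mspan R us = mspan R us' \<Longrightarrow> mspan R vs = mspan R vs' \<Longrightarrow> mspan R (us @ vs) = mspan R (us' @ vs')"
  by (simp add: mspan_append)

lemma mspan_mono: "R \<subseteq> R' \<Longrightarrow> mspan R us \<subseteq> mspan R' us"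
  by (induction us) auto

lemma mspan_UNIV: "mspan UNIV us = vec.span (set us)"
proof
  have "submodule_over UNIV (vec.span (set us))" by (rule submodule_subspace) simp
  then show "mspan UNIV us \<subseteq> vec.span (set us)" by (rule mspan_least) (rule vec.span_superset)
  have U: "is_subring (UNIV :: 'a set)" by (simp add: is_subring_def)
  have "vec.subspace (mspan UNIV us)"
    using submodule_mspan[OF U, of us] by (simp add: vec.subspace_def submodule_over_def)
  then show "vec.span (set us) \<subseteq> mspan UNIV us"
    using mspan_member[OF U] by (intro vec.span_minimal) auto
qed

lemma span_mspan:
  assumes R: "is_subring R"
  shows "vec.span (mspan R us) = vec.span (set us)"
proof
  show "vec.span (mspan R us) \<subseteq> vec.span (set us)"
    using mspan_mono[of R UNIV us] by (intro vec.span_minimal) (auto simp: mspan_UNIV)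
  show "vec.span (set us) \<subseteq> vec.span (mspan R us)"
    using mspan_member[OF R] by (intro vec.span_mono) auto
qed

lemma mspan_sum: "mspan R us = {\<Sum>i<length us. c i *s us ! i |c. \<forall>i<length us. c i \<in> R}"
proof (induction us)
  case (Cons u us)
  show ?case
  proof (intro equalityI subsetI)
    fix x assume "x \<in> mspan R (u # us)"
    then obtain r c where A: "r \<in> R" "\<forall>i<length us. c i \<in> R" "x = r *s u + (\<Sum>i<length us. c i *s us ! i)"
      unfolding mspan.simps Cons by blast
    show "x \<in> {\<Sum>i<length (u # us). c i *s (u # us) ! i |c. \<forall>i<length (u # us). c i \<in> R}"
      unfolding mem_Collect_eq
    proof (intro exI[of _ "case_nat r c"] conjI allI impI)
      show "x = (\<Sum>i<length (u # us). case_nat r c i *s (u # us) ! i)"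
        by (simp add: A(3) sum.lessThan_Suc_shift del: sum.lessThan_Suc)
      show "case_nat r c i \<in> R" if "i < length (u # us)" for i
        using A that by (cases i) auto
    qed
  next
    fix x assume "x \<in> {\<Sum>i<length (u # us). c i *s (u # us) ! i |c. \<forall>i<length (u # us). c i \<in> R}"
    then obtain c where c: "\<forall>i<length (u # us). c i \<in> R" "x = (\<Sum>i<length (u # us). c i *s (u # us) ! i)" by blast
    have "x = c 0 *s u + (\<Sum>i<length us. c (Suc i) *s us ! i)"
      by (simp add: c(2) sum.lessThan_Suc_shift del: sum.lessThan_Suc)
    moreover have "(\<Sum>i<length us. c (Suc i) *s us ! i) \<in> mspan R us"
      unfolding Cons using c(1) by (auto intro!: exI[of _ "\<lambda>i. c (Suc i)"])
    ultimately show "x \<in> mspan R (u # us)" using c(1) by auto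
  qed
qed auto

subsection \<open>Freeness\<close>

text \<open>Freeness in triangular form, matching the recursion of \<open>mspan\<close>. The usual
  form is \<open>mfree_relation\<close>; for \<open>R = UNIV\<close> it means that the entries are
  distinct and linearly independent.\<close>

fun mfree :: "'k::field set \<Rightarrow> ('k ^ 'n::finite) list \<Rightarrow> bool" where
  "mfree R [] \<longleftrightarrow> True"
| "mfree R (u # us) \<longleftrightarrow> mfree R us \<and> (\<forall>r\<in>R. r \<noteq> 0 \<longrightarrow> r *s u \<notin> mspan R us)"

lemma mfree_mono: "R \<subseteq> R' \<Longrightarrow> mfree R' us \<Longrightarrow> mfree R us"
proof (induction us)
  case (Cons u us)
  then show ?case using mspan_mono[of R R' us] by auto
qed simp

lemma mfree_relation:
  assumes "is_subring R"
  shows "mfree R us \<longleftrightarrow> (\<forall>c. (\<forall>i<length us. c i \<in> R) \<and> (\<Sum>i<length us. c i *s us ! i) = 0 \<longrightarrow> (\<forall>i<length us. c i = 0))"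
proof (induction us)
  case (Cons u us)
  note R = is_subringD[OF assms]
  have shift: "(\<Sum>i<length (u # us). c i *s (u # us) ! i) = c 0 *s u + (\<Sum>i<length us. c (Suc i) *s us ! i)" for c
    by (simp add: sum.lessThan_Suc_shift del: sum.lessThan_Suc)
  show ?case
  proof
    assume free: "mfree R (u # us)"
    show "\<forall>c. (\<forall>i<length (u # us). c i \<in> R) \<and> (\<Sum>i<length (u # us). c i *s (u # us) ! i) = 0 \<longrightarrow> (\<forall>i<length (u # us). c i = 0)"
    proof (rule allI, rule impI, elim conjE)
      fix c assume c: "\<forall>i<length (u # us). c i \<in> R" "(\<Sum>i<length (u # us). c i *s (u # us) ! i) = 0"
      have c0: "c 0 \<in> R" and cS: "\<forall>i<length us. c (Suc i) \<in> R" using c(1) by auto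
      have rel: "c 0 *s u = - (\<Sum>i<length us. c (Suc i) *s us ! i)"
        using c(2) unfolding shift by (simp add: eq_neg_iff_add_eq_0)
      have "(\<Sum>i<length us. c (Suc i) *s us ! i) \<in> mspan R us"
        unfolding mspan_sum using cS by (auto intro!: exI[of _ "\<lambda>i. c (Suc i)"])
      then have "c 0 *s u \<in> mspan R us"
        unfolding rel by (rule submodule_minus[OF assms submodule_mspan[OF assms]])
      then have z: "c 0 = 0" using free c0 by auto
      then have "(\<Sum>i<length us. c (Suc i) *s us ! i) = 0" using rel by simp
      then have "\<forall>i<length us. c (Suc i) = 0"
        using Cons free cS by (auto dest!: spec[of _ "\<lambda>i. c (Suc i)"])
      then show "\<forall>i<length (u # us). c i = 0" using z by (auto simp: less_Suc_eq_0_disj)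
    qed
  next
    assume H: "\<forall>c. (\<forall>i<length (u # us). c i \<in> R) \<and> (\<Sum>i<length (u # us). c i *s (u # us) ! i) = 0 \<longrightarrow> (\<forall>i<length (u # us). c i = 0)"
    have H': "case_nat r d i = 0" if "r \<in> R" "\<forall>i<length us. d i \<in> R" "r *s u + (\<Sum>i<length us. d i *s us ! i) = 0" "i < Suc (length us)" for r d i
      using spec[OF H, of "case_nat r d"] that unfolding shift by (auto simp: less_Suc_eq_0_disj)
    have "mfree R us" unfolding Cons
    proof (intro allI impI, elim conjE)
      fix c i assume "\<forall>i<length us. c i \<in> R" "(\<Sum>i<length us. c i *s us ! i) = 0" "i < length us"
      then show "c i = 0" using H'[of 0 c "Suc i"] R(1) by simp
    qed
    moreover have "r *s u \<notin> mspan R us" if r: "r \<in> R" "r \<noteq> 0" for r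
    proof
      assume "r *s u \<in> mspan R us"
      then obtain d where d: "\<forall>i<length us. d i \<in> R" "r *s u = (\<Sum>i<length us. d i *s us ! i)"
        unfolding mspan_sum by auto
      have "r *s u + (\<Sum>i<length us. (- d i) *s us ! i) = 0"
        by (simp add: d(2) sum_negf)
      then show False using H'[of r "\<lambda>i. - d i" 0] r d(1) R(3) by simp
    qed
    ultimately show "mfree R (u # us)" by simp
  qed
qed simp

lemma mfree_UNIV: "mfree UNIV us \<longleftrightarrow> distinct us \<and> vec.independent (set us)"
proof (induction us)
  case Nil
  then show ?case by (simp add: vec.independent_empty)
next
  case (Cons u us)
  have "(\<forall>r\<in>UNIV. r \<noteq> 0 \<longrightarrow> r *s u \<notin> mspan UNIV us) \<longleftrightarrow> u \<notin> vec.span (set us)"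
  proof
    assume "\<forall>r\<in>UNIV. r \<noteq> 0 \<longrightarrow> r *s u \<notin> mspan UNIV us"
    then have "1 *s u \<notin> mspan UNIV us" by (metis UNIV_I zero_neq_one)
    then show "u \<notin> vec.span (set us)" by (simp add: mspan_UNIV)
  next
    assume A: "u \<notin> vec.span (set us)"
    show "\<forall>r\<in>UNIV. r \<noteq> 0 \<longrightarrow> r *s u \<notin> mspan UNIV us"
    proof (intro ballI impI notI)
      fix r assume "r \<noteq> 0" "r *s u \<in> mspan UNIV us"
      then have "inverse r *s (r *s u) \<in> vec.span (set us)" by (simp only: mspan_UNIV vec.span_scale)
      then show False using A \<open>r \<noteq> 0\<close> by simp
    qed
  qed
  then show ?case
    using Cons vec.span_base[of u "set us"] by (auto simp: vec.independent_insert)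
qed

lemma mfree_UNIV_iff_dim: "mfree UNIV us \<longleftrightarrow> vec.dim (set us) = length us"
proof
  assume "mfree UNIV us"
  then show "vec.dim (set us) = length us"
    by (simp add: mfree_UNIV vec.dim_eq_card_independent distinct_card)
next
  assume A: "vec.dim (set us) = length us"
  have "vec.dim (set us) \<le> card (set us)" by (rule vec.dim_le_card') simp
  then have "card (set us) = length us" using A card_length[of us] by simp
  then show "mfree UNIV us"
    unfolding mfree_UNIV using A vec.card_le_dim_spanning[of "set us" "set us"]
    by (auto simp: card_distinct vec.span_superset)
qed

text \<open>Recovers freeness after changes of generators for which only the length of the list is
  tracked.\<close>

lemma mfree_UNIV_length:
  assumes "vec.span (set us) = vec.span (set vs)" "length us = length vs" "mfree UNIV us"
  shows "mfree UNIV vs"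
  using assms unfolding mfree_UNIV_iff_dim by (metis vec.dim_span)

text \<open>As \<open>us\<close> is independent over the field, a relation among \<open>xs\<close>
  amounts to a linear system for its coefficients, whose entries are the coordinates of
  \<open>xs\<close> in \<open>R\<close>. A nonzero solution over the field yields one in
  \<open>R\<close>.\<close>

lemma mfree_extend_scalars:
  assumes R: "is_subring R" and us: "mfree UNIV us" and xs: "set xs \<subseteq> mspan R us" and free: "mfree R xs"
  shows "mfree UNIV xs"
proof (rule ccontr)
  assume "\<not> mfree UNIV xs"
  have U: "is_subring (UNIV :: 'a set)" by (simp add: is_subring_def)
  obtain c where c: "(\<Sum>i<length xs. c i *s xs ! i) = 0" "\<exists>i<length xs. c i \<noteq> 0"
    using \<open>\<not> mfree UNIV xs\<close> unfolding mfree_relation[OF U] by auto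
  have "\<forall>i. \<exists>a. i < length xs \<longrightarrow> (\<forall>j<length us. a j \<in> R) \<and> xs ! i = (\<Sum>j<length us. a j *s us ! j)"
  proof
    fix i
    show "\<exists>a. i < length xs \<longrightarrow> (\<forall>j<length us. a j \<in> R) \<and> xs ! i = (\<Sum>j<length us. a j *s us ! j)"
    proof (cases "i < length xs")
      case True
      then have "xs ! i \<in> mspan R us" using xs nth_mem by blast
      then show ?thesis unfolding mspan_sum by auto
    qed simp
  qed
  from choice[OF this] obtain a where a: "\<forall>i<length xs. (\<forall>j<length us. a i j \<in> R) \<and> xs ! i = (\<Sum>j<length us. a i j *s us ! j)"
    by auto
  have swap: "(\<Sum>i<length xs. d i *s xs ! i) = (\<Sum>j<length us. (\<Sum>i<length xs. d i * a i j) *s us ! j)" for d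
  proof -
    have "(\<Sum>i<length xs. d i *s xs ! i) = (\<Sum>i<length xs. \<Sum>j<length us. (d i * a i j) *s us ! j)"
      using a by (intro sum.cong) (auto simp: vec.scale_sum_right)
    also have "\<dots> = (\<Sum>j<length us. \<Sum>i<length xs. (d i * a i j) *s us ! j)" by (rule sum.swap)
    finally show ?thesis by (simp add: vec.scale_sum_left)
  qed
  have "\<forall>j<length us. (\<Sum>i<length xs. c i * a i j) = 0"
    using us c(1) unfolding mfree_relation[OF U] swap by (auto dest!: spec[of _ "\<lambda>j. \<Sum>i<length xs. c i * a i j"])
  then have "\<exists>c. (\<forall>i\<in>{..<length xs}. c i \<in> R) \<and> (\<exists>i\<in>{..<length xs}. c i \<noteq> 0) \<and>
      (\<forall>j\<in>{..<length us}. (\<Sum>i\<in>{..<length xs}. c i * a i j) = 0)"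
    using a c(2) by (intro linear_system_solution[OF R] disjI2 exI[of _ c]) auto
  then obtain d where d: "\<forall>i<length xs. d i \<in> R" "\<exists>i<length xs. d i \<noteq> 0" "\<forall>j<length us. (\<Sum>i<length xs. d i * a i j) = 0"
    by auto
  have "(\<Sum>i<length xs. d i *s xs ! i) = 0" unfolding swap using d(3) by simp
  then show False using free d(1,2) unfolding mfree_relation[OF R] by auto
qed

subsection \<open>Submodules over a principal ideal domain\<close>

text \<open>The form in which principal ideals enter: a common divisor \<open>g\<close> with
  cofactors \<alpha>, \<beta> and Bezout coefficients \<open>s\<close>, \<open>t\<close>. The case
  \<open>a = b = 0\<close> with \<open>g = 0\<close> is included.\<close>

definition bezout :: "'k::field set \<Rightarrow> bool" where
  "bezout R \<longleftrightarrow> (\<forall>a\<in>R. \<forall>b\<in>R. \<exists>g\<in>R. \<exists>\<alpha>\<in>R. \<exists>\<beta>\<in>R. \<exists>s\<in>R. \<exists>t\<in>R. a = g * \<alpha> \<and> b = g * \<beta> \<and> g = s * a + t * b)"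

text \<open>The coordinates are gathered one at a time: those of the tail are already contained in
  \<open>d' *s f1\<close>, and a unimodular change of the pair \<open>b\<close>, \<open>f1\<close>
  gathers the first one as well.\<close>

lemma mspan_primitive_vector:
  assumes R: "is_subring R" and bez: "bezout R"
  shows "x \<in> mspan R us \<Longrightarrow> us \<noteq> [] \<Longrightarrow>
    \<exists>f fs d. Suc (length fs) = length us \<and> mspan R (f # fs) = mspan R us \<and> d \<in> R \<and> x = d *s f"
proof (induction us arbitrary: x)
  case (Cons b us)
  note r = is_subringD[OF R]
  show ?case
  proof (cases "us = []")
    case True
    with Cons.prems show ?thesis by (intro exI[of _ b] exI[of _ "[]"]) auto
  next
    case False
    obtain a x' where x: "a \<in> R" "x' \<in> mspan R us" "x = a *s b + x'" using Cons.prems by auto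
    from Cons.IH[OF x(2) False] obtain f1 fs d' where f1: "Suc (length fs) = length us"
      "mspan R (f1 # fs) = mspan R us" "d' \<in> R" "x' = d' *s f1" by (elim exE conjE)
    obtain g \<alpha> \<beta> s t where g: "g \<in> R" "\<alpha> \<in> R" "\<beta> \<in> R" "s \<in> R" "t \<in> R" "a = g * \<alpha>" "d' = g * \<beta>" "g = s * a + t * d'"
      using bspec[OF bspec[OF bez[unfolded bezout_def] x(1)] f1(3)] by (elim bexE conjE)
    show ?thesis
    proof (cases "g = 0")
      case True
      then have "x = 0 *s b" using g(6,7) x(3) f1(4) by simp
      then show ?thesis using r(1)
        by (intro exI[of _ b] exI[of _ us] exI[of _ 0] conjI) (simp_all del: mspan.simps)
    next
      case False
      have "g * (s * \<alpha> + t * \<beta>) = s * (g * \<alpha>) + t * (g * \<beta>)" by (simp add: algebra_simps)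
      also have "\<dots> = s * a + t * d'" by (simp only: g(6,7))
      also have "\<dots> = g * 1" by (simp only: g(8)[symmetric] mult_1_right)
      finally have "g * (s * \<alpha> + t * \<beta>) = g * 1" .
      then have unit: "s * \<alpha> + t * \<beta> = 1" using False by (simp only: mult_cancel_left) simp
      \<comment> \<open>The matrix with rows (\<alpha>, \<beta>) and (-t, s) has determinant 1 by
        \<open>unit\<close>; the facts \<open>b\<close> and \<open>f1'\<close> express its
        inverse.\<close>
      define f f2 where "f = \<alpha> *s b + \<beta> *s f1" and "f2 = - t *s b + s *s f1"
      have "s *s f - \<beta> *s f2 = (s * \<alpha> + t * \<beta>) *s b"
        by (simp add: f_def f2_def vec_eq_iff algebra_simps)
      then have b: "b = s *s f - \<beta> *s f2" by (simp add: unit)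
      have "t *s f + \<alpha> *s f2 = (s * \<alpha> + t * \<beta>) *s f1"
        by (simp add: f_def f2_def vec_eq_iff algebra_simps)
      then have f1': "f1 = t *s f + \<alpha> *s f2" by (simp add: unit)
      have M: "submodule_over R (mspan R vs)" for vs :: "('a ^ 'b) list" by (rule submodule_mspan[OF R])
      have in1: "f \<in> mspan R (f # f2 # fs)" "f2 \<in> mspan R (f # f2 # fs)" "set fs \<subseteq> mspan R (f # f2 # fs)"
        using mspan_member[OF R, of _ "f # f2 # fs"] by (auto simp del: mspan.simps)
      have in2: "b \<in> mspan R (b # f1 # fs)" "f1 \<in> mspan R (b # f1 # fs)" "set fs \<subseteq> mspan R (b # f1 # fs)"
        using mspan_member[OF R, of _ "b # f1 # fs"] by (auto simp del: mspan.simps)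
      note add = submodule_overD(2)[OF M] and scale = submodule_overD(3)[OF M]
      have "f \<in> mspan R (b # f1 # fs)" unfolding f_def
        by (rule add[OF scale[OF g(2) in2(1)] scale[OF g(3) in2(2)]])
      moreover have "f2 \<in> mspan R (b # f1 # fs)" unfolding f2_def
        by (rule add[OF scale[OF r(3)[OF g(5)] in2(1)] scale[OF g(4) in2(2)]])
      ultimately have sub1: "set (f # f2 # fs) \<subseteq> mspan R (b # f1 # fs)"
        using in2(3) by (simp del: mspan.simps)
      have "s *s f - \<beta> *s f2 \<in> mspan R (f # f2 # fs)"
        by (rule submodule_diff[OF R M scale[OF g(4) in1(1)] scale[OF g(3) in1(2)]])
      then have "b \<in> mspan R (f # f2 # fs)" by (simp only: b[symmetric])
      moreover have "t *s f + \<alpha> *s f2 \<in> mspan R (f # f2 # fs)"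
        by (rule add[OF scale[OF g(5) in1(1)] scale[OF g(2) in1(2)]])
      then have "f1 \<in> mspan R (f # f2 # fs)" by (simp only: f1'[symmetric])
      ultimately have "set (b # f1 # fs) \<subseteq> mspan R (f # f2 # fs)"
        using in1(3) by (simp del: mspan.simps)
      with sub1 have "mspan R (f # f2 # fs) = mspan R (b # f1 # fs)"
        unfolding set_eq_subset mspan_subset_iff[OF R] by (rule conjI)
      then have "mspan R (f # f2 # fs) = mspan R (b # us)" by (rule trans[OF _ mspan_Cons_mono[OF f1(2)]])
      moreover have "x = g *s f"
        by (simp add: x(3) f1(4) f_def g(6,7) vec_eq_iff algebra_simps)
      ultimately show ?thesis using f1(1) g(1)
        by (intro exI[of _ f] exI[of _ "f2 # fs"] exI[of _ g] conjI) (simp_all del: mspan.simps)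
    qed
  qed
qed simp

text \<open>A nonzero vector of \<open>N\<close> is a multiple of a member \<open>f\<close> of some
  generating list, and saturation puts \<open>f\<close> itself into \<open>N\<close>. After
  splitting off \<open>f\<close>, what remains of \<open>N\<close> lies in the module of the other
  generators and is again saturated there.\<close>

lemma saturated_submodule_summand:
  assumes R: "is_subring R" and bez: "bezout R"
  shows "submodule_over R N \<Longrightarrow> N \<subseteq> mspan R us \<Longrightarrow>
    (\<And>r x. r \<in> R \<Longrightarrow> r \<noteq> 0 \<Longrightarrow> x \<in> mspan R us \<Longrightarrow> r *s x \<in> N \<Longrightarrow> x \<in> N) \<Longrightarrow>
    \<exists>fs gs. length (gs @ fs) = length us \<and> mspan R (gs @ fs) = mspan R us \<and> mspan R fs = N"
proof (induction "length us" arbitrary: us N)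
  case 0
  then have "N = {0}" using submodule_overD(1)[of R N] by auto
  then show ?case using 0 by (intro exI[of _ "[]"]) simp
next
  case (Suc n)
  note N = submodule_overD[OF Suc.prems(1)]
  show ?case
  proof (cases "N = {0}")
    case True
    then show ?thesis by (intro exI[of _ "[]"] exI[of _ us]) simp
  next
    case False
    then obtain x where x: "x \<in> N" "x \<noteq> 0" using N(1) by auto
    have "us \<noteq> []" using Suc.hyps(2) by auto
    have "x \<in> mspan R us" using x Suc.prems(2) by auto
    from mspan_primitive_vector[OF R bez this \<open>us \<noteq> []\<close>] obtain f hs d where f: "Suc (length hs) = length us"
      "mspan R (f # hs) = mspan R us" "d \<in> R" "x = d *s f" by (elim exE conjE)
    have fus: "f \<in> mspan R us" using mspan_member[OF R, of f "f # hs"] unfolding f(2) by simp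
    have hus: "mspan R hs \<subseteq> mspan R us" unfolding f(2)[symmetric] mspan_subset_iff[OF R]
      using mspan_member[OF R, of _ "f # hs"] by auto
    have "d \<noteq> 0" using f(4) x by auto
    then have "f \<in> N" using Suc.prems(3)[OF f(3) _ fus] f(4) x by simp
    have sub: "submodule_over R (N \<inter> mspan R hs)"
      by (intro submodule_inter Suc.prems(1) submodule_mspan[OF R])
    have len: "n = length hs" using f(1) Suc.hyps(2) by simp
    have "\<exists>fs gs. length (gs @ fs) = length hs \<and> mspan R (gs @ fs) = mspan R hs \<and> mspan R fs = N \<inter> mspan R hs"
    proof (rule Suc.hyps(1)[OF len sub])
      fix r x assume "r \<in> R" "r \<noteq> 0" "x \<in> mspan R hs" "r *s x \<in> N \<inter> mspan R hs"
      then show "x \<in> N \<inter> mspan R hs" using Suc.prems(3)[of r x] hus by auto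
    qed simp
    then obtain fs gs where I: "length (gs @ fs) = length hs" "mspan R (gs @ fs) = mspan R hs" "mspan R fs = N \<inter> mspan R hs"
      by (elim exE conjE)
    have "mspan R (gs @ f # fs) = mspan R (f # (gs @ fs))" by (rule mspan_cong_set[OF R]) auto
    then have 1: "mspan R (gs @ f # fs) = mspan R us"
      by (rule trans[OF _ trans[OF mspan_Cons_mono[OF I(2)] f(2)]])
    have 2: "mspan R (f # fs) = N"
    proof
      have "set fs \<subseteq> N" using I(3) mspan_member[OF R, of _ fs] by blast
      then show "mspan R (f # fs) \<subseteq> N"
        using \<open>f \<in> N\<close> by (intro mspan_least Suc.prems(1)) simp
      show "N \<subseteq> mspan R (f # fs)"
      proof
        fix y assume y: "y \<in> N"
        then have "y \<in> mspan R (f # hs)" unfolding f(2) using Suc.prems(2) by blast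
        then obtain r h where h: "r \<in> R" "h \<in> mspan R hs" "y = r *s f + h" by auto
        have "y - r *s f \<in> N" by (intro submodule_diff[OF R Suc.prems(1)] y N(3) h(1) \<open>f \<in> N\<close>)
        then have "h \<in> mspan R fs" using h I(3) by simp
        then show "y \<in> mspan R (f # fs)" by (rule mspan_ConsI[OF h(3) h(1)])
      qed
    qed
    show ?thesis using 1 2 I(1) f(1) by (intro exI[of _ "f # fs"] exI[of _ gs]) (simp del: mspan.simps)
  qed
qed

section \<open>Change of basis in the exterior algebra\<close>

text \<open>The part of degree \<open>p\<close> of the exterior algebra generated by
  \<open>us\<close> over \<open>R\<close>. A monomial either avoids the head \<open>u\<close> or
  contains it once, which yields the recursion.\<close>

fun ext_span :: "'k::field set \<Rightarrow> ('k ^ 'n::{finite,linorder}) list \<Rightarrow> nat \<Rightarrow> ('k, 'n) exterior set" where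
  "ext_span R [] 0 = {(\<lambda>S. c * ext_one S) |c. c \<in> R}"
| "ext_span R [] (Suc p) = {\<lambda>S. 0}"
| "ext_span R (u # us) 0 = ext_span R us 0"
| "ext_span R (u # us) (Suc p) =
    {(\<lambda>S. g S + wedge (ext_vec u) h S) |g h. g \<in> ext_span R us (Suc p) \<and> h \<in> ext_span R us p}"

lemma ext_span_ConsI:
  "x = (\<lambda>S. g S + wedge (ext_vec u) h S) \<Longrightarrow> g \<in> ext_span R us (Suc p) \<Longrightarrow> h \<in> ext_span R us p \<Longrightarrow>
    x \<in> ext_span R (u # us) (Suc p)"
  by auto

lemma ext_span_linear:
  assumes R: "is_subring R"
  shows "x \<in> ext_span R us p \<Longrightarrow> y \<in> ext_span R us p \<Longrightarrow> r \<in> R \<Longrightarrow> s \<in> R \<Longrightarrow> (\<lambda>S. r * x S + s * y S) \<in> ext_span R us p"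
  using R
proof (induction R us p arbitrary: x y rule: ext_span.induct)
  case (1 R)
  then obtain c d where cd: "x = (\<lambda>S. c * ext_one S)" "y = (\<lambda>S. d * ext_one S)" "c \<in> R" "d \<in> R" by auto
  then have "(\<lambda>S. r * x S + s * y S) = (\<lambda>S. (r * c + s * d) * ext_one S)" by (simp add: algebra_simps)
  moreover have "r * c + s * d \<in> R" using cd 1 by (auto intro!: is_subringD)
  ultimately show ?case unfolding ext_span.simps by blast
next
  case (4 R u us p)
  then obtain g h g' h' where A: "x = (\<lambda>S. g S + wedge (ext_vec u) h S)" "y = (\<lambda>S. g' S + wedge (ext_vec u) h' S)"
    "g \<in> ext_span R us (Suc p)" "g' \<in> ext_span R us (Suc p)" "h \<in> ext_span R us p" "h' \<in> ext_span R us p"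
    by auto
  have "(\<lambda>S. r * x S + s * y S) = (\<lambda>S. (r * g S + s * g' S) + wedge (ext_vec u) (\<lambda>S. r * h S + s * h' S) S)"
    unfolding A(1,2) wedge_linear_right by (simp add: algebra_simps)
  moreover have "(\<lambda>S. r * g S + s * g' S) \<in> ext_span R us (Suc p)" using 4(1)[OF A(3,4)] 4 by simp
  moreover have "(\<lambda>S. r * h S + s * h' S) \<in> ext_span R us p" using 4(2)[OF A(5,6)] 4 by simp
  ultimately show ?case by (rule ext_span_ConsI)
qed simp_all

lemma wedge_ext_span:
  assumes R: "is_subring R"
  shows "v \<in> mspan R us \<Longrightarrow> g \<in> ext_span R us p \<Longrightarrow> wedge (ext_vec v) g \<in> ext_span R us (Suc p)"
proof (induction us arbitrary: v g p)
  case Nil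
  then show ?case by (simp add: fun_eq_iff wedge_vec)
next
  case (Cons u us)
  note r = is_subringD[OF R]
  obtain r v' where v: "v = r *s u + v'" "r \<in> R" "v' \<in> mspan R us" using Cons.prems(1) by auto
  have ev: "ext_vec v = (\<lambda>S. r * ext_vec u S + 1 * ext_vec v' S)"
    using ext_vec_linear[of r u 1 v'] v(1) by simp
  have W: "wedge (ext_vec v) x = (\<lambda>S. r * wedge (ext_vec u) x S + 1 * wedge (ext_vec v') x S)" for x
    unfolding ev by (rule wedge_linear_left)
  show ?case
  proof (cases p)
    case 0
    then have g: "g \<in> ext_span R us 0" using Cons.prems(2) by simp
    have "wedge (ext_vec v) g = (\<lambda>S. wedge (ext_vec v') g S + wedge (ext_vec u) (\<lambda>S. r * g S + 0 * g S) S)"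
      unfolding W wedge_linear_right by (simp add: algebra_simps)
    moreover have "wedge (ext_vec v') g \<in> ext_span R us (Suc 0)" by (rule Cons.IH[OF v(3) g])
    moreover have "(\<lambda>S. r * g S + 0 * g S) \<in> ext_span R us 0"
      by (rule ext_span_linear[OF R g g v(2) r(1)])
    ultimately show ?thesis unfolding 0 by (rule ext_span_ConsI)
  next
    case (Suc p')
    then obtain g1 g2 where g: "g = (\<lambda>S. g1 S + wedge (ext_vec u) g2 S)" "g1 \<in> ext_span R us p" "g2 \<in> ext_span R us p'"
      using Cons.prems(2) by auto
    \<comment> \<open>Moving \<open>v'\<close> past \<open>u\<close> costs a sign, and
      \<open>r *s u\<close> annihilates the summand that already contains \<open>u\<close>.\<close>
    have "wedge (ext_vec v) g = (\<lambda>S. wedge (ext_vec v') g1 S + wedge (ext_vec u) (\<lambda>S. r * g1 S + (- 1) * wedge (ext_vec v') g2 S) S)"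
      unfolding wedge_linear_right[of _ r g1 "- 1"] W g(1) wedge_add_right wedge_vec_self_left wedge_vec_commute[of v' u]
      by (simp add: fun_eq_iff algebra_simps)
    moreover have "wedge (ext_vec v') g1 \<in> ext_span R us (Suc p)" by (rule Cons.IH[OF v(3) g(2)])
    moreover have "(\<lambda>S. r * g1 S + (- 1) * wedge (ext_vec v') g2 S) \<in> ext_span R us p"
      using Cons.IH[OF v(3) g(3)] g(2) unfolding Suc
      by (intro ext_span_linear[OF R] v(2) r)
    ultimately show ?thesis by (rule ext_span_ConsI)
  qed
qed

lemma wedge_list_in_ext_span:
  assumes R: "is_subring R"
  shows "set vs \<subseteq> mspan R us \<Longrightarrow> wedge_list vs \<in> ext_span R us (length vs)"
proof (induction vs)
  case Nil
  have "ext_one \<in> ext_span R us 0"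
    using is_subringD(2)[OF R] by (induction us) (auto intro!: exI[of _ 1])
  then show ?case by simp
qed (simp add: wedge_ext_span[OF R])

lemma ext_span_above: "length us < p \<Longrightarrow> ext_span R us p \<subseteq> {\<lambda>S. 0}"
proof (induction us arbitrary: p)
  case Nil
  then show ?case by (cases p) auto
next
  case (Cons u us)
  then obtain p' where p: "p = Suc p'" "length us < p'" by (cases p) auto
  show ?case
  proof
    fix x assume "x \<in> ext_span R (u # us) p"
    then obtain g h where x: "x = (\<lambda>S. g S + wedge (ext_vec u) h S)" "g \<in> ext_span R us (Suc p')" "h \<in> ext_span R us p'"
      unfolding p ext_span.simps by blast
    have "g = (\<lambda>S. 0)" "h = (\<lambda>S. 0)" using Cons.IH[of p'] Cons.IH[of "Suc p'"] x(2,3) p(2) by auto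
    then show "x \<in> {\<lambda>S. 0}" by (simp add: x(1))
  qed
qed

text \<open>In top degree every generator has to occur, which leaves the multiples of a single
  wedge.\<close>

lemma ext_span_top: "x \<in> ext_span R us (length us) \<Longrightarrow> \<exists>c\<in>R. x = (\<lambda>S. c * wedge_list us S)"
proof (induction us arbitrary: x)
  case (Cons u us)
  then obtain g h where x: "x = (\<lambda>S. g S + wedge (ext_vec u) h S)" "g \<in> ext_span R us (Suc (length us))" "h \<in> ext_span R us (length us)"
    by auto
  have g: "g = (\<lambda>S. 0)" using ext_span_above[of us "Suc (length us)" R] x(2) by auto
  obtain c where c: "c \<in> R" "h = (\<lambda>S. c * wedge_list us S)" using Cons.IH[OF x(3)] by auto
  have "x = (\<lambda>S. c * wedge_list (u # us) S)"
    by (simp add: x(1) g c(2) wedge_scale_right)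
  then show ?case using c(1) by blast
qed auto

text \<open>The scalar is a determinant of coordinates of \<open>vs\<close> in terms of
  \<open>us\<close>; the description of the top degree supplies it without a theory of
  determinants.\<close>

lemma wedge_list_change_basis:
  assumes "is_subring R" "set vs \<subseteq> mspan R us" "length vs = length us"
  shows "\<exists>c\<in>R. wedge_list vs = (\<lambda>S. c * wedge_list us S)"
  using ext_span_top[of _ R us] wedge_list_in_ext_span[OF assms(1,2)] unfolding assms(3) by simp

lemma wedge_list_reduce:
  assumes "\<And>v. v \<in> set xs \<Longrightarrow> v - f v \<in> vec.span (set ys)"
  shows "wedge_list (xs @ ys) = wedge_list (map f xs @ ys)"
  using assms
proof (induction xs)
  case (Cons v xs)
  have "ext_vec v = (\<lambda>S. 1 * ext_vec (f v) S + 1 * ext_vec (v - f v) S)"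
    using ext_vec_linear[of 1 "f v" 1 "v - f v"] by simp
  then have "wedge (ext_vec v) g = (\<lambda>S. 1 * wedge (ext_vec (f v)) g S + 1 * wedge (ext_vec (v - f v)) g S)" for g
    by (simp only: wedge_linear_left)
  moreover have "v - f v \<in> vec.span (set (map f xs @ ys))"
    using Cons.prems[of v] vec.span_mono[of "set ys" "set (map f xs @ ys)"] by auto
  ultimately show ?case
    using Cons by (simp add: wedge_list_span)
qed simp

text \<open>The expansion along the first vector leaves one term, since that vector vanishes at the
  other coordinates in \<open>js\<close>. The sign depends on the order of
  \<open>js\<close>.\<close>

lemma wedge_list_identity_block:
  assumes "distinct js" "\<And>i j. i \<in> set js \<Longrightarrow> j \<in> set js \<Longrightarrow> e i $ j = (if i = j then 1 else 0)"
  shows "\<exists>n. wedge_list (map e js) (set js) = (- 1) ^ n"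
  using assms
proof (induction js)
  case (Cons i js)
  then obtain n where n: "wedge_list (map e js) (set js) = (- 1) ^ n" by auto
  have i: "i \<notin> set js" using Cons.prems by simp
  have "wedge_list (map e (i # js)) (set (i # js)) =
      (\<Sum>a\<in>insert i (set js). if a = i then inv_sign {i} (set js) * wedge_list (map e js) (set js) else 0)"
    unfolding list.map wedge_list_Cons list.set wedge_vec
  proof (intro sum.cong refl)
    fix a assume "a \<in> insert i (set js)"
    then have "e i $ a = (if i = a then 1 else 0)" using Cons.prems(2)[of i a] by simp
    then show "inv_sign {a} (insert i (set js) - {a}) * e i $ a * wedge_list (map e js) (insert i (set js) - {a}) =
        (if a = i then inv_sign {i} (set js) * wedge_list (map e js) (set js) else 0)"
      using i by auto
  qed
  also have "\<dots> = inv_sign {i} (set js) * (- 1) ^ n" by (simp add: n)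
  finally show ?case unfolding inv_sign_def power_add[symmetric] by blast
next
  case Nil
  show ?case by (intro exI[of _ 0]) (simp add: ext_one_def)
qed

section \<open>Norms\<close>

context
  fixes w :: "'k::field \<Rightarrow> int"
  assumes w: "discrete_valuation w" and q: "card (residue_field w) \<noteq> 0"
begin

lemma vabs_nonneg: "0 \<le> vabs w x"
  by (simp add: vabs_def)

lemma vabs_0 [simp]: "vabs w 0 = 0"
  by (simp add: vabs_def)

lemma vabs_1 [simp]: "vabs w 1 = 1"
  by (simp add: vabs_def val_one[OF w])

lemma vabs_minus [simp]: "vabs w (- x) = vabs w x"
  by (simp add: vabs_def val_minus[OF w])

lemma vabs_eq_0: "vabs w x = 0 \<longleftrightarrow> x = 0"
  using q by (simp add: vabs_def)

lemma vabs_mult: "vabs w (x * y) = vabs w x * vabs w y"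
  using q by (simp add: vabs_def val_mult[OF w] power_int_add[symmetric])

lemma vabs_add:
  assumes "vabs w x \<le> B" "vabs w y \<le> B"
  shows "vabs w (x + y) \<le> B"
proof (cases "x = 0 \<or> y = 0 \<or> x + y = 0")
  case True
  moreover have "0 \<le> B" using assms(1) vabs_nonneg[of x] by linarith
  ultimately show ?thesis using assms by auto
next
  case False
  have q1: "1 \<le> real (card (residue_field w))" using q by simp
  have "w x \<le> w (x + y) \<or> w y \<le> w (x + y)"
    using w False unfolding discrete_valuation_def by (metis min_le_iff_disj)
  then have "vabs w (x + y) \<le> vabs w x \<or> vabs w (x + y) \<le> vabs w y"
    using False q1 by (auto simp: vabs_def intro: power_int_increasing)
  then show ?thesis using assms by linarith
qed

lemma vabs_sum:
  assumes "0 \<le> B" "\<And>i. i \<in> A \<Longrightarrow> vabs w (f i) \<le> B"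
  shows "vabs w (sum f A) \<le> B"
  using assms(2)
  by (induction A rule: infinite_finite_induct) (auto intro: vabs_add simp: assms(1))

lemma vabs_sign [simp]: "vabs w ((- 1) ^ n) = 1"
  by (induction n) (simp_all add: vabs_mult)

lemma vabs_inv_sign [simp]: "vabs w (inv_sign I J) = 1"
  by (simp add: inv_sign_def)

lemma vabs_inverse: "x \<noteq> 0 \<Longrightarrow> vabs w (inverse x) = inverse (vabs w x)"
  using vabs_mult[of x "inverse x"] vabs_eq_0[of x] by (simp add: field_simps)

section \<open>The maximum norm on the exterior algebra\<close>

lemma ext_norm_ge: "vabs w (u I) \<le> ext_norm w (u :: ('k, 'n::finite) exterior)"
  unfolding ext_norm_def by (intro Max_ge) auto

lemma ext_norm_le: "(\<And>I. vabs w (u I) \<le> B) \<Longrightarrow> ext_norm w (u :: ('k, 'n::finite) exterior) \<le> B"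
  unfolding ext_norm_def by (intro Max.boundedI) auto

lemma ext_norm_attained: "\<exists>I. ext_norm w (u :: ('k, 'n::finite) exterior) = vabs w (u I)"
proof -
  have "ext_norm w u \<in> range (\<lambda>I. vabs w (u I))" unfolding ext_norm_def by (intro Max_in) auto
  then show ?thesis by auto
qed

lemma ext_norm_nonneg: "0 \<le> ext_norm w (u :: ('k, 'n::finite) exterior)"
  using ext_norm_ge[of u "{}"] vabs_nonneg[of "u {}"] by linarith

lemma ext_norm_scale: "ext_norm w (\<lambda>S. c * u S) = vabs w c * ext_norm w (u :: ('k, 'n::finite) exterior)"
proof (rule antisym)
  show "ext_norm w (\<lambda>S. c * u S) \<le> vabs w c * ext_norm w u"
    by (intro ext_norm_le) (simp add: vabs_mult mult_left_mono ext_norm_ge vabs_nonneg)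
  obtain I where "ext_norm w u = vabs w (u I)" using ext_norm_attained by blast
  then show "vabs w c * ext_norm w u \<le> ext_norm w (\<lambda>S. c * u S)"
    using ext_norm_ge[of "\<lambda>S. c * u S" I] by (simp add: vabs_mult)
qed

text \<open>The ultrametric inequality bounds the sum that forms a coefficient by its largest term,
  so no combinatorial constant appears.\<close>

lemma ext_norm_wedge:
  "ext_norm w (wedge u v) \<le> ext_norm w u * ext_norm w (v :: ('k, 'n::{finite,linorder}) exterior)"
proof (rule ext_norm_le)
  fix S
  have "vabs w (inv_sign I (S - I) * u I * v (S - I)) \<le> ext_norm w u * ext_norm w v" for I
    by (simp add: vabs_mult mult_mono ext_norm_ge ext_norm_nonneg vabs_nonneg)
  then show "vabs w (wedge u v S) \<le> ext_norm w u * ext_norm w v"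
    unfolding wedge_eq by (intro vabs_sum) (simp_all add: ext_norm_nonneg)
qed

lemma ext_norm_one: "ext_norm w (ext_one :: ('k, 'n::finite) exterior) = 1"
proof (rule antisym)
  show "ext_norm w (ext_one :: ('k, 'n::finite) exterior) \<le> 1"
    by (rule ext_norm_le) (simp add: ext_one_def)
  show "1 \<le> ext_norm w (ext_one :: ('k, 'n::finite) exterior)"
    using ext_norm_ge[of ext_one "{}"] by (simp add: ext_one_def)
qed

lemma ext_norm_wedge_list_le_1:
  fixes xs :: "('k ^ 'n::{finite,linorder}) list"
  assumes "\<And>x i. x \<in> set xs \<Longrightarrow> vabs w (x $ i) \<le> 1"
  shows "ext_norm w (wedge_list xs) \<le> 1"
  using assms
proof (induction xs)
  case (Cons x xs)
  have "vabs w (ext_vec x S) \<le> 1" for S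
  proof (cases "\<exists>a. S = {a}")
    case True
    then show ?thesis using Cons.prems by auto
  qed (simp add: ext_vec_eq_0)
  then have "ext_norm w (ext_vec x) \<le> 1" by (rule ext_norm_le)
  then have "ext_norm w (ext_vec x) * ext_norm w (wedge_list xs) \<le> 1 * 1"
    using Cons by (intro mult_mono) (auto simp: ext_norm_nonneg)
  then show ?case using ext_norm_wedge[of "ext_vec x" "wedge_list xs"] by simp
qed (simp add: ext_norm_one)

text \<open>Gaussian elimination with complete pivoting.\<close>

lemma subspace_reduced_basis:
  fixes E :: "('k ^ 'n::finite) set"
  assumes "vec.subspace E"
  shows "\<exists>I e. (\<forall>i\<in>I. e i \<in> E) \<and> (\<forall>i\<in>I. \<forall>j\<in>I. e i $ j = (if i = j then 1 else 0)) \<and>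
    (\<forall>i\<in>I. \<forall>j. vabs w (e i $ j) \<le> 1) \<and> (\<forall>v\<in>E. v = (\<Sum>i\<in>I. (v $ i) *s e i))"
  using assms
proof (induction "card {i. \<exists>v\<in>E. v $ i \<noteq> 0}" arbitrary: E rule: less_induct)
  case less
  note E = less.prems
  show ?case
  proof (cases "E \<subseteq> {0}")
    case True
    then show ?thesis by (intro exI[of _ "{}"]) auto
  next
    case False
    then obtain v where v: "v \<in> E" "v \<noteq> 0" by auto
    \<comment> \<open>The pivot is a coordinate of maximal absolute value, so that the normalized
      vector \<open>x\<close> has no coordinate of absolute value above 1.\<close>
    define m where "m = Max (range (\<lambda>i. vabs w (v $ i)))"
    have "m \<in> range (\<lambda>i. vabs w (v $ i))" unfolding m_def by (intro Max_in) auto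
    then obtain p where p: "m = vabs w (v $ p)" by auto
    have m: "vabs w (v $ i) \<le> vabs w (v $ p)" for i unfolding p[symmetric] m_def by (intro Max_ge) auto
    have vp: "v $ p \<noteq> 0"
    proof
      assume "v $ p = 0"
      then have "vabs w (v $ i) = 0" for i using m[of i] vabs_nonneg[of "v $ i"] by simp
      then show False using v(2) by (simp add: vabs_eq_0 vec_eq_iff)
    qed
    define x where "x = inverse (v $ p) *s v"
    have x: "x \<in> E" "x $ p = 1" using v(1) E vp by (auto simp: x_def vec.subspace_scale)
    have x1: "vabs w (x $ i) \<le> 1" for i
    proof -
      have "vabs w (v $ p) > 0" using vp vabs_eq_0[of "v $ p"] vabs_nonneg[of "v $ p"] by linarith
      moreover have "vabs w (x $ i) = inverse (vabs w (v $ p)) * vabs w (v $ i)"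
        by (simp only: x_def vector_smult_component vabs_mult vabs_inverse[OF vp])
      moreover have "inverse (vabs w (v $ p)) * vabs w (v $ i) \<le> inverse (vabs w (v $ p)) * vabs w (v $ p)"
        using m[of i] vabs_nonneg[of "v $ p"] by (intro mult_left_mono) auto
      ultimately show ?thesis by simp
    qed
    \<comment> \<open>All members of \<open>E'\<close> vanish at \<open>p\<close>, so the number of
      coordinates in use drops.\<close>
    define E' where "E' = {y\<in>E. y $ p = 0}"
    have E': "vec.subspace E'"
      using E by (auto simp: E'_def vec.subspace_def)
    have "{i. \<exists>v\<in>E'. v $ i \<noteq> 0} \<subset> {i. \<exists>v\<in>E. v $ i \<noteq> 0}"
    proof
      show "{i. \<exists>v\<in>E'. v $ i \<noteq> 0} \<subseteq> {i. \<exists>v\<in>E. v $ i \<noteq> 0}" by (auto simp: E'_def)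
      have "p \<in> {i. \<exists>v\<in>E. v $ i \<noteq> 0}" "p \<notin> {i. \<exists>v\<in>E'. v $ i \<noteq> 0}"
        using v vp by (auto simp: E'_def)
      then show "{i. \<exists>v\<in>E'. v $ i \<noteq> 0} \<noteq> {i. \<exists>v\<in>E. v $ i \<noteq> 0}" by auto
    qed
    then have "card {i. \<exists>v\<in>E'. v $ i \<noteq> 0} < card {i. \<exists>v\<in>E. v $ i \<noteq> 0}"
      by (intro psubset_card_mono) auto
    from less.hyps[OF this E'] obtain I e where I: "\<forall>i\<in>I. e i \<in> E'"
      "\<forall>i\<in>I. \<forall>j\<in>I. e i $ j = (if i = j then 1 else 0)"
      "\<forall>i\<in>I. \<forall>j. vabs w (e i $ j) \<le> 1" "\<forall>v\<in>E'. v = (\<Sum>i\<in>I. (v $ i) *s e i)"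
      by (elim exE conjE)
    have ep: "e i $ p = 0" if "i \<in> I" for i using I(1) that by (auto simp: E'_def)
    have pI: "p \<notin> I" using ep I(2) by force
    \<comment> \<open>\<open>x\<close> may be nonzero at the pivots of \<open>E'\<close>. Clearing
      them preserves the bound 1 by the ultrametric inequality, and the coordinate at
      \<open>p\<close> because each \<open>e i\<close> vanishes there.\<close>
    define y where "y = x - (\<Sum>i\<in>I. (x $ i) *s e i)"
    have y: "y \<in> E" unfolding y_def using x(1) I(1)
      by (intro vec.subspace_diff[OF E] vec.subspace_sum[OF E] vec.subspace_scale[OF E]) (auto simp: E'_def)
    have yp: "y $ p = 1" by (simp add: y_def x(2) ep)
    have yI: "y $ j = 0" if "j \<in> I" for j
    proof -
      have "(\<Sum>i\<in>I. x $ i * e i $ j) = (\<Sum>i\<in>I. if i = j then x $ i else 0)"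
        using I(2) that by (intro sum.cong) auto
      also have "\<dots> = x $ j" using that by simp
      finally show ?thesis by (simp add: y_def)
    qed
    have y1: "vabs w (y $ j) \<le> 1" for j
    proof -
      have "vabs w (x $ i * e i $ j) \<le> 1" if "i \<in> I" for i
        using mult_mono[of "vabs w (x $ i)" 1 "vabs w (e i $ j)" 1] x1 I(3) that vabs_nonneg
        by (simp add: vabs_mult)
      then have "vabs w (\<Sum>i\<in>I. x $ i * e i $ j) \<le> 1" by (intro vabs_sum) auto
      then have "vabs w (x $ j + - (\<Sum>i\<in>I. x $ i * e i $ j)) \<le> 1"
        using x1 by (intro vabs_add) auto
      then show ?thesis by (simp add: y_def)
    qed
    define e' where "e' i = (if i = p then y else e i)" for i
    have e'I: "e' i = e i" if "i \<in> I" for i using that pI by (auto simp: e'_def)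
    have e'p: "e' p = y" by (simp add: e'_def)
    have rep: "u = (\<Sum>i\<in>insert p I. (u $ i) *s e' i)" if u: "u \<in> E" for u
    proof -
      define u' where "u' = u - (u $ p) *s y"
      have "u' \<in> E'" using u y E yp by (auto simp: E'_def u'_def vec.subspace_diff vec.subspace_scale)
      then have "u' = (\<Sum>i\<in>I. (u' $ i) *s e i)" using I(4) by blast
      also have "\<dots> = (\<Sum>i\<in>I. (u $ i) *s e' i)"
        by (intro sum.cong) (auto simp: u'_def yI e'I)
      finally have "u = (u $ p) *s e' p + (\<Sum>i\<in>I. (u $ i) *s e' i)"
        by (simp add: u'_def e'p diff_eq_eq add.commute)
      then show ?thesis using pI by simp
    qed
    show ?thesis
    proof (intro exI[of _ "insert p I"] exI[of _ e'] conjI ballI allI)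
      fix i assume i: "i \<in> insert p I"
      show "e' i \<in> E" using i I(1) y e'I e'p by (auto simp: E'_def)
      show "vabs w (e' i $ j) \<le> 1" for j using i I(3) y1 e'I e'p by auto
      show "e' i $ j = (if i = j then 1 else 0)" if "j \<in> insert p I" for j
        using i that I(2) yp yI ep pI e'I e'p by auto
    next
      fix u assume "u \<in> E"
      then show "u = (\<Sum>i\<in>insert p I. (u $ i) *s e' i)" by (rule rep)
    qed
  qed
qed

text \<open>Take \<open>J\<close> with maximal coefficient for \<open>xs\<close> and look at the
  union of \<open>J\<close> with \<open>set js\<close>. There only the splitting with
  \<open>J\<close> as its first part contributes: \<open>xs\<close> avoids the coordinates in
  \<open>js\<close>, and a smaller first part would leave more indices than the block has vectors.
  Hence the coefficient is that of \<open>xs\<close> at \<open>J\<close>, up to sign.\<close>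

lemma ext_norm_append_identity_block:
  fixes e :: "'n::{finite,linorder} \<Rightarrow> ('k, 'n) vec" and xs :: "('k, 'n) vec list"
  assumes js: "distinct js" and e: "\<And>i j. i \<in> set js \<Longrightarrow> j \<in> set js \<Longrightarrow> e i $ j = (if i = j then 1 else 0)"
    and xs: "\<And>x j. x \<in> set xs \<Longrightarrow> j \<in> set js \<Longrightarrow> x $ j = 0"
  shows "ext_norm w (wedge_list xs) \<le> ext_norm w (wedge_list (xs @ map e js))"
proof -
  define I where "I = set js"
  obtain J where J: "ext_norm w (wedge_list xs) = vabs w (wedge_list xs J)" using ext_norm_attained by blast
  show ?thesis
  proof (cases "J \<inter> I = {}")
    case False
    then obtain j where "j \<in> J" "j \<in> set js" by (auto simp: I_def)
    then have "wedge_list xs J = 0" using xs by (intro wedge_list_support[of xs j J]) auto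
    then show ?thesis using J ext_norm_nonneg by simp
  next
    case True
    define f where "f A = inv_sign A (J \<union> I - A) * wedge_list xs A * wedge_list (map e js) (J \<union> I - A)" for A
    have "f A = 0" if A: "A \<subseteq> J \<union> I" "A \<noteq> J" for A
    proof (rule ccontr)
      assume "f A \<noteq> 0"
      then have nz: "wedge_list xs A \<noteq> 0" "wedge_list (map e js) (J \<union> I - A) \<noteq> 0" by (auto simp: f_def)
      have "A \<inter> I = {}"
      proof (rule ccontr)
        assume "A \<inter> I \<noteq> {}"
        then obtain j where "j \<in> A" "j \<in> set js" by (auto simp: I_def)
        then have "wedge_list xs A = 0" using xs by (intro wedge_list_support[of xs j A]) auto
        then show False using nz(1) by simp
      qed
      then have "A \<subset> J" using A by auto
      then have "I \<subset> J \<union> I - A" using True \<open>A \<inter> I = {}\<close> by auto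
      then have "card I < card (J \<union> I - A)" by (intro psubset_card_mono) auto
      moreover have "card (J \<union> I - A) = card I"
        using wedge_list_homogeneous[OF nz(2)] js by (simp add: I_def distinct_card)
      ultimately show False by simp
    qed
    then have "(\<Sum>A\<in>Pow (J \<union> I). f A) = (\<Sum>A\<in>{J}. f A)"
      by (intro sum.mono_neutral_right) auto
    moreover have "J \<union> I - J = I" using True by auto
    ultimately have "wedge_list (xs @ map e js) (J \<union> I) =
        inv_sign J I * wedge_list xs J * wedge_list (map e js) I"
      by (simp add: wedge_list_append wedge_eq f_def)
    moreover have "\<exists>n. wedge_list (map e js) I = (- 1) ^ n"
      unfolding I_def by (rule wedge_list_identity_block[OF js]) (rule e)
    then obtain n where "wedge_list (map e js) I = (- 1) ^ n" by (elim exE)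
    ultimately have "vabs w (wedge_list (xs @ map e js) (J \<union> I)) = vabs w (wedge_list xs J)"
      by (simp add: vabs_mult)
    then show ?thesis using J ext_norm_ge[of "wedge_list (xs @ map e js)" "J \<union> I"] by simp
  qed
qed

text \<open>For a reduced basis \<open>e'\<close> of the span of \<open>es\<close> both sides acquire the same factor when \<open>es\<close> is
  replaced by \<open>e'\<close>, and the other vectors may be changed modulo the span so that they vanish on the
  pivot coordinates. Then wedging with \<open>e'\<close> does not decrease norms, and submultiplicativity of the
  norm suffices.\<close>

lemma ext_norm_submodular:
  fixes es ls ms :: "('k ^ 'n::{finite,linorder}) list"
  assumes es: "mfree UNIV es"
  shows "ext_norm w (wedge_list es) * ext_norm w (wedge_list (ms @ ls @ es)) \<le>
    ext_norm w (wedge_list (ls @ es)) * ext_norm w (wedge_list (ms @ es))"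
proof -
  have U: "is_subring (UNIV :: 'k set)" by (simp add: is_subring_def)
  define E where "E = vec.span (set es)"
  have E: "vec.subspace E" by (simp add: E_def)
  from subspace_reduced_basis[OF E] obtain I e where I: "\<forall>i\<in>I. e i \<in> E"
      "\<forall>i\<in>I. \<forall>j\<in>I. e i $ j = (if i = j then 1 else 0)"
      "\<forall>i\<in>I. \<forall>j. vabs w (e i $ j) \<le> 1" "\<forall>v\<in>E. v = (\<Sum>i\<in>I. (v $ i) *s e i)"
    by (elim exE conjE)
  obtain js where js: "set js = I" "distinct js" using finite_distinct_list[of I] by auto
  define es' where "es' = map e js"
  have free: "mfree UNIV es'"
    unfolding mfree_relation[OF U]
  proof (intro allI impI, elim conjE)
    fix c k assume c: "(\<Sum>i<length es'. c i *s es' ! i) = 0" and k: "k < length es'"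
    have "(c i *s es' ! i) $ (js ! k) = (if i = k then c i else 0)" if "i < length es'" for i
    proof -
      have "js ! i \<in> I" "js ! k \<in> I" using that k js(1) by (auto simp: es'_def)
      then have "e (js ! i) $ (js ! k) = (if js ! i = js ! k then 1 else 0)" using I(2) by blast
      moreover have "js ! i = js ! k \<longleftrightarrow> i = k"
        using that k js(2) by (simp add: es'_def nth_eq_iff_index_eq)
      ultimately show ?thesis using that by (simp add: es'_def)
    qed
    then have "(\<Sum>i<length es'. c i *s es' ! i) $ (js ! k) = (\<Sum>i<length es'. if i = k then c i else 0)"
      unfolding sum_component by (intro sum.cong) auto
    then show "c k = 0" using c k by simp
  qed
  have span: "vec.span (set es') = E"
  proof
    show "vec.span (set es') \<subseteq> E" using I(1) js by (intro vec.span_minimal E) (auto simp: es'_def)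
    show "E \<subseteq> vec.span (set es')"
    proof
      fix v assume "v \<in> E"
      then have "v = (\<Sum>i\<in>I. (v $ i) *s e i)" using I(4) by blast
      moreover have "(\<Sum>i\<in>I. (v $ i) *s e i) \<in> vec.span (set es')"
        by (intro vec.span_sum vec.span_scale vec.span_base) (auto simp: es'_def js)
      ultimately show "v \<in> vec.span (set es')" by simp
    qed
  qed
  have len: "length es = length es'"
  proof -
    have "length es = vec.dim E" using es by (simp add: mfree_UNIV_iff_dim E_def)
    also have "\<dots> = vec.dim (set es')" by (simp only: span[symmetric] vec.dim_span)
    also have "\<dots> = length es'" using free by (simp add: mfree_UNIV_iff_dim)
    finally show ?thesis .
  qed
  have "set es \<subseteq> mspan UNIV es'" by (simp add: mspan_UNIV span E_def vec.span_superset)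
  \<comment> \<open>The determinant of \<open>es\<close> in terms of the reduced basis; it becomes a
    factor of each of the four norms.\<close>
  then obtain \<alpha> where \<alpha>: "wedge_list es = (\<lambda>S. \<alpha> * wedge_list es' S)"
    using wedge_list_change_basis[OF U _ len] by auto
  \<comment> \<open>The projection along \<open>E\<close> onto the vectors that vanish at the
    pivots.\<close>
  define f where "f v = v - (\<Sum>i\<in>I. (v $ i) *s e i)" for v
  have fspan: "v - f v \<in> vec.span (set es')" for v
  proof -
    have "(\<Sum>i\<in>I. (v $ i) *s e i) \<in> vec.span (set es')"
      by (intro vec.span_sum vec.span_scale vec.span_base) (simp add: es'_def js)
    then show ?thesis by (simp add: f_def)
  qed
  have fzero: "f v $ j = 0" if "j \<in> I" for v j
  proof -
    have "(\<Sum>i\<in>I. v $ i * e i $ j) = (\<Sum>i\<in>I. if i = j then v $ i else 0)"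
      using I(2) that by (intro sum.cong) auto
    also have "\<dots> = v $ j" using that by simp
    finally show ?thesis by (simp add: f_def)
  qed
  have norm_eq: "ext_norm w (wedge_list (xs @ es)) = vabs w \<alpha> * ext_norm w (wedge_list (map f xs @ es'))" for xs
  proof -
    have "wedge_list (xs @ es) = (\<lambda>S. \<alpha> * wedge_list (xs @ es') S)"
      by (simp only: wedge_list_append \<alpha> wedge_scale_right)
    also have "wedge_list (xs @ es') = wedge_list (map f xs @ es')"
      by (rule wedge_list_reduce) (rule fspan)
    finally show ?thesis by (simp only: ext_norm_scale)
  qed
  have lower: "ext_norm w (wedge_list (map f xs)) \<le> ext_norm w (wedge_list (map f xs @ es'))" for xs
    unfolding es'_def using js I(2) fzero by (intro ext_norm_append_identity_block) auto
  have es'1: "ext_norm w (wedge_list es') \<le> 1"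
    using I(3) js by (intro ext_norm_wedge_list_le_1) (auto simp: es'_def)
  define l m where "l = ext_norm w (wedge_list (map f ls))" and "m = ext_norm w (wedge_list (map f ms))"
  have nonneg: "0 \<le> vabs w \<alpha>" "0 \<le> l" "0 \<le> m"
    by (simp_all add: vabs_nonneg ext_norm_nonneg l_def m_def)
  have "ext_norm w (wedge_list es) \<le> vabs w \<alpha>"
    using mult_left_mono[OF es'1 nonneg(1)] by (simp add: \<alpha> ext_norm_scale)
  moreover have "ext_norm w (wedge_list (ms @ ls @ es)) \<le> vabs w \<alpha> * (m * l)"
  proof -
    have "ext_norm w (wedge_list (map f ms @ (map f ls @ es'))) \<le> m * ext_norm w (wedge_list (map f ls @ es'))"
      unfolding wedge_list_append[of "map f ms"] m_def by (rule ext_norm_wedge)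
    also have "\<dots> \<le> m * (l * 1)"
    proof (intro mult_left_mono nonneg(3))
      have "ext_norm w (wedge_list (map f ls @ es')) \<le> l * ext_norm w (wedge_list es')"
        unfolding wedge_list_append l_def by (rule ext_norm_wedge)
      also have "\<dots> \<le> l * 1" by (intro mult_left_mono nonneg es'1)
      finally show "ext_norm w (wedge_list (map f ls @ es')) \<le> l * 1" .
    qed
    finally show ?thesis
      using norm_eq[of "ms @ ls"] nonneg(1) by (simp add: mult_left_mono)
  qed
  \<comment> \<open>The left side is bounded from above by submultiplicativity; the right side is
    then bounded from below by \<open>lower\<close>, with \<alpha> occurring twice on each
    side.\<close>
  ultimately have "ext_norm w (wedge_list es) * ext_norm w (wedge_list (ms @ ls @ es)) \<le> vabs w \<alpha> * (vabs w \<alpha> * (m * l))"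
    by (intro mult_mono nonneg ext_norm_nonneg)
  also have "\<dots> = (vabs w \<alpha> * l) * (vabs w \<alpha> * m)" by simp
  also have "\<dots> \<le> ext_norm w (wedge_list (ls @ es)) * ext_norm w (wedge_list (ms @ es))"
    unfolding norm_eq l_def m_def
    by (intro mult_mono mult_left_mono lower) (auto simp: vabs_nonneg ext_norm_nonneg)
  finally show ?thesis .
qed

end

section \<open>Lattices\<close>

lemma mspan_set:
  assumes "distinct us"
  shows "mspan R us = {\<Sum>u\<in>set us. r u *s u |r. \<forall>u\<in>set us. r u \<in> R}"
  using assms
proof (induction us)
  case (Cons u us)
  have u: "u \<notin> set us" and IH: "mspan R us = {\<Sum>u\<in>set us. r u *s u |r. \<forall>u\<in>set us. r u \<in> R}"
    using Cons by auto
  show ?case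
  proof (intro equalityI subsetI)
    fix x assume "x \<in> mspan R (u # us)"
    then obtain s r where r: "s \<in> R" "\<forall>u\<in>set us. r u \<in> R" "x = s *s u + (\<Sum>u\<in>set us. r u *s u)"
      unfolding mspan.simps IH by blast
    have "(\<Sum>v\<in>set us. (r(u := s)) v *s v) = (\<Sum>v\<in>set us. r v *s v)"
      using u by (intro sum.cong) auto
    then have "x = (\<Sum>v\<in>set (u # us). (r(u := s)) v *s v)"
      using u by (simp add: r(3))
    moreover have "\<forall>v\<in>set (u # us). (r(u := s)) v \<in> R" using r by auto
    ultimately show "x \<in> {\<Sum>u\<in>set (u # us). r u *s u |r. \<forall>u\<in>set (u # us). r u \<in> R}" by blast
  next
    fix x assume "x \<in> {\<Sum>u\<in>set (u # us). r u *s u |r. \<forall>u\<in>set (u # us). r u \<in> R}"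
    then obtain r where r: "x = (\<Sum>u\<in>set (u # us). r u *s u)" "\<forall>u\<in>set (u # us). r u \<in> R" by blast
    show "x \<in> mspan R (u # us)"
    proof (rule mspan_ConsI)
      show "x = r u *s u + (\<Sum>u\<in>set us. r u *s u)" using r(1) u by simp
      show "(\<Sum>u\<in>set us. r u *s u) \<in> mspan R us" unfolding IH using r(2) by auto
      show "r u \<in> R" using r(2) by simp
    qed
  qed
qed simp

lemma lattice_basis_iff:
  assumes "distinct us"
  shows "lattice_basis R D (set us) \<longleftrightarrow> D = mspan R us \<and> mfree UNIV us"
proof -
  have "\<forall>u\<in>set us. r u = 0" if "vec.independent (set us)" "(\<Sum>u\<in>set us. r u *s u) = 0" for r
    using that by (auto simp: vec.dependent_finite)
  then show ?thesis
    using assms by (auto simp: lattice_basis_def basis_over_def mspan_set mfree_UNIV)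
qed

lemma lattice_basis_list:
  assumes "\<exists>B. lattice_basis R D B"
  shows "\<exists>us. D = mspan R us \<and> mfree UNIV us"
proof -
  obtain B where B: "lattice_basis R D B" using assms by blast
  then have "finite B" by (simp add: lattice_basis_def basis_over_def)
  then obtain us where "set us = B" "distinct us" using finite_distinct_list by blast
  then show ?thesis using B lattice_basis_iff[of us R D] by blast
qed

lemma mfree_appendD: "mfree R (xs @ ys) \<Longrightarrow> mfree R ys"
  by (induction xs) auto

text \<open>In a relation \<open>r *s u = x + y\<close> the vector \<open>y\<close> lies in the
  modules of both \<open>ls @ es\<close> and \<open>(u # ms) @ es\<close>, hence in that of
  \<open>es\<close>. This contradicts the freeness of \<open>(u # ms) @ es\<close>.\<close>

lemma mfree_append_Int:
  assumes R: "is_subring R"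
  shows "mfree R (ms @ es) \<Longrightarrow> mfree R (ls @ es) \<Longrightarrow> mspan R (ls @ es) \<inter> mspan R (ms @ es) \<subseteq> mspan R es \<Longrightarrow>
    mfree R (ms @ ls @ es)"
proof (induction ms)
  case (Cons u ms)
  have sub: "mspan R (ms @ es) \<subseteq> mspan R ((u # ms) @ es)"
    unfolding mspan_subset_iff[OF R] using mspan_member[OF R, of _ "(u # ms) @ es"] by (auto simp del: mspan.simps)
  have "r *s u \<notin> mspan R (ms @ ls @ es)" if r: "r \<in> R" "r \<noteq> 0" for r
  proof
    assume "r *s u \<in> mspan R (ms @ ls @ es)"
    then obtain x y where xy: "r *s u = x + y" "x \<in> mspan R ms" "y \<in> mspan R (ls @ es)"
      unfolding mspan_append[of R ms] by blast
    note M = submodule_mspan[OF R]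
    have "mspan R ms \<subseteq> mspan R ((u # ms) @ es)" "u \<in> mspan R ((u # ms) @ es)"
      using mspan_member[OF R, of _ "(u # ms) @ es"] unfolding mspan_subset_iff[OF R]
      by (auto simp del: mspan.simps)
    then have "r *s u - x \<in> mspan R ((u # ms) @ es)"
      using xy(2) by (intro submodule_diff[OF R M] submodule_overD(3)[OF M r(1)]) blast+
    then have "y \<in> mspan R es" using Cons.prems(3) xy by auto
    then have "r *s u \<in> mspan R (ms @ es)"
      unfolding mspan_append xy(1) using xy(2) by blast
    then show False using Cons.prems(1) r by simp
  qed
  moreover have "mfree R (ms @ ls @ es)"
    using Cons.prems sub by (intro Cons.IH) auto
  ultimately show ?case by simp
qed simp

context
  fixes w :: "'k::field \<Rightarrow> int" and R :: "'k set"
  assumes w: "discrete_valuation w" and q: "card (residue_field w) \<noteq> 0"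
    and R: "is_subring R" and R_large: "\<And>r. r \<in> R \<Longrightarrow> r \<noteq> 0 \<Longrightarrow> 1 \<le> vabs w r"
begin

text \<open>The scalar in the change of basis lies in \<open>R\<close>, so it is 0 or has absolute
  value at least 1. It can be a non-unit, since \<open>xs\<close> may generate a proper
  submodule.\<close>

lemma ext_norm_sublattice:
  fixes xs ys :: "('k ^ 'n::{finite,linorder}) list"
  assumes xs: "set xs \<subseteq> mspan R ys" and ys: "set ys \<subseteq> mspan UNIV xs" and len: "length xs = length ys"
  shows "ext_norm w (wedge_list ys) \<le> ext_norm w (wedge_list xs)"
proof -
  have U: "is_subring (UNIV :: 'k set)" by (simp add: is_subring_def)
  obtain c where c: "c \<in> R" "wedge_list xs = (\<lambda>S. c * wedge_list ys S)"
    using wedge_list_change_basis[OF R xs len] by auto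
  obtain d where d: "wedge_list ys = (\<lambda>S. d * wedge_list xs S)"
    using wedge_list_change_basis[OF U ys len[symmetric]] by auto
  have cn: "ext_norm w (wedge_list xs) = vabs w c * ext_norm w (wedge_list ys)"
    unfolding c(2) by (rule ext_norm_scale[OF w q])
  have dn: "ext_norm w (wedge_list ys) = vabs w d * ext_norm w (wedge_list xs)"
    by (subst d) (rule ext_norm_scale[OF w q])
  show ?thesis
  proof (cases "c = 0")
    \<comment> \<open>The norm of \<open>xs\<close> is 0 by \<open>cn\<close>, and then so is that
      of \<open>ys\<close> by \<open>dn\<close>.\<close>
    case True
    then show ?thesis using cn dn vabs_0[OF w q] by simp
  next
    case False
    then have "1 * ext_norm w (wedge_list ys) \<le> vabs w c * ext_norm w (wedge_list ys)"
      by (intro mult_right_mono R_large c(1) ext_norm_nonneg[OF w q])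
    then show ?thesis using cn by simp
  qed
qed

text \<open>Two bases of one lattice generate each other over \<open>R\<close>, so
  \<open>ext_norm_sublattice\<close> applies in both directions and the choice inside
  \<open>lattice_d\<close> does not matter.\<close>

lemma lattice_d_eq:
  fixes us :: "('k ^ 'n::{finite,linorder}) list"
  assumes us: "W \<inter> D = mspan R us" "mfree UNIV us"
  shows "lattice_d w R D W = ext_norm w (wedge_list us)"
proof (cases "W = {0}")
  case True
  have "us = []"
  proof (rule ccontr)
    assume "us \<noteq> []"
    then obtain u where u: "u \<in> set us" by (cases us) auto
    then have "u = 0" using mspan_member[OF R u] us(1) True by auto
    then show False using u us(2) vec.dependent_zero by (auto simp: mfree_UNIV)
  qed
  then show ?thesis using True by (simp add: lattice_d_def ext_norm_one[OF w q])
next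
  case False
  define P where "P ws \<longleftrightarrow> distinct ws \<and> lattice_basis R (W \<inter> D) (set ws)" for ws
  have "distinct us" using us(2) by (simp add: mfree_UNIV)
  then have "P us" using us lattice_basis_iff[of us R "W \<inter> D"] by (simp add: P_def)
  define vs where "vs = (SOME ws. P ws)"
  have "P vs" unfolding vs_def by (rule someI[of P]) fact
  then have vs: "W \<inter> D = mspan R vs" "mfree UNIV vs"
    using lattice_basis_iff[of vs R "W \<inter> D"] by (auto simp: P_def)
  have "vec.span (set us) = vec.span (set vs)"
    using span_mspan[OF R, of us] span_mspan[OF R, of vs] us(1) vs(1) by simp
  then have "vec.dim (set us) = vec.dim (set vs)" by (metis vec.dim_span)
  then have len: "length us = length vs" using us(2) vs(2) by (simp add: mfree_UNIV_iff_dim)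
  have le: "ext_norm w (wedge_list ys) \<le> ext_norm w (wedge_list xs)"
    if xy: "mspan R xs = mspan R ys" "length xs = length ys" for xs ys :: "('k, 'n) vec list"
  proof -
    have "set xs \<subseteq> mspan R ys" "set ys \<subseteq> mspan R xs"
      using xy(1) mspan_member[OF R, of _ xs] mspan_member[OF R, of _ ys] by auto
    moreover have "mspan R xs \<subseteq> mspan UNIV xs" by (rule mspan_mono) simp
    ultimately show ?thesis using xy(2) by (intro ext_norm_sublattice) auto
  qed
  have "ext_norm w (wedge_list us) = ext_norm w (wedge_list vs)"
    using le[of us vs] le[of vs us] len us(1) vs(1) by simp
  then show ?thesis using False unfolding lattice_d_def vs_def P_def by simp
qed

text \<open>Adapted bases: \<open>es\<close> is shared, \<open>ls\<close> and \<open>ms\<close>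
  complete it. The list \<open>fs\<close> has to be chosen separately, because the sum of
  \<open>L \<inter> \<Delta>\<close> and \<open>M \<inter> \<Delta>\<close> can be a proper
  submodule of \<open>(L + M) \<inter> \<Delta>\<close>.\<close>

lemma lattice_submodular:
  fixes L M \<Delta> :: "('k ^ 'n::{finite,linorder}) set"
  assumes bez: "bezout R" and \<Delta>: "\<Delta> = mspan R ds" "mfree UNIV ds"
    and L: "vec.subspace L" "L \<inter> \<Delta> = mspan R lb" "mfree UNIV lb" "vec.span (L \<inter> \<Delta>) = L"
    and M: "vec.subspace M" "M \<inter> \<Delta> = mspan R mb" "mfree UNIV mb" "vec.span (M \<inter> \<Delta>) = M"
  shows "\<exists>es ls ms fs. L \<inter> M \<inter> \<Delta> = mspan R es \<and> mfree UNIV es \<and> L \<inter> \<Delta> = mspan R (ls @ es) \<and> mfree UNIV (ls @ es) \<and>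
    M \<inter> \<Delta> = mspan R (ms @ es) \<and> mfree UNIV (ms @ es) \<and> (L + M) \<inter> \<Delta> = mspan R fs \<and> mfree UNIV fs \<and>
    vec.span (L \<inter> M \<inter> \<Delta>) = L \<inter> M \<and> vec.span ((L + M) \<inter> \<Delta>) = L + M \<and>
    mfree UNIV (ms @ ls @ es) \<and> length fs = length (ms @ ls @ es) \<and> set (ms @ ls @ es) \<subseteq> mspan R fs"
proof -
  note MS = submodule_mspan[OF R]
  have LM_eq: "L + M = {x + y |x y. x \<in> L \<and> y \<in> M}" by (auto simp: set_plus_def)
  have LM: "vec.subspace (L + M)" unfolding LM_eq by (rule vec.subspace_sums[OF L(1) M(1)])
  \<comment> \<open>A subspace allows division by \<open>r\<close>, so it cuts out a saturated
    submodule.\<close>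
  have sat: "x \<in> W" if "vec.subspace W" "r \<noteq> 0" "r *s x \<in> W" for r x and W :: "('k, 'n) vec set"
    using vec.subspace_scale[OF that(1,3), of "inverse r"] that(2) by simp
  have summand: "\<exists>fs gs. length (gs @ fs) = length us \<and> mspan R (gs @ fs) = mspan R us \<and> mspan R fs = W \<inter> mspan R us"
    if W: "vec.subspace W" for W :: "('k, 'n) vec set" and us
    by (rule saturated_submodule_summand[OF R bez])
      (use sat[OF W] submodule_inter[OF submodule_subspace[OF W] MS] in auto)
  have free: "mfree UNIV ys" if "mfree UNIV xs" "mspan R ys = mspan R xs" "length ys = length xs" for xs ys :: "('k, 'n) vec list"
  proof (rule mfree_UNIV_length[OF _ _ that(1)])
    show "vec.span (set xs) = vec.span (set ys)"
      using span_mspan[OF R, of xs] span_mspan[OF R, of ys] that(2) by simp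
  qed (use that(3) in simp)
  obtain es ls where el: "length (ls @ es) = length lb" "mspan R (ls @ es) = mspan R lb" "mspan R es = M \<inter> mspan R lb"
    using summand[OF M(1), of lb] by (elim exE conjE)
  obtain es' ms where em: "length (ms @ es') = length mb" "mspan R (ms @ es') = mspan R mb" "mspan R es' = L \<inter> mspan R mb"
    using summand[OF L(1), of mb] by (elim exE conjE)
  obtain fs gs where f: "length (gs @ fs) = length ds" "mspan R (gs @ fs) = mspan R ds" "mspan R fs = (L + M) \<inter> mspan R ds"
    using summand[OF LM, of ds] by (elim exE conjE)
  \<comment> \<open>The splittings for \<open>L\<close> and \<open>M\<close> give two bases of the
    same module. They have equal length, so \<open>es\<close> may take the place of
    \<open>es'\<close>.\<close>
  have E: "L \<inter> M \<inter> \<Delta> = mspan R es" "L \<inter> M \<inter> \<Delta> = mspan R es'"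
    using el(3) em(3) L(2) M(2) by auto
  have free_l: "mfree UNIV (ls @ es)" by (rule free[OF L(3) el(2,1)])
  have free_m': "mfree UNIV (ms @ es')" by (rule free[OF M(3) em(2,1)])
  have free_e: "mfree UNIV es" "mfree UNIV es'" by (rule mfree_appendD[OF free_l], rule mfree_appendD[OF free_m'])
  have free_f: "mfree UNIV fs" using free[OF \<Delta>(2) f(2,1)] by (rule mfree_appendD)
  have "vec.dim (set es) = vec.dim (set es')"
  proof -
    have "vec.span (set es) = vec.span (set es')"
      using span_mspan[OF R, of es] span_mspan[OF R, of es'] E by simp
    then show ?thesis by (metis vec.dim_span)
  qed
  then have len_e: "length es = length es'" using free_e by (simp add: mfree_UNIV_iff_dim)
  have m: "mspan R (ms @ es) = mspan R mb"
    using mspan_append_mono[of R ms ms es es'] E em(2) by simp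
  have free_m: "mfree UNIV (ms @ es)"
    using em(1) len_e by (intro free[OF M(3) m]) simp
  have Ldelta: "L \<inter> \<Delta> = mspan R (ls @ es)" and Mdelta: "M \<inter> \<Delta> = mspan R (ms @ es)"
    using L(2) M(2) el(2) m by simp_all
  have Fdelta: "(L + M) \<inter> \<Delta> = mspan R fs" using f(3) \<Delta>(1) by simp
  \<comment> \<open>The intersection hypothesis handles relations over \<open>R\<close>; the passage
    to the field succeeds because all these vectors lie in \<Delta>, whose basis \<open>ds\<close>
    is independent over the field.\<close>
  have "mfree R (ms @ ls @ es)"
  proof (rule mfree_append_Int[OF R])
    show "mfree R (ms @ es)" "mfree R (ls @ es)"
      using mfree_mono[OF subset_UNIV free_m] mfree_mono[OF subset_UNIV free_l] by auto
    show "mspan R (ls @ es) \<inter> mspan R (ms @ es) \<subseteq> mspan R es"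
      using Ldelta Mdelta E(1) by blast
  qed
  moreover have in_L: "set (ls @ es) \<subseteq> L \<inter> \<Delta>" and in_M: "set (ms @ es) \<subseteq> M \<inter> \<Delta>"
    unfolding Ldelta Mdelta using mspan_member[OF R, of _ "ls @ es"] mspan_member[OF R, of _ "ms @ es"] by blast+
  ultimately have free_mle: "mfree UNIV (ms @ ls @ es)"
    using \<Delta> by (intro mfree_extend_scalars[OF R \<Delta>(2)]) auto
  have "L \<subseteq> L + M" "M \<subseteq> L + M"
    unfolding LM_eq using vec.subspace_0[OF L(1)] vec.subspace_0[OF M(1)] by force+
  then have sub: "set (ms @ ls @ es) \<subseteq> mspan R fs"
    unfolding Fdelta[symmetric] using in_L in_M by auto
  have spanL: "vec.span (set (ls @ es)) = L" and spanM: "vec.span (set (ms @ es)) = M"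
    using span_mspan[OF R, of "ls @ es"] span_mspan[OF R, of "ms @ es"] L(4) M(4) Ldelta Mdelta by simp_all
  have "set (ms @ ls @ es) = set (ls @ es) \<union> set (ms @ es)" by auto
  then have span_mle: "vec.span (set (ms @ ls @ es)) = L + M"
    unfolding LM_eq by (simp only: vec.span_Un spanL spanM)
  have span_f: "vec.span (set fs) = L + M"
  proof
    have "set fs \<subseteq> L + M" using Fdelta mspan_member[OF R, of _ fs] by blast
    then show "vec.span (set fs) \<subseteq> L + M" by (intro vec.span_minimal LM)
    have "vec.span (set (ms @ ls @ es)) \<subseteq> vec.span (mspan R fs)" by (intro vec.span_mono sub)
    then show "L + M \<subseteq> vec.span (set fs)" by (simp only: span_mle span_mspan[OF R])
  qed
  have dim: "vec.dim V = length xs" if "vec.span (set xs) = V" "mfree UNIV xs" for V and xs :: "('k, 'n) vec list"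
    using that vec.dim_span[of "set xs"] by (simp add: mfree_UNIV_iff_dim)
  have len_f: "length fs = length (ms @ ls @ es)"
    using dim[OF span_f free_f] dim[OF span_mle free_mle] by simp
  \<comment> \<open>The dimension formula shows that \<open>es\<close> is long enough to span
    \<open>L \<inter> M\<close>.\<close>
  have "vec.dim (L + M) + vec.dim (L \<inter> M) = vec.dim L + vec.dim M"
    unfolding LM_eq by (rule vec.dim_sums_Int[OF L(1) M(1)])
  then have dimLM: "vec.dim (L \<inter> M) = length es"
    using dim[OF span_mle free_mle] dim[OF spanL free_l] dim[OF spanM free_m] by simp
  have "vec.span (set es) = L \<inter> M"
  proof (rule vec.subspace_dim_equal)
    show "vec.subspace (L \<inter> M)" by (rule vec.subspace_inter[OF L(1) M(1)])
    then show "vec.span (set es) \<subseteq> L \<inter> M"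
      using in_L in_M by (intro vec.span_minimal) auto
    show "vec.dim (L \<inter> M) \<le> vec.dim (vec.span (set es))"
      using dim[OF refl free_e(1)] dimLM by simp
  qed simp
  then have span_e: "vec.span (L \<inter> M \<inter> \<Delta>) = L \<inter> M" by (simp only: E(1) span_mspan[OF R])
  have span_F: "vec.span ((L + M) \<inter> \<Delta>) = L + M" by (simp only: Fdelta span_mspan[OF R] span_f)
  show ?thesis
    using E(1) free_e(1) Ldelta free_l Mdelta free_m Fdelta free_f span_e span_F free_mle len_f sub
    by (intro exI conjI)
qed

lemma lattice_d_submodular:
  fixes L M \<Delta> :: "('k ^ 'n::{finite,linorder}) set" and emb :: "'f::{field,finite} \<Rightarrow> 'a::field"
  assumes bez: "bezout R" and \<Delta>: "\<Delta> = mspan R ds" "mfree UNIV ds"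
    and L: "vec.subspace L" "L \<inter> \<Delta> = mspan R lb" "mfree UNIV lb" "vec.span (L \<inter> \<Delta>) = L"
    and M: "vec.subspace M" "M \<inter> \<Delta> = mspan R mb" "mfree UNIV mb" "vec.span (M \<inter> \<Delta>) = M"
  shows "lattice_d w R \<Delta> (L \<inter> M) * lattice_d w R \<Delta> (L + M) \<le> lattice_d w R \<Delta> L * lattice_d w R \<Delta> M"
    and "covol emb w R (L \<inter> M \<inter> \<Delta>) * covol emb w R ((L + M) \<inter> \<Delta>) \<le> covol emb w R (L \<inter> \<Delta>) * covol emb w R (M \<inter> \<Delta>)"
proof -
  obtain es ls ms fs where E: "L \<inter> M \<inter> \<Delta> = mspan R es" "mfree UNIV es"
    and LE: "L \<inter> \<Delta> = mspan R (ls @ es)" "mfree UNIV (ls @ es)"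
    and ME: "M \<inter> \<Delta> = mspan R (ms @ es)" "mfree UNIV (ms @ es)"
    and F: "(L + M) \<inter> \<Delta> = mspan R fs" "mfree UNIV fs"
    and spans: "vec.span (L \<inter> M \<inter> \<Delta>) = L \<inter> M" "vec.span ((L + M) \<inter> \<Delta>) = L + M"
    and MLE: "mfree UNIV (ms @ ls @ es)" "length fs = length (ms @ ls @ es)" "set (ms @ ls @ es) \<subseteq> mspan R fs"
    using lattice_submodular[OF assms] by (elim exE conjE)
  have norm_f: "ext_norm w (wedge_list fs) \<le> ext_norm w (wedge_list (ms @ ls @ es))"
  proof -
    have span: "vec.span (set (ms @ ls @ es)) \<subseteq> vec.span (set fs)"
      using vec.span_mono[OF MLE(3)] by (simp only: span_mspan[OF R])
    have "vec.span (set (ms @ ls @ es)) = vec.span (set fs)"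
    proof (rule vec.subspace_dim_equal[OF _ _ span])
      show "vec.dim (vec.span (set fs)) \<le> vec.dim (vec.span (set (ms @ ls @ es)))"
        using MLE(1,2) F(2) unfolding vec.dim_span mfree_UNIV_iff_dim by simp
    qed simp_all
    then have "set fs \<subseteq> mspan UNIV (ms @ ls @ es)"
      unfolding mspan_UNIV by (metis vec.span_superset)
    then show ?thesis using MLE(2,3) by (intro ext_norm_sublattice) auto
  qed
  define dL dM dE dF where "dL = ext_norm w (wedge_list (ls @ es))" and "dM = ext_norm w (wedge_list (ms @ es))"
    and "dE = ext_norm w (wedge_list es)" and "dF = ext_norm w (wedge_list fs)"
  have main: "dE * dF \<le> dL * dM"
  proof -
    have "dE * dF \<le> dE * ext_norm w (wedge_list (ms @ ls @ es))"
      unfolding dE_def dF_def by (intro mult_left_mono norm_f ext_norm_nonneg[OF w q])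
    also have "\<dots> \<le> dL * dM"
      unfolding dE_def dL_def dM_def by (rule ext_norm_submodular[OF w q E(2)])
    finally show ?thesis .
  qed
  \<comment> \<open>The first claim uses \<Delta> itself as the lattice, whereas
    \<open>covol\<close> passes an intersection such as \<open>W \<inter> \<Delta>\<close>; both
    have the same intersection with \<open>W\<close>.\<close>
  have d: "lattice_d w R D W = ext_norm w (wedge_list us)"
    if "W \<inter> \<Delta> = mspan R us" "mfree UNIV us" "W \<inter> D = W \<inter> \<Delta>" for W D and us :: "('k, 'n) vec list"
    using that by (intro lattice_d_eq) auto
  show "lattice_d w R \<Delta> (L \<inter> M) * lattice_d w R \<Delta> (L + M) \<le> lattice_d w R \<Delta> L * lattice_d w R \<Delta> M"
    using main unfolding d[OF E refl] d[OF F refl] d[OF LE refl] d[OF ME refl] dE_def dF_def dL_def dM_def .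
  define p where "p = real CARD('f)"
  have p: "p > 0" by (simp add: p_def)
  have covol: "covol emb w R (W \<inter> \<Delta>) = p powi ((genus emb - 1) * int (vec.dim W)) * ext_norm w (wedge_list us)"
    if "W \<inter> \<Delta> = mspan R us" "mfree UNIV us" "vec.span (W \<inter> \<Delta>) = W" for W and us :: "('k, 'n) vec list"
    using d[OF that(1,2), of "W \<inter> \<Delta>"] unfolding covol_def that(3) p_def by (simp add: Int_assoc[symmetric])
  have LM_eq: "L + M = {x + y |x y. x \<in> L \<and> y \<in> M}" by (auto simp: set_plus_def)
  have dims: "vec.dim (L \<inter> M) + vec.dim (L + M) = vec.dim L + vec.dim M"
    unfolding LM_eq using vec.dim_sums_Int[OF L(1) M(1)] by simp
  define g where "g = genus emb - 1"
  \<comment> \<open>By the dimension formula the powers of the field size on both sides agree, so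
    the covolume inequality is the first one times a positive constant.\<close>
  have pow: "p powi (g * int (vec.dim (L \<inter> M))) * p powi (g * int (vec.dim (L + M))) =
      p powi (g * int (vec.dim L)) * p powi (g * int (vec.dim M))"
    using p dims by (simp add: power_int_add[symmetric] distrib_left[symmetric] flip: of_nat_add)
  have "covol emb w R (L \<inter> M \<inter> \<Delta>) * covol emb w R ((L + M) \<inter> \<Delta>) =
      (p powi (g * int (vec.dim L)) * p powi (g * int (vec.dim M))) * (dE * dF)"
    unfolding covol[OF E spans(1)] covol[OF F spans(2)] g_def[symmetric] dE_def[symmetric] dF_def[symmetric] pow[symmetric]
    by (simp only: mult_ac)
  also have "\<dots> \<le> (p powi (g * int (vec.dim L)) * p powi (g * int (vec.dim M))) * (dL * dM)"
    using p by (intro mult_left_mono main) auto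
  also have "\<dots> = covol emb w R (L \<inter> \<Delta>) * covol emb w R (M \<inter> \<Delta>)"
    unfolding covol[OF LE L(4)] covol[OF ME M(4)] g_def[symmetric] dL_def[symmetric] dM_def[symmetric]
    by (simp only: mult_ac)
  finally show "covol emb w R (L \<inter> M \<inter> \<Delta>) * covol emb w R ((L + M) \<inter> \<Delta>) \<le> covol emb w R (L \<inter> \<Delta>) * covol emb w R (M \<inter> \<Delta>)" .
qed

end


section \<open>Bezout identities in the affine algebra\<close>

lemma affine_algebra_subring:
  assumes P: "principal_domain (affine_algebra \<nu>)"
  shows "is_subring (carrier (affine_algebra \<nu>))"
proof -
  interpret principal_domain "affine_algebra \<nu>" by (rule P)
  have ops: "x \<oplus>\<^bsub>affine_algebra \<nu>\<^esub> y = x + y" "x \<otimes>\<^bsub>affine_algebra \<nu>\<^esub> y = x * y"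
    "\<zero>\<^bsub>affine_algebra \<nu>\<^esub> = 0" "\<one>\<^bsub>affine_algebra \<nu>\<^esub> = 1" for x y
    by (simp_all add: affine_algebra_def)
  \<comment> \<open>The ring record carries no negation, so the additive inverse of the ring is
    identified with that of the field.\<close>
  have minus: "- x \<in> carrier (affine_algebra \<nu>)" if x: "x \<in> carrier (affine_algebra \<nu>)" for x
  proof -
    have "x + (\<ominus>\<^bsub>affine_algebra \<nu>\<^esub> x) = 0" using r_neg[OF x] by (simp only: ops)
    then have "- x = \<ominus>\<^bsub>affine_algebra \<nu>\<^esub> x" by (rule Groups.minus_unique)
    then show ?thesis using a_inv_closed[OF x] by simp
  qed
  show ?thesis
    unfolding is_subring_def
    using zero_closed one_closed add.m_closed m_closed minus by (simp add: ops)
qed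

text \<open>\<open>g\<close> generates the sum of the principal ideals of \<open>a\<close> and
  \<open>b\<close>. Membership of \<open>a\<close> and \<open>b\<close> in the ideal of
  \<open>g\<close> gives the cofactors, and membership of \<open>g\<close> in the sum gives the
  coefficients.\<close>

lemma affine_algebra_bezout:
  assumes P: "principal_domain (affine_algebra \<nu>)" and a: "a \<in> carrier (affine_algebra \<nu>)" and b: "b \<in> carrier (affine_algebra \<nu>)"
  shows "\<exists>g\<in>carrier (affine_algebra \<nu>). \<exists>\<alpha>\<in>carrier (affine_algebra \<nu>). \<exists>\<beta>\<in>carrier (affine_algebra \<nu>).
    \<exists>s\<in>carrier (affine_algebra \<nu>). \<exists>t\<in>carrier (affine_algebra \<nu>). a = g * \<alpha> \<and> b = g * \<beta> \<and> g = s * a + t * b"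
proof -
  interpret principal_domain "affine_algebra \<nu>" by (rule P)
  let ?A = "affine_algebra \<nu>"
  have ops: "x \<oplus>\<^bsub>?A\<^esub> y = x + y" "x \<otimes>\<^bsub>?A\<^esub> y = x * y" "\<zero>\<^bsub>?A\<^esub> = 0" "\<one>\<^bsub>?A\<^esub> = 1" for x y
    by (simp_all add: affine_algebra_def)
  note sub = is_subringD[OF affine_algebra_subring[OF P]]
  have PIdl_eq: "PIdl\<^bsub>?A\<^esub> c = (\<lambda>s. s * c) ` carrier ?A" for c
    by (auto simp: cgenideal_def ops)
  then have PIdl: "x \<in> PIdl\<^bsub>?A\<^esub> c \<longleftrightarrow> (\<exists>s\<in>carrier ?A. x = s * c)" for x c by auto
  have sum: "x \<in> PIdl\<^bsub>?A\<^esub> a <+>\<^bsub>?A\<^esub> PIdl\<^bsub>?A\<^esub> b \<longleftrightarrow> (\<exists>s\<in>carrier ?A. \<exists>t\<in>carrier ?A. x = s * a + t * b)" for x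
    unfolding set_add_def' PIdl_eq by (auto simp: ops)
  obtain g where g: "g \<in> carrier ?A" "PIdl\<^bsub>?A\<^esub> a <+>\<^bsub>?A\<^esub> PIdl\<^bsub>?A\<^esub> b = PIdl\<^bsub>?A\<^esub> g"
    using exists_gen[OF add_ideals[OF cgenideal_ideal[OF a] cgenideal_ideal[OF b]]] by (elim bexE)
  have "a \<in> PIdl\<^bsub>?A\<^esub> g" unfolding g(2)[symmetric] sum
    by (rule bexI[of _ 1], rule bexI[of _ 0]) (use sub(1,2) in auto)
  then obtain \<alpha> where \<alpha>: "\<alpha> \<in> carrier ?A" "a = \<alpha> * g" unfolding PIdl by auto
  have "b \<in> PIdl\<^bsub>?A\<^esub> g" unfolding g(2)[symmetric] sum
    by (rule bexI[of _ 0], rule bexI[of _ 1]) (use sub(1,2) in auto)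
  then obtain \<beta> where \<beta>: "\<beta> \<in> carrier ?A" "b = \<beta> * g" unfolding PIdl by auto
  have "g \<in> PIdl\<^bsub>?A\<^esub> g" unfolding PIdl by (rule bexI[of _ 1]) (use sub(2) in auto)
  then obtain s t where st: "s \<in> carrier ?A" "t \<in> carrier ?A" "g = s * a + t * b"
    unfolding g(2)[symmetric] sum by auto
  show ?thesis
    by (rule bexI[OF _ g(1)], rule bexI[OF _ \<alpha>(1)], rule bexI[OF _ \<beta>(1)], rule bexI[OF _ st(1)], rule bexI[OF _ st(2)])
      (intro conjI trans[OF \<alpha>(2) mult.commute] trans[OF \<beta>(2) mult.commute] st(3))
qed

lemma field_embedding_subring:
  assumes h: "field_embedding h" and A: "is_subring A"
  shows "is_subring (h ` A)"
proof -
  note h_simps = field_embedding_simps[OF h] and A = is_subringD[OF A]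
  have "0 \<in> h ` A" "1 \<in> h ` A"
    by (metis h_simps(1) A(1) imageI, metis h_simps(2) A(2) imageI)
  moreover have "- x \<in> h ` A" if "x \<in> h ` A" for x
    using that A(3) by (auto simp: h_simps(5)[symmetric])
  moreover have "x + y \<in> h ` A \<and> x * y \<in> h ` A" if "x \<in> h ` A" "y \<in> h ` A" for x y
    using that A(4,5) by (auto simp: h_simps(3,4)[symmetric])
  ultimately show ?thesis by (simp add: is_subring_def)
qed

section \<open>Consequences of discreteness\<close>

lemma submodule_power: "submodule_over R D \<Longrightarrow> r \<in> R \<Longrightarrow> x \<in> D \<Longrightarrow> r ^ t *s x \<in> D"
proof (induction t)
  case (Suc t)
  then have "r *s (r ^ t *s x) \<in> D" by (intro submodule_overD(3)[OF Suc.prems(1,2)])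
  then show ?case by simp
qed simp

text \<open>If the residue field is infinite, its cardinality is \<open>0\<close> and the absolute value of every element
  of nonzero valuation is \<open>0\<close>; a lattice is not discrete for such an absolute value.\<close>

lemma discrete_imp_finite_residue_field:
  fixes D :: "('k::field ^ 'n::finite) set"
  assumes w: "discrete_valuation w" and D: "submodule_over R D" "discrete_in w D"
    and x: "x \<in> D" "x \<noteq> 0" and r: "r \<in> R" "r \<noteq> 0" "w r < 0"
  shows "card (residue_field w) \<noteq> 0"
proof
  assume q: "card (residue_field w) = 0"
  obtain \<epsilon> where \<epsilon>: "\<epsilon> > 0" "\<forall>y\<in>D. (\<forall>i. vabs w (y $ i - 0 $ i) < \<epsilon>) \<longrightarrow> y = 0"
    using bspec[OF D(2)[unfolded discrete_in_def] submodule_overD(1)[OF D(1)]] by (elim exE conjE)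
  \<comment> \<open>\<open>t\<close> exceeds the values of all coordinates in absolute value, so no
    nonzero coordinate of \<open>r ^ t *s x\<close> has value 0. A nonzero power of the cardinality
    0 is 0, hence all these coordinates have absolute value 0.\<close>
  define t where "t = Suc (\<Sum>i\<in>UNIV. nat \<bar>w (x $ i)\<bar>)"
  have "vabs w ((r ^ t *s x) $ i) < \<epsilon>" for i
  proof (cases "x $ i = 0")
    case True
    then show ?thesis using \<epsilon>(1) by (simp add: vabs_def)
  next
    case False
    have "nat \<bar>w (x $ i)\<bar> \<le> (\<Sum>i\<in>UNIV. nat \<bar>w (x $ i)\<bar>)" by (rule member_le_sum) auto
    then have "int (nat \<bar>w (x $ i)\<bar>) < int t" unfolding t_def by linarith
    then have "\<bar>w (x $ i)\<bar> < int t" by simp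
    moreover have "int t * w r \<le> int t * (- 1)" using r(3) by (intro mult_left_mono) auto
    ultimately have "int t * w r + w (x $ i) \<noteq> 0" by linarith
    then show ?thesis using \<epsilon>(1) r(2) False by (simp add: vabs_def q val_mult[OF w] val_power[OF w])
  qed
  then have "r ^ t *s x = 0" using bspec[OF \<epsilon>(2) submodule_power[OF D(1) r(1) x(1), of t]] by simp
  then show False using r(2) x(2) by simp
qed

text \<open>Otherwise the vectors \<open>r ^ t *s x\<close> would be nonzero members of
  \<open>D\<close> tending to 0.\<close>

lemma discrete_imp_vabs_ge_1:
  fixes D :: "('k::field ^ 'n::finite) set"
  assumes w: "discrete_valuation w" and q: "card (residue_field w) \<noteq> 0" and D: "submodule_over R D" "discrete_in w D"
    and x: "x \<in> D" "x \<noteq> 0" and r: "r \<in> R" "r \<noteq> 0"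
  shows "1 \<le> vabs w r"
proof (rule ccontr)
  assume "\<not> 1 \<le> vabs w r"
  obtain \<epsilon> where \<epsilon>: "\<epsilon> > 0" "\<forall>y\<in>D. (\<forall>i. vabs w (y $ i - 0 $ i) < \<epsilon>) \<longrightarrow> y = 0"
    using bspec[OF D(2)[unfolded discrete_in_def] submodule_overD(1)[OF D(1)]] by (elim exE conjE)
  define m where "m = 1 + (\<Sum>i\<in>UNIV. vabs w (x $ i))"
  have m: "vabs w (x $ i) \<le> m" for i
    using member_le_sum[of i UNIV "\<lambda>i. vabs w (x $ i)"] vabs_nonneg[OF w q] by (simp add: m_def)
  have "m > 0" unfolding m_def using vabs_nonneg[OF w q] by (intro add_pos_nonneg sum_nonneg) auto
  have "vabs w r < 1" using \<open>\<not> 1 \<le> vabs w r\<close> by simp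
  then obtain t where t: "vabs w r ^ t < \<epsilon> / m"
    using real_arch_pow_inv[of "\<epsilon> / m" "vabs w r"] \<epsilon>(1) \<open>m > 0\<close> by auto
  have pow: "vabs w (r ^ t) = vabs w r ^ t" by (induction t) (simp_all add: vabs_1[OF w q] vabs_mult[OF w q])
  have "vabs w ((r ^ t *s x) $ i) < \<epsilon>" for i
  proof -
    have "vabs w ((r ^ t *s x) $ i) = vabs w r ^ t * vabs w (x $ i)"
      by (simp add: vabs_mult[OF w q] pow)
    also have "\<dots> \<le> vabs w r ^ t * m" using m vabs_nonneg[OF w q] by (intro mult_left_mono) auto
    also have "\<dots> < \<epsilon>" using t \<open>m > 0\<close> by (simp add: field_simps)
    finally show ?thesis .
  qed
  then have "r ^ t *s x = 0" using bspec[OF \<epsilon>(2) submodule_power[OF D(1) r(1) x(1), of t]] by simp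
  then show False using r(2) x(2) by simp
qed

lemma rational_subspace_basis:
  assumes "rational_subspace w R D W"
  shows "vec.subspace W \<and> vec.span (W \<inter> D) = W \<and> (\<exists>us. W \<inter> D = mspan R us \<and> mfree UNIV us)"
proof (intro conjI)
  show W: "vec.subspace W" using assms by (simp add: rational_subspace_def)
  have lat: "is_lattice w R (W \<inter> D) W" using assms by (simp add: rational_subspace_def)
  then show "\<exists>us. W \<inter> D = mspan R us \<and> mfree UNIV us"
    by (intro lattice_basis_list) (simp add: is_lattice_def)
  show "vec.span (W \<inter> D) = W"
  proof (rule vec.subspace_dim_equal[OF _ W])
    show "vec.span (W \<inter> D) \<subseteq> W" by (intro vec.span_minimal W) auto
    show "vec.dim W \<le> vec.dim (vec.span (W \<inter> D))"
      using lat by (simp add: is_lattice_def lattice_rank_def)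
  qed simp
qed

theorem theorem1p4:
  fixes emb :: "'f::{field,finite} \<Rightarrow> 'a::field"
    and \<nu> :: "'a \<Rightarrow> int"
    and \<iota> :: "'a \<Rightarrow> 'k::field"
    and w :: "'k \<Rightarrow> int"
    and R :: "'k set"
    and \<Delta> L M :: "('k ^ 'n::{finite,linorder}) set"
  assumes "curve_function_field emb"
    and "discrete_valuation \<nu>"
    and "is_completion \<nu> \<iota> w"
    and "R = \<iota> ` carrier (affine_algebra \<nu>)"
    and "principal_domain (affine_algebra \<nu>)"
    and "is_lattice w R \<Delta> UNIV"
    and "rational_subspace w R \<Delta> L"
    and "rational_subspace w R \<Delta> M"
  shows "lattice_d w R \<Delta> L * lattice_d w R \<Delta> M
           \<ge> lattice_d w R \<Delta> (L \<inter> M) * lattice_d w R \<Delta> (L + M)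
       \<and> covol emb w R (L \<inter> \<Delta>) * covol emb w R (M \<inter> \<Delta>)
           \<ge> covol emb w R (L \<inter> M \<inter> \<Delta>) * covol emb w R ((L + M) \<inter> \<Delta>)"
proof -
  let ?A = "carrier (affine_algebra \<nu>)"
  have \<iota>: "field_embedding \<iota>" and w: "discrete_valuation w" and w\<iota>: "\<And>x. w (\<iota> x) = \<nu> x"
    using assms(3) by (auto simp: is_completion_def)
  note h = field_embedding_simps[OF \<iota>]
  have R: "is_subring R"
    unfolding assms(4) by (rule field_embedding_subring[OF \<iota> affine_algebra_subring[OF assms(5)]])
  have bez: "bezout R"
    unfolding bezout_def
  proof (intro ballI)
    fix a b assume "a \<in> R" "b \<in> R"
    then obtain a' b' where ab: "a' \<in> ?A" "b' \<in> ?A" "a = \<iota> a'" "b = \<iota> b'" unfolding assms(4) by auto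
    obtain g \<alpha> \<beta> s t where g: "g \<in> ?A" "\<alpha> \<in> ?A" "\<beta> \<in> ?A" "s \<in> ?A" "t \<in> ?A"
      "a' = g * \<alpha>" "b' = g * \<beta>" "g = s * a' + t * b'"
      using affine_algebra_bezout[OF assms(5) ab(1,2)] by (elim bexE conjE)
    have eqs: "a = \<iota> g * \<iota> \<alpha>" "b = \<iota> g * \<iota> \<beta>" "\<iota> g = \<iota> s * a + \<iota> t * b"
      unfolding ab(3,4) h(3,4)[symmetric] by (rule arg_cong[OF g(6)] arg_cong[OF g(7)] arg_cong[OF g(8)])+
    show "\<exists>g\<in>R. \<exists>\<alpha>\<in>R. \<exists>\<beta>\<in>R. \<exists>s\<in>R. \<exists>t\<in>R. a = g * \<alpha> \<and> b = g * \<beta> \<and> g = s * a + t * b"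
      unfolding assms(4)
      by (rule bexI[OF _ imageI[OF g(1)]], rule bexI[OF _ imageI[OF g(2)]], rule bexI[OF _ imageI[OF g(3)]],
          rule bexI[OF _ imageI[OF g(4)]], rule bexI[OF _ imageI[OF g(5)]], intro conjI eqs)
  qed
  have sub: "submodule_over R \<Delta>" and disc: "discrete_in w \<Delta>" and "\<exists>B. lattice_basis R \<Delta> B"
    and rank: "lattice_rank \<Delta> = vec.dim (UNIV :: ('k, 'n) vec set)"
    using assms(6) by (auto simp: is_lattice_def)
  obtain ds where ds: "\<Delta> = mspan R ds" "mfree UNIV ds"
    using lattice_basis_list[OF \<open>\<exists>B. lattice_basis R \<Delta> B\<close>] by auto
  \<comment> \<open>Both consequences of discreteness concern multiples of a nonzero vector of
    \<Delta>. Full rank provides one, because the index type is nonempty.\<close>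
  have "\<not> \<Delta> \<subseteq> {0}"
  proof
    assume "\<Delta> \<subseteq> {0}"
    then have "vec.dim \<Delta> = 0" by (simp only: vec.dim_eq_0)
    then show False using rank by (simp add: lattice_rank_def card_cart_basis del: vec.dim_eq_0)
  qed
  then obtain x where x: "x \<in> \<Delta>" "x \<noteq> 0" by auto
  obtain r where r: "r \<in> ?A" "r \<noteq> 0" "\<nu> r < 0"
    using affine_algebra_pole[OF assms(1,2)] by auto
  have q: "card (residue_field w) \<noteq> 0"
    by (rule discrete_imp_finite_residue_field[OF w sub disc x, of "\<iota> r"])
      (use r h(6) in \<open>auto simp: assms(4) w\<iota>\<close>)
  have large: "1 \<le> vabs w r" if "r \<in> R" "r \<noteq> 0" for r
    by (rule discrete_imp_vabs_ge_1[OF w q sub disc x that])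
  obtain lb where L: "vec.subspace L" "L \<inter> \<Delta> = mspan R lb" "mfree UNIV lb" "vec.span (L \<inter> \<Delta>) = L"
    using rational_subspace_basis[OF assms(7)] by auto
  obtain mb where M: "vec.subspace M" "M \<inter> \<Delta> = mspan R mb" "mfree UNIV mb" "vec.span (M \<inter> \<Delta>) = M"
    using rational_subspace_basis[OF assms(8)] by auto
  show ?thesis
    by (intro conjI lattice_d_submodular[OF w q R large bez ds L M])
qed

end
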